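(* Let $G$ be a group acting on a non-empty set $S$. Then the abstract twisted Brin--Thompson group $SV_G$ has property NL.
   Context: Property NL ("No Loxodromics"): a group $\Gamma$ has property NL if every isometric action of $\Gamma$ on a Gromov-hyperbolic space $X$ is elliptic (bounded orbits) or parabolic, also called horocyclic (the limit set $\overline{\Gamma x}\cap\partial X$ is a single point); equivalently, no element of $\Gamma$ acts as a loxodromic isometry in any isometric action on a hyperbolic space, where $g$ is loxodromic (hyperbolic) if $n\mapsto g^nx$ is a quasi-isometric embedding of $\mathbb Z$ into $X$ for some (equivalently every) $x\in X$. Abstract twisted Brin--Thompson groups. Let $G$ act on the left on a non-empty set $S$ (not necessarily faithfully). Let $C=\{0,1\}^{\mathbb N}$ be the Cantor set, $C^S$ the space of functions $S\to C$ with the product topology, and $C^S(m)$ the disjoint union of $m$ copies of $C^S$ ($m\ge 1$). For $\psi\colon S\to\{0,1\}^*$ (finite words) with $\psi(s)$ empty for all but finitely many $s$, the dyadic brick $B(\psi)$ is $\{\kappa\in C^S\mid \psi(s)\text{ is a prefix of }\kappa(s)\ \forall s\}$, with canonical homeomorphism $h_\psi\colon C^S\to B(\psi)$, $h_\psi(\kappa)(s)=\psi(s)\cdot\kappa(s)$. The Brin--Thompson groupoid $S\mathcal V$ consists of all homeomorphisms $C^S(m)\to C^S(n)$ obtained by partitioning domain and range into the same finite number of dyadic bricks (inside the copies of $C^S$) and mapping domain bricks to range bricks via canonical homeomorphisms $h_\varphi\circ h_\psi^{-1}$. It contains, for $s\in S$, the simple split $x_s\colon C^S\to C^S(2)$ (sending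 the half where $\kappa(s)$ starts with $0$, resp. $1$, to the first, resp. second, copy by deleting that first letter of $\kappa(s)$), and for $\sigma\in\Sigma_n$ the permutation $p_\sigma$ of the copies in $C^S(n)$ (copy $i$ goes to copy $\sigma(i)$); it has an obvious direct sum $\oplus$ (juxtaposition). The groupoid $S\mathcal V_G$ has objects the positive integers and is generated by $S\mathcal V$ together with, for each $n$, a copy of $G^n$ based at the object $n$ (with $(g_1,\dots,g_n)$ also written $g_1\oplus\cdots\oplus g_n$), subject to the set of relations that is closed under compositions and direct sums and contains $x_{g.s}\circ g=(g\oplus g)\circ x_s$ for $s\in S,g\in G$, and $(g_1\oplus\cdots\oplus g_n)\circ p_\sigma=p_\sigma\circ(g_{\sigma(1)}\oplus\cdots\oplus g_{\sigma(n)})$ for $\sigma\in\Sigma_n$, $g_i\in G$. The group $SV_G$ is the group of morphisms of $S\mathcal V_G$ from the object $1$ to itself. (Equivalently, letting $G$ act on $C^S$ by $(g\kappa)(s)=\kappa(g^{-1}.s)$, $SV_G$ is the group of pairs $(h,\gamma)$, $h$ a homeomorphism of $C^S$ and $\gamma\colon C^S\to G$, for which there are finite partitions of $C^S$ into dyadic bricks $B(\psi_1),\dots,B(\psi_n)$ and $B(\varphi_1),\dots,B(\varphi_n)$ and $g_1,\dots,g_n\in G$ with $h|_{B(\psi_i)}=h_{\varphi_i}\circ g_i\circ h_{\psi_i}^{-1}$ and $\gamma|_{B(\psi_i)}\equiv g_i$; the product is $(h,\gamma)(h',\gamma')=(hh',\ \kappa\mapsto\gamma(h'(\kappa))\gamma'(\kappa))$.)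 *)

theory Defs
  imports "HOL-Analysis.Analysis" "HOL-Algebra.Group_Action"
begin

section \<open>Gromov-hyperbolic spaces, their boundary, and property NL\<close>

definition gromov_product :: "('x \<Rightarrow> 'x \<Rightarrow> real) \<Rightarrow> 'x \<Rightarrow> 'x \<Rightarrow> 'x \<Rightarrow> real" where
  "gromov_product d p x y = (d x p + d y p - d x y) / 2"

text \<open>Gromov's four-point condition; the space is not required to be geodesic or proper.\<close>

definition gromov_hyperbolic :: "'x set \<Rightarrow> ('x \<Rightarrow> 'x \<Rightarrow> real) \<Rightarrow> bool" where
  "gromov_hyperbolic M d \<longleftrightarrow> Metric_space M d \<and>
     (\<exists>\<delta>. \<forall>p\<in>M. \<forall>x\<in>M. \<forall>y\<in>M. \<forall>z\<in>M.
        gromov_product d p x z \<ge> min (gromov_product d p x y) (gromov_product d p y z) - \<delta>)"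

definition diverge_together ::
  "'x set \<Rightarrow> ('x \<Rightarrow> 'x \<Rightarrow> real) \<Rightarrow> (nat \<Rightarrow> 'x) \<Rightarrow> (nat \<Rightarrow> 'x) \<Rightarrow> bool" where
  "diverge_together M d \<sigma> \<tau> \<longleftrightarrow>
     (\<forall>p\<in>M. filterlim (\<lambda>(m, n). gromov_product d p (\<sigma> m) (\<tau> n)) at_top (sequentially \<times>\<^sub>F sequentially))"

text \<open>Sequences converging to infinity. Two of them define the same boundary point iff their mutual
  Gromov products tend to infinity.\<close>

definition gromov_sequences :: "'x set \<Rightarrow> ('x \<Rightarrow> 'x \<Rightarrow> real) \<Rightarrow> (nat \<Rightarrow> 'x) set" where
  "gromov_sequences M d = {\<sigma>. range \<sigma> \<subseteq> M \<and> diverge_together M d \<sigma> \<sigma>}"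

definition gromov_boundary :: "'x set \<Rightarrow> ('x \<Rightarrow> 'x \<Rightarrow> real) \<Rightarrow> (nat \<Rightarrow> 'x) set set" where
  "gromov_boundary M d =
     gromov_sequences M d //
       {(\<sigma>, \<tau>). \<sigma> \<in> gromov_sequences M d \<and> \<tau> \<in> gromov_sequences M d \<and> diverge_together M d \<sigma> \<tau>}"

text \<open>A sequence of points converges to the boundary point \<open>\<xi>\<close> iff it is a representative of \<open>\<xi>\<close>,
  so this is the set of boundary points in the closure of \<open>A\<close> in the union of the space and its
  boundary.\<close>

definition boundary_closure ::
  "'x set \<Rightarrow> ('x \<Rightarrow> 'x \<Rightarrow> real) \<Rightarrow> 'x set \<Rightarrow> (nat \<Rightarrow> 'x) set set" where
  "boundary_closure M d A = {\<xi> \<in> gromov_boundary M d. \<exists>\<sigma>\<in>\<xi>. range \<sigma> \<subseteq> A}"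

definition isometric_action ::
  "('a, 'm) monoid_scheme \<Rightarrow> 'x set \<Rightarrow> ('x \<Rightarrow> 'x \<Rightarrow> real) \<Rightarrow> ('a \<Rightarrow> 'x \<Rightarrow> 'x) \<Rightarrow> bool" where
  "isometric_action \<Gamma> M d \<phi> \<longleftrightarrow> group_action \<Gamma> M \<phi> \<and>
     (\<forall>g\<in>carrier \<Gamma>. \<forall>x\<in>M. \<forall>y\<in>M. d (\<phi> g x) (\<phi> g y) = d x y)"

definition elliptic_action ::
  "('a, 'm) monoid_scheme \<Rightarrow> 'x set \<Rightarrow> ('x \<Rightarrow> 'x \<Rightarrow> real) \<Rightarrow> ('a \<Rightarrow> 'x \<Rightarrow> 'x) \<Rightarrow> bool" where
  "elliptic_action \<Gamma> M d \<phi> \<longleftrightarrow> (\<forall>x\<in>M. Metric_space.mbounded M d (Group_Action.orbit \<Gamma> \<phi> x))"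

definition parabolic_action ::
  "('a, 'm) monoid_scheme \<Rightarrow> 'x set \<Rightarrow> ('x \<Rightarrow> 'x \<Rightarrow> real) \<Rightarrow> ('a \<Rightarrow> 'x \<Rightarrow> 'x) \<Rightarrow> bool" where
  "parabolic_action \<Gamma> M d \<phi> \<longleftrightarrow>
     (\<exists>\<xi>. \<forall>x\<in>M. boundary_closure M d (Group_Action.orbit \<Gamma> \<phi> x) = {\<xi>})"

text \<open>HOL cannot quantify over types inside a definition, so the type of points of the space acted
  upon is a parameter; property NL is \<open>property_NL TYPE('x) \<Gamma>\<close> for an arbitrary type variable \<open>'x\<close>.\<close>

definition property_NL :: "'x itself \<Rightarrow> ('a, 'm) monoid_scheme \<Rightarrow> bool" where
  "property_NL _ \<Gamma> \<longleftrightarrow> group \<Gamma> \<and>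
     (\<forall>(M :: 'x set) d \<phi>. gromov_hyperbolic M d \<longrightarrow> isometric_action \<Gamma> M d \<phi> \<longrightarrow>
        elliptic_action \<Gamma> M d \<phi> \<or> parabolic_action \<Gamma> M d \<phi>)"

section \<open>Abstract twisted Brin--Thompson groups\<close>

text \<open>The letters 0 and 1 are \<^const>\<open>False\<close> and \<^const>\<open>True\<close>; the points of the cube \<open>C\<^sup>S\<close> are functions
  that are extensional on \<open>S\<close>.\<close>

type_synonym 's cantor_point = "'s \<Rightarrow> nat \<Rightarrow> bool"

definition cantor_space :: "(nat \<Rightarrow> bool) topology" where
  "cantor_space = product_topology (\<lambda>_. discrete_topology UNIV) UNIV"

definition cantor_cube :: "'s set \<Rightarrow> 's cantor_point topology" where
  "cantor_cube S = product_topology (\<lambda>_. cantor_space) S"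

abbreviation cube_points :: "'s set \<Rightarrow> 's cantor_point set" where
  "cube_points S \<equiv> topspace (cantor_cube S)"

definition prefix_of :: "bool list \<Rightarrow> (nat \<Rightarrow> bool) \<Rightarrow> bool" where
  "prefix_of w x \<longleftrightarrow> (\<forall>i<length w. x i = w ! i)"

definition prepend :: "bool list \<Rightarrow> (nat \<Rightarrow> bool) \<Rightarrow> nat \<Rightarrow> bool" where
  "prepend w x = (\<lambda>n. if n < length w then w ! n else x (n - length w))"

definition brick_labels :: "'s set \<Rightarrow> ('s \<Rightarrow> bool list) set" where
  "brick_labels S = {\<psi>. finite {s \<in> S. \<psi> s \<noteq> []}}"

definition brick :: "'s set \<Rightarrow> ('s \<Rightarrow> bool list) \<Rightarrow> 's cantor_point set" where
  "brick S \<psi> = {\<kappa> \<in> cube_points S. \<forall>s\<in>S. prefix_of (\<psi> s) (\<kappa> s)}"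

definition canonical_map :: "'s set \<Rightarrow> ('s \<Rightarrow> bool list) \<Rightarrow> 's cantor_point \<Rightarrow> 's cantor_point" where
  "canonical_map S \<psi> \<kappa> = (\<lambda>s\<in>S. prepend (\<psi> s) (\<kappa> s))"

definition brick_partition :: "'s set \<Rightarrow> nat \<Rightarrow> (nat \<Rightarrow> 's \<Rightarrow> bool list) \<Rightarrow> bool" where
  "brick_partition S n \<psi> \<longleftrightarrow>
     (\<forall>i<n. \<psi> i \<in> brick_labels S) \<and>
     disjoint_family_on (\<lambda>i. brick S (\<psi> i)) {..<n} \<and>
     (\<Union>i<n. brick S (\<psi> i)) = cube_points S"

definition cube_action ::
  "('g, 'm) monoid_scheme \<Rightarrow> 's set \<Rightarrow> ('g \<Rightarrow> 's \<Rightarrow> 's) \<Rightarrow> 'g \<Rightarrow> 's cantor_point \<Rightarrow> 's cantor_point" where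
  "cube_action G S \<alpha> g \<kappa> = (\<lambda>s\<in>S. \<kappa> (\<alpha> (inv\<^bsub>G\<^esub> g) s))"

text \<open>Since the canonical map \<open>h\<^sub>\<psi>\<close> is a bijection onto the brick of \<open>\<psi>\<close>, the condition that \<open>h\<close>
  restricts to \<open>h\<^sub>\<phi> \<circ> g \<circ> h\<^sub>\<psi>\<^sup>-\<^sup>1\<close> there is written as \<open>h \<circ> h\<^sub>\<psi> = h\<^sub>\<phi> \<circ> g\<close>.\<close>

definition SVG_elements ::
  "('g, 'm) monoid_scheme \<Rightarrow> 's set \<Rightarrow> ('g \<Rightarrow> 's \<Rightarrow> 's) \<Rightarrow>
     (('s cantor_point \<Rightarrow> 's cantor_point) \<times> ('s cantor_point \<Rightarrow> 'g)) set" where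
  "SVG_elements G S \<alpha> = {(h, \<gamma>).
     h \<in> extensional (cube_points S) \<and>
     homeomorphic_map (cantor_cube S) (cantor_cube S) h \<and>
     \<gamma> \<in> cube_points S \<rightarrow>\<^sub>E carrier G \<and>
     (\<exists>n \<psi> \<phi> g. brick_partition S n \<psi> \<and> brick_partition S n \<phi> \<and>
        (\<forall>i<n. g i \<in> carrier G \<and>
           (\<forall>\<kappa>\<in>cube_points S.
              h (canonical_map S (\<psi> i) \<kappa>) = canonical_map S (\<phi> i) (cube_action G S \<alpha> (g i) \<kappa>)) \<and>
           (\<forall>\<kappa>\<in>brick S (\<psi> i). \<gamma> \<kappa> = g i)))}"

definition SVG ::
  "('g, 'm) monoid_scheme \<Rightarrow> 's set \<Rightarrow> ('g \<Rightarrow> 's \<Rightarrow> 's) \<Rightarrow>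
     (('s cantor_point \<Rightarrow> 's cantor_point) \<times> ('s cantor_point \<Rightarrow> 'g)) monoid" where
  "SVG G S \<alpha> =
     \<lparr>carrier = SVG_elements G S \<alpha>,
      mult = (\<lambda>(h, \<gamma>) (h', \<gamma>').
        (compose (cube_points S) h h', \<lambda>\<kappa>\<in>cube_points S. \<gamma> (h' \<kappa>) \<otimes>\<^bsub>G\<^esub> \<gamma>' \<kappa>)),
      one = (\<lambda>\<kappa>\<in>cube_points S. \<kappa>, \<lambda>\<kappa>\<in>cube_points S. \<one>\<^bsub>G\<^esub>)\<rparr>"

end

theory Submission
  imports Defs "HOL-Real_Asymp.Real_Asymp"
begin

text \<open>
  An element of \<open>SV\<^sub>G\<close> is identified with a permutation of \<open>C\<^sup>S \<times> G\<close> that is locally given by the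
  maps \<open>(\<kappa>, a) \<mapsto> (h\<^sub>\<psi> (g \<kappa>), g a)\<close>. Suppose that the group acts on a hyperbolic space.

  Let \<open>t\<close> be a loxodromic element supported in a proper brick. The elements supported in a disjoint
  brick commute with \<open>t\<close>, hence quasi-preserve its axis, and the translation along the axis is a
  homogeneous quasimorphism on them. Since there are arbitrarily many commuting copies of such an
  element, the quasimorphism is a homomorphism to the reals, and every such homomorphism that does not
  change under passing to a smaller brick vanishes. But a conjugate of \<open>t\<close> with disjoint support is
  loxodromic and commutes with \<open>t\<close>, so that it does translate along the axis: a contradiction.

  Every element is a product of three elements that each fix one of four given bricks. If the groups
  of elements fixing these bricks have bounded orbits, so has the whole group. Otherwise they share
  a unique limit point whose horofunction they all quasi-preserve; then so does the whole group, which
  therefore contains no loxodromic element. Without loxodromic elements an action is elliptic or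
  parabolic.
\<close>

section \<open>Loxodromic elements for hyperbolic left-invariant metrics\<close>

text \<open>All geometry takes place on the group itself, with the pseudometric
  \<open>d (g x) (h x)\<close> of an orbit, because the spaces need not be geodesic. An axis is
  present only through the powers of \<open>t\<close>, its end through the numbers
  \<open>D g (t^n) - len (t^n)\<close>, and a common limit point through long elements supported in
  one fixed brick. The obstacle is that translation along an axis is additive only up to a bounded
  error. The product of the copies of one element in \<open>k\<close> disjoint bricks translates
  \<open>k\<close> times as far as a single copy and depends multiplicatively on the element, so the
  error for one copy is at most the bound divided by \<open>k\<close>. The resulting homomorphism
  \<open>p\<close> vanishes by self-similarity: an element of \<open>G\<close>, and likewise the
  element that turns a cut along one coordinate into a cut along another, equals its own copies on
  two halves of the cube up to factors on which \<open>p\<close> is 0, so that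
  \<open>p b = 2 * p b\<close>. Together with swaps, which are involutions, such elements match any
  two partitions obtained by the same number of cuts.\<close>

lemma exp_exceeds_affine:
  fixes c A B :: real
  assumes "c > 0"
  shows "\<exists>j::nat. c * 2 ^ j > A + B * real j"
proof -
  have "filterlim (\<lambda>j::nat. c * 2 ^ j - (A + B * real j)) at_top sequentially"
    using assms by real_asymp
  then have "\<forall>Z. eventually (\<lambda>j::nat. Z < c * 2 ^ j - (A + B * real j)) sequentially"
    by (subst (asm) filterlim_at_top_dense)
  from spec[OF this, of 0] have "eventually (\<lambda>j::nat. c * 2 ^ j - (A + B * real j) > 0) sequentially" .
  then obtain j :: nat where "c * 2 ^ j - (A + B * real j) > 0"
    by (meson eventually_sequentially order_refl)
  then show ?thesis by (intro exI[of _ j]) simp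
qed

text \<open>The intervals from \<open>(u n - D) / n\<close> to \<open>(u n + D) / n\<close> meet
  pairwise, since \<open>u (m * n)\<close> is close to both \<open>m * u n\<close> and
  \<open>n * u m\<close>; the supremum of their left ends therefore lies in all of them. The bound
  stays \<open>D\<close>, so homogenizing loses nothing.\<close>

lemma almost_additive_imp_near_linear:
  fixes u :: "nat \<Rightarrow> real"
  assumes "\<And>m n. \<bar>u (m + n) - u m - u n\<bar> \<le> D"
  shows "\<exists>r. \<forall>n. \<bar>u n - real n * r\<bar> \<le> D"
proof -
  have D0: "D \<ge> 0" using assms[of 0 0] by linarith
  have mult: "\<bar>u (Suc k * n) - real (Suc k) * u n\<bar> \<le> real k * D" for k n
  proof (induction k)
    case (Suc k)
    have "u (Suc (Suc k) * n) = u (Suc k * n + n)" by (simp add: algebra_simps)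
    then have "\<bar>u (Suc (Suc k) * n) - u (Suc k * n) - u n\<bar> \<le> D" using assms by simp
    then show ?case using Suc by (simp add: algebra_simps del: mult_Suc)
  qed simp
  define U where "U = (\<lambda>n. (u n - D) / real n) ` {1..}"
  have cmp: "(u n - D) / real n \<le> (u m + D) / real m" if "n \<ge> 1" "m \<ge> 1" for m n
  proof -
    have a: "\<bar>u (m * n) - real m * u n\<bar> \<le> real (m - 1) * D" using mult[of "m - 1" n] that by simp
    have b: "\<bar>u (m * n) - real n * u m\<bar> \<le> real (n - 1) * D"
      using mult[of "n - 1" m] that by (simp add: mult.commute)
    have "real m * u n - real n * u m \<le> real (m - 1) * D + real (n - 1) * D"
      using a b by linarith
    also have "\<dots> \<le> real m * D + real n * D"
      using D0 by (intro add_mono mult_right_mono) auto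
    finally show ?thesis using that by (simp add: field_simps)
  qed
  have bdd: "bdd_above U" unfolding U_def using cmp[of _ 1] by (auto intro!: bdd_aboveI2)
  have "\<bar>u n - real n * Sup U\<bar> \<le> D" for n
  proof (cases "n = 0")
    case True
    then show ?thesis using assms[of 0 0] by simp
  next
    case False
    then have "(u n - D) / real n \<le> Sup U"
      using bdd by (intro cSup_upper) (auto simp: U_def)
    moreover have "Sup U \<le> (u n + D) / real n"
      using cmp[of _ n] False by (intro cSup_least) (auto simp: U_def)
    ultimately show ?thesis using False by (simp add: field_simps abs_le_iff)
  qed
  then show ?thesis by blast
qed

lemma linear_bounded_imp_zero:
  fixes x B :: real
  assumes "\<And>n::nat. real n * \<bar>x\<bar> \<le> B"
  shows "x = 0"
proof (rule ccontr)
  assume "x \<noteq> 0"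
  then obtain n :: nat where "real n * \<bar>x\<bar> > B"
    using reals_Archimedean3[of "\<bar>x\<bar>"] by auto
  then show False using assms[of n] by simp
qed

text \<open>Made for the orbit metrics \<open>d (\<phi> g x) (\<phi> h x)\<close>: only a
  pseudometric, because elements of a stabilizer have distance 0 from the identity.
  \<open>D_four\<close> is Gromov's condition without a base point: of the three sums of opposite
  distances, the two largest differ by at most \<delta>.\<close>

locale hyperbolic_metric_group = group G for G (structure) +
  fixes D :: "'a \<Rightarrow> 'a \<Rightarrow> real" and \<delta> :: real
  assumes D_refl: "g \<in> carrier G \<Longrightarrow> D g g = 0"
    and D_sym: "\<lbrakk>g \<in> carrier G; h \<in> carrier G\<rbrakk> \<Longrightarrow> D g h = D h g"
    and D_triangle: "\<lbrakk>g \<in> carrier G; h \<in> carrier G; k \<in> carrier G\<rbrakk> \<Longrightarrow> D g k \<le> D g h + D h k"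
    and D_left: "\<lbrakk>k \<in> carrier G; g \<in> carrier G; h \<in> carrier G\<rbrakk> \<Longrightarrow> D (k \<otimes> g) (k \<otimes> h) = D g h"
    and D_four: "\<lbrakk>a \<in> carrier G; b \<in> carrier G; c \<in> carrier G; d \<in> carrier G\<rbrakk> \<Longrightarrow>
        D a b + D c d \<le> max (D a c + D b d) (D a d + D b c) + \<delta>"
begin

definition len :: "'a \<Rightarrow> real" where
  "len g = D \<one> g"

text \<open>\<open>lox\<close> is a sufficient criterion for being loxodromic that depends on the base point, \<open>lin\<close> is the
  conjugacy invariant notion.\<close>

definition lox :: "'a \<Rightarrow> bool" where
  "lox g \<longleftrightarrow> len (g \<otimes> g) > len g + 2 * \<delta>"

definition lin :: "'a \<Rightarrow> bool" where
  "lin g \<longleftrightarrow> (\<exists>c>0. \<exists>C. \<forall>n::nat. len (g [^] n) \<ge> c * real n - C)"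

lemma D_four_cases:
  assumes "a \<in> carrier G" "b \<in> carrier G" "c \<in> carrier G" "d \<in> carrier G"
  obtains "D a b + D c d \<le> D a c + D b d + \<delta>" | "D a b + D c d \<le> D a d + D b c + \<delta>"
  using D_four[OF assms] by (cases "D a c + D b d \<le> D a d + D b c") auto

lemma delta_nonneg: "\<delta> \<ge> 0"
  using D_four[of \<one> \<one> \<one> \<one>] D_refl[of \<one>] by simp

lemma D_len: "\<lbrakk>g \<in> carrier G; h \<in> carrier G\<rbrakk> \<Longrightarrow> D g h = len (inv g \<otimes> h)"
  unfolding len_def using D_left[of "inv g" g h] by (simp add: l_inv)

lemma len_one [simp]: "len \<one> = 0"
  by (simp add: len_def D_refl)

lemma len_inv [simp]: "g \<in> carrier G \<Longrightarrow> len (inv g) = len g"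
  using D_len[of g \<one>] D_sym[of g \<one>] by (simp add: len_def)

lemma D_one_right: "g \<in> carrier G \<Longrightarrow> D g \<one> = len g"
  by (simp add: len_def D_sym)

lemma D_nonneg: "\<lbrakk>g \<in> carrier G; h \<in> carrier G\<rbrakk> \<Longrightarrow> D g h \<ge> 0"
  using D_triangle[of g h g] D_sym[of g h] D_refl[of g] by simp

lemma len_nonneg: "g \<in> carrier G \<Longrightarrow> len g \<ge> 0"
  by (simp add: len_def D_nonneg)

lemma len_mult: "\<lbrakk>g \<in> carrier G; h \<in> carrier G\<rbrakk> \<Longrightarrow> len (g \<otimes> h) \<le> len g + len h"
  using D_triangle[of \<one> g "g \<otimes> h"] D_left[of g \<one> h] by (simp add: len_def)

lemma D_pow: "g \<in> carrier G \<Longrightarrow> D (g [^] (m::nat)) (g [^] (m + n)) = len (g [^] n)"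
  using D_left[of "g [^] m" \<one> "g [^] n"] by (simp add: len_def nat_pow_mult)

lemma D_pow_le:
  assumes "g \<in> carrier G" "m \<le> n"
  shows "D (g [^] (m::nat)) (g [^] n) = len (g [^] (n - m))"
    and "D (g [^] n) (g [^] (m::nat)) = len (g [^] (n - m))"
  using D_pow[OF assms(1), of m "n - m"] assms by (auto simp: D_sym)

lemma len_square_le: "g \<in> carrier G \<Longrightarrow> len (g \<otimes> g) \<le> 2 * len g"
  using len_mult[of g g] by simp

text \<open>Apply the four-point condition to \<open>1\<close>, \<open>g^2\<close>, \<open>g\<close>
  and \<open>g^(n+2)\<close>. One alternative would make \<open>g^(n+1)\<close> shorter than
  \<open>g^n\<close>, against the previous step, as the gain
  \<open>len (g g) - len g - \<delta>\<close> is positive; the other alternative is the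
  claim.\<close>

lemma lox_step:
  assumes g: "g \<in> carrier G" and "lox g"
  shows "len (g [^] Suc n) \<ge> len (g [^] n) + (len (g \<otimes> g) - len g - \<delta>)"
proof (induction n)
  case 0
  then show ?case using len_square_le[OF g] delta_nonneg g by simp
next
  case (Suc n)
  let ?L = "len (g \<otimes> g) - len g - \<delta>"
  have L: "?L > \<delta>" using assms(2) by (simp add: lox_def)
  have e: "g [^] (2::nat) = g \<otimes> g" using g by (simp add: numeral_2_eq_2)
  have "D (g [^] (0::nat)) (g [^] (2::nat)) + D (g [^] (1::nat)) (g [^] (Suc (Suc n)))
      \<le> max (D (g [^] (0::nat)) (g [^] (1::nat)) + D (g [^] (2::nat)) (g [^] (Suc (Suc n))))
            (D (g [^] (0::nat)) (g [^] (Suc (Suc n))) + D (g [^] (2::nat)) (g [^] (1::nat))) + \<delta>"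
    using g by (intro D_four) auto
  then have "len (g \<otimes> g) + len (g [^] Suc n) \<le>
      max (len g + len (g [^] n)) (len (g [^] Suc (Suc n)) + len g) + \<delta>"
    using D_pow_le[OF g, of 0 2] D_pow_le[OF g, of 1 "Suc (Suc n)"] D_pow_le[OF g, of 0 1]
      D_pow_le[OF g, of 2 "Suc (Suc n)"] D_pow_le[OF g, of 0 "Suc (Suc n)"] D_pow_le[OF g, of 1 2] g e
    by (simp del: nat_pow_Suc nat_pow_0)
  then show ?case using Suc L delta_nonneg by linarith
qed

lemma lox_mono:
  assumes g: "g \<in> carrier G" and "lox g"
  shows "len (g [^] (n::nat)) \<ge> real n * (len (g \<otimes> g) - len g - \<delta>)"
proof (induction n)
  case (Suc n)
  then show ?case using lox_step[OF assms, of n] by (simp add: algebra_simps)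
qed simp

lemma lox_gap_pos: "lox g \<Longrightarrow> len (g \<otimes> g) - len g - \<delta> > \<delta>"
  by (simp add: lox_def)

text \<open>The powers run along a quasigeodesic, so the triangle inequality between them is sharp
  up to a constant. The competing alternative of the four-point condition would let one more factor
  in each of the two powers gain at most \<delta> in total, whereas by \<open>lox_step\<close> each
  of them gains more than \<delta>.\<close>

lemma lox_quasi_additive:
  assumes g: "g \<in> carrier G" and "lox g"
  shows "len (g [^] (m::nat)) + len (g [^] (n::nat)) \<le> len (g [^] (m + n)) + len g + \<delta>"
proof (cases n)
  case 0
  then show ?thesis using len_nonneg[OF g] delta_nonneg by simp
next
  case (Suc k)
  have "D (g [^] (0::nat)) (g [^] Suc m) + D (g [^] m) (g [^] (Suc m + k))
      \<le> max (D (g [^] (0::nat)) (g [^] m) + D (g [^] Suc m) (g [^] (Suc m + k)))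
            (D (g [^] (0::nat)) (g [^] (Suc m + k)) + D (g [^] Suc m) (g [^] m)) + \<delta>"
    using g by (intro D_four) auto
  then have "len (g [^] Suc m) + len (g [^] Suc k)
      \<le> max (len (g [^] m) + len (g [^] k)) (len (g [^] (Suc m + k)) + len g) + \<delta>"
    using g D_pow_le[OF g, of m "Suc m"] D_pow_le[OF g, of m "Suc m + k"] D_pow[OF g, of "Suc m" k]
      D_pow_le[OF g, of 0 "Suc m"] D_pow_le[OF g, of 0 m] D_pow_le[OF g, of 0 "Suc m + k"]
    by (simp del: nat_pow_Suc nat_pow_0)
  then show ?thesis
    using lox_step[OF assms, of m] lox_step[OF assms, of k] lox_gap_pos[OF assms(2)] delta_nonneg Suc
    by (simp del: nat_pow_Suc)
qed

lemma lox_imp_lin: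
  assumes g: "g \<in> carrier G" and "lox g"
  shows "lin g"
  unfolding lin_def
  apply (rule exI[of _ "len (g \<otimes> g) - len g - \<delta>"])
  using lox_gap_pos[OF assms(2)] lox_mono[OF assms] delta_nonneg
  by (metis (no_types, lifting) diff_zero le_less_trans mult.commute)

text \<open>If no power is \<open>lox\<close>, each doubling of the exponent adds at most
  \<open>2 * \<delta>\<close>, so the lengths of \<open>g^(2^j)\<close> grow at most linearly in
  \<open>j\<close>, against linear growth in \<open>2^j\<close>.\<close>

lemma lin_imp_lox_pow:
  assumes g: "g \<in> carrier G" and "lin g"
  shows "\<exists>k. lox (g [^] (k::nat))"
proof (rule ccontr)
  assume no: "\<not> ?thesis"
  from assms(2) obtain c C where c: "c > 0" "\<And>n::nat. len (g [^] n) \<ge> c * real n - C"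
    unfolding lin_def by blast
  have up: "len (g [^] ((2::nat) ^ j)) \<le> len g + 2 * \<delta> * j" for j
  proof (induction j)
    case (Suc j)
    have "g [^] ((2::nat) ^ Suc j) = g [^] ((2::nat) ^ j) \<otimes> g [^] ((2::nat) ^ j)"
      using g by (simp add: nat_pow_mult mult_2)
    then have "len (g [^] ((2::nat) ^ Suc j)) \<le> len (g [^] ((2::nat) ^ j)) + 2 * \<delta>"
      using no by (metis lox_def not_le_imp_less)
    then show ?case using Suc by (simp add: algebra_simps)
  qed (use g in simp)
  have le: "c * 2 ^ j \<le> C + len g + 2 * \<delta> * j" for j :: nat
    using up[of j] c(2)[of "2 ^ j"] by simp
  obtain j :: nat where "c * 2 ^ j > C + len g + 2 * \<delta> * j"
    using exp_exceeds_affine[OF c(1)] by blast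
  then show False using le[of j] by simp
qed

lemma inv_cancel_left [simp]:
  "\<lbrakk>w \<in> carrier G; x \<in> carrier G\<rbrakk> \<Longrightarrow> inv w \<otimes> (w \<otimes> x) = x"
  "\<lbrakk>w \<in> carrier G; x \<in> carrier G\<rbrakk> \<Longrightarrow> w \<otimes> (inv w \<otimes> x) = x"
  by (simp_all add: m_assoc[symmetric])

lemma pow_conj:
  assumes "w \<in> carrier G" "g \<in> carrier G"
  shows "(w \<otimes> g \<otimes> inv w) [^] (n::nat) = w \<otimes> g [^] n \<otimes> inv w"
proof (induction n)
  case (Suc n)
  have "(w \<otimes> g \<otimes> inv w) [^] Suc n = w \<otimes> g [^] n \<otimes> inv w \<otimes> (w \<otimes> g \<otimes> inv w)"
    by (simp add: Suc)
  also have "\<dots> = w \<otimes> g [^] n \<otimes> (inv w \<otimes> w) \<otimes> g \<otimes> inv w"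
    using assms by (simp add: m_assoc del: l_inv)
  finally show ?case using assms by (simp add: m_assoc)
qed (use assms in simp)

lemma lin_conj:
  assumes w: "w \<in> carrier G" and g: "g \<in> carrier G" and "lin g"
  shows "lin (w \<otimes> g \<otimes> inv w)"
proof -
  from assms(3) obtain c C where c: "c > 0" "\<And>n::nat. len (g [^] n) \<ge> c * real n - C"
    unfolding lin_def by blast
  have "len ((w \<otimes> g \<otimes> inv w) [^] n) \<ge> c * real n - (C + 2 * len w)" for n :: nat
  proof -
    have "g [^] n = inv w \<otimes> (w \<otimes> g [^] n \<otimes> inv w) \<otimes> w"
      using w g by (simp add: m_assoc)
    then have "len (g [^] n) \<le> len (inv w \<otimes> (w \<otimes> g [^] n \<otimes> inv w)) + len w"
      using w g by (metis inv_closed len_mult m_closed nat_pow_closed)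
    also have "\<dots> \<le> len (inv w) + len (w \<otimes> g [^] n \<otimes> inv w) + len w"
      using w g len_mult[of "inv w" "w \<otimes> g [^] n \<otimes> inv w"] by simp
    finally show ?thesis using c(2)[of n] w g by (simp add: pow_conj)
  qed
  then show ?thesis unfolding lin_def using c(1) by blast
qed

text \<open>If \<open>D g h\<close> is much larger than both lengths, then \<open>1, g, gh, ghg, \<dots>\<close> is a local quasigeodesic,
  so that \<open>gh\<close> is loxodromic. The products in the proof are Gromov products based at \<open>1\<close>.\<close>

lemma D_le_max_len:
  assumes g: "g \<in> carrier G" and h: "h \<in> carrier G"
    and "\<not> lox g" "\<not> lox h" "\<not> lox (g \<otimes> h)"
  shows "D g h \<le> max (len g) (len h) + 20 * \<delta>"
proof (rule ccontr)
  assume big: "\<not> ?thesis"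
  define pr where "pr u v = (len u + len v - D u v) / 2" for u v
  have pr3: "pr u w \<ge> min (pr u v) (pr v w) - \<delta> / 2"
    if "u \<in> carrier G" "v \<in> carrier G" "w \<in> carrier G" for u v w
    using D_four[of u w v \<one>] that by (simp add: pr_def D_one_right min_def max_def D_sym field_simps split: if_splits)
  have prs: "pr u v = pr v u" if "u \<in> carrier G" "v \<in> carrier G" for u v
    using that by (simp add: pr_def D_sym)
  \<comment> \<open>Not being \<open>lox\<close> means that \<open>u\<close> and its inverse leave
    \<open>1\<close> in nearly the same direction for half of \<open>len u\<close>. Hence either of
    \<open>g\<close> and \<open>h\<close> may be replaced by its inverse in the small product
    \<open>pr g h\<close>.\<close>
  have self: "pr u (inv u) \<ge> len u / 2 - \<delta>" if "u \<in> carrier G" "\<not> lox u" for u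
  proof -
    have "D (inv u) u = len (u \<otimes> u)" using that by (simp add: D_len)
    then show ?thesis using that by (simp add: pr_def lox_def D_sym field_simps)
  qed
  let ?u = "g \<otimes> h" and ?a = "len g" and ?b = "len h"
  have u: "?u \<in> carrier G" using g h by simp
  have gh: "pr g h < min ?a ?b / 2 - 10 * \<delta>"
    using big by (simp add: pr_def min_def max_def field_simps split: if_splits)
  have d0: "\<delta> \<ge> 0" by (rule delta_nonneg)
  have 1: "pr g (inv h) \<le> pr g h + \<delta> / 2"
    using pr3[of g "inv h" h] prs[of h "inv h"] self[of h] gh g h assms d0 by (simp add: min_def split: if_splits)
  have 2: "pr (inv g) h \<le> pr g h + \<delta> / 2"
    using pr3[of g "inv g" h] self[of g] gh g h assms d0 by (simp add: min_def split: if_splits)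
  have Du: "len ?u = ?a + ?b - 2 * pr (inv g) h"
    using D_len[of "inv g" h] g h by (simp add: pr_def field_simps)
  have ug: "pr g ?u = ?a - pr (inv g) h"
    using D_left[of g \<one> h] Du g h by (simp add: pr_def len_def)
  have "D (inv ?u) (inv h) = ?a"
    using D_left[of "inv h" "inv g" \<one>] g h by (simp add: inv_mult_group D_one_right)
  then have uh: "pr (inv ?u) (inv h) = ?b - pr (inv g) h"
    using Du g h u by (simp add: pr_def)
  \<comment> \<open>Along \<open>g\<close>, \<open>gh\<close>, \<open>inv (gh)\<close>,
    \<open>inv h\<close> all consecutive products are large, the middle one because
    \<open>gh\<close> is not \<open>lox\<close>. So the product of \<open>g\<close> and
    \<open>inv h\<close> would be large as well, against the fact labelled 1.\<close>
  have "pr g (inv h) \<ge> min (pr g ?u) (pr ?u (inv h)) - \<delta> / 2"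
    using pr3[of g ?u "inv h"] g h by simp
  moreover have "pr ?u (inv h) \<ge> min (pr ?u (inv ?u)) (pr (inv ?u) (inv h)) - \<delta> / 2"
    using pr3[of ?u "inv ?u" "inv h"] u h by simp
  moreover have "pr ?u (inv ?u) \<ge> len ?u / 2 - \<delta>"
    using self[OF u] assms by simp
  ultimately show False
    using Du ug uh 1 2 gh d0 by (simp add: min_def field_simps split: if_splits)
qed

section \<open>Centralizers and the Busemann quasimorphism\<close>

definition centr :: "'a \<Rightarrow> 'a set" where
  "centr t = {g \<in> carrier G. g \<otimes> t = t \<otimes> g}"

lemma centr_carrier [simp]: "g \<in> centr t \<Longrightarrow> g \<in> carrier G"
  by (simp add: centr_def)

lemma centr_one [simp]: "t \<in> carrier G \<Longrightarrow> \<one> \<in> centr t"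
  by (simp add: centr_def del: centr_carrier)

lemma centr_mult [simp]:
  assumes "t \<in> carrier G" "g \<in> centr t" "h \<in> centr t"
  shows "g \<otimes> h \<in> centr t"
proof -
  have c: "g \<in> carrier G" "h \<in> carrier G" "g \<otimes> t = t \<otimes> g" "h \<otimes> t = t \<otimes> h"
    using assms by (auto simp: centr_def simp del: centr_carrier)
  have "g \<otimes> h \<otimes> t = g \<otimes> (t \<otimes> h)" by (simp only: m_assoc[OF c(1,2) assms(1)] c(4))
  also have "\<dots> = t \<otimes> (g \<otimes> h)"
    by (simp only: m_assoc[OF c(1) assms(1) c(2), symmetric] m_assoc[OF assms(1) c(1,2), symmetric] c(3))
  finally show ?thesis using c by (simp add: centr_def del: centr_carrier)
qed

lemma centr_inv [simp]:
  assumes "t \<in> carrier G" "g \<in> centr t"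
  shows "inv g \<in> centr t"
proof -
  have c: "g \<in> carrier G" "g \<otimes> t = t \<otimes> g" using assms by (auto simp: centr_def simp del: centr_carrier)
  have "inv g \<otimes> t = inv g \<otimes> (t \<otimes> g) \<otimes> inv g" using assms(1) c(1) by (simp add: m_assoc)
  also have "\<dots> = t \<otimes> inv g" using assms(1) c(1) by (simp add: c(2)[symmetric])
  finally show ?thesis using c by (simp add: centr_def del: centr_carrier)
qed

lemma centr_pow [simp]: "\<lbrakk>t \<in> carrier G; g \<in> centr t\<rbrakk> \<Longrightarrow> g [^] (n::nat) \<in> centr t"
  by (induction n) auto

lemma pow_comm:
  assumes "g \<in> carrier G" "t \<in> carrier G" "g \<otimes> t = t \<otimes> g"
  shows "g \<otimes> t [^] (n::nat) = t [^] n \<otimes> g"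
proof (induction n)
  case (Suc n)
  have "g \<otimes> t [^] Suc n = (g \<otimes> t [^] n) \<otimes> t" using assms by (simp add: m_assoc)
  also have "\<dots> = t [^] n \<otimes> (g \<otimes> t)" using assms Suc by (simp add: m_assoc)
  finally show ?case using assms by (simp add: m_assoc)
qed (use assms in simp)

lemma centr_subset_centr_pow: "t \<in> carrier G \<Longrightarrow> centr t \<subseteq> centr (t [^] (n::nat))"
  using pow_comm by (auto simp: centr_def simp del: centr_carrier)

lemma lox_len_unbounded:
  assumes "t \<in> carrier G" "lox t"
  shows "\<exists>N::nat. \<forall>n\<ge>N. len (t [^] n) > B"
proof -
  let ?L = "len (t \<otimes> t) - len t - \<delta>"
  have L: "?L > 0" using lox_gap_pos[OF assms(2)] delta_nonneg by linarith
  obtain N :: nat where N: "B < real N * ?L" using reals_Archimedean3[OF L] by blast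
  have "len (t [^] n) > B" if "n \<ge> N" for n
  proof -
    have "B < real N * ?L" by (rule N)
    also have "\<dots> \<le> real n * ?L" using that L by (intro mult_right_mono) auto
    also have "\<dots> \<le> len (t [^] n)" by (rule lox_mono[OF assms])
    finally show ?thesis .
  qed
  then show ?thesis by blast
qed

text \<open>\<open>D g (t [^] n) - len (t [^] n)\<close> is, up to a bounded error, the Busemann function of the
  attracting fixed point of \<open>t\<close>.\<close>

lemma busemann_exists:
  assumes t: "t \<in> carrier G" and "lox t"
  shows "\<exists>q. \<forall>g\<in>carrier G. \<exists>N::nat. \<forall>n\<ge>N. \<bar>D g (t [^] n) - len (t [^] n) - q g\<bar> \<le> \<delta>"
proof -
  have "\<exists>r. \<exists>N::nat. \<forall>n\<ge>N. \<bar>D g (t [^] n) - len (t [^] n) - r\<bar> \<le> \<delta>" if g: "g \<in> carrier G" for g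
  proof -
    \<comment> \<open>The threshold rules out, in both applications of the four-point condition
      below, the alternative that pairs \<open>g\<close> with \<open>1\<close> and
      \<open>t^m\<close> with \<open>t^n\<close>.\<close>
    obtain m :: nat where m: "\<forall>n\<ge>m. len (t [^] n) > (len t + 2 * len g + 2 * \<delta>) / 2"
      using lox_len_unbounded[OF assms] by blast
    have "\<bar>D g (t [^] n) - len (t [^] n) - (D g (t [^] m) - len (t [^] m))\<bar> \<le> \<delta>" if "n \<ge> m" for n
    proof -
      have a: "len (t [^] m) + len (t [^] (n - m)) \<le> len (t [^] n) + len t + \<delta>"
        using lox_quasi_additive[OF assms, of m "n - m"] that by simp
      have b: "D (t [^] m) (t [^] n) = len (t [^] (n - m))" "D (t [^] n) (t [^] m) = len (t [^] (n - m))"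
        using D_pow_le[OF t that] by auto
      have c: "D g (t [^] n) \<ge> len (t [^] n) - len g" "D g (t [^] m) \<ge> len (t [^] m) - len g"
        using D_triangle[of \<one> g "t [^] n"] D_triangle[of \<one> g "t [^] m"] g t by (auto simp: len_def)
      have f: "2 * len (t [^] m) > len t + 2 * len g + 2 * \<delta>" using m by auto
      have h: "D \<one> (t [^] m) = len (t [^] m)" "D \<one> (t [^] n) = len (t [^] n)"
        "D (t [^] m) \<one> = len (t [^] m)" "D (t [^] n) \<one> = len (t [^] n)" "D g \<one> = len g"
        using g t by (auto simp: len_def D_sym)
      have "D g (t [^] n) + len (t [^] m) \<le> D g (t [^] m) + len (t [^] n) + \<delta>"
        by (rule D_four_cases[of g "t [^] n" \<one> "t [^] m"]) (use a b c f h g t in auto)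
      moreover have "D g (t [^] m) + len (t [^] n) \<le> D g (t [^] n) + len (t [^] m) + \<delta>"
        by (rule D_four_cases[of g "t [^] m" \<one> "t [^] n"]) (use a b c f h g t in auto)
      ultimately show ?thesis by linarith
    qed
    then show ?thesis by blast
  qed
  then show ?thesis by metis
qed

text \<open>As \<open>g\<close> commutes with \<open>t\<close>, the distance of \<open>g h\<close>
  to \<open>t^n\<close> equals that of \<open>h\<close> to \<open>t^n g^-1\<close>, a point at
  distance \<open>len g\<close> from \<open>t^n\<close>. Moving a far point by a bounded amount
  changes its distances from \<open>1\<close> and from \<open>h\<close> equally, up to one \<delta>;
  the other three come from the approximations of \<open>q\<close>.\<close>

lemma busemann_quasimorphism:
  assumes t: "t \<in> carrier G" and "lox t"
    and q: "\<forall>g\<in>carrier G. \<exists>N::nat. \<forall>n\<ge>N. \<bar>D g (t [^] n) - len (t [^] n) - q g\<bar> \<le> \<delta>"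
    and g: "g \<in> centr t" and h: "h \<in> carrier G"
  shows "\<bar>q (g \<otimes> h) - q g - q h\<bar> \<le> 4 * \<delta>"
proof -
  have gc: "g \<in> carrier G" using g by simp
  obtain N1 :: nat where N1: "\<And>n. n \<ge> N1 \<Longrightarrow> \<bar>D g (t [^] n) - len (t [^] n) - q g\<bar> \<le> \<delta>" using q gc by blast
  obtain N2 :: nat where N2: "\<And>n. n \<ge> N2 \<Longrightarrow> \<bar>D h (t [^] n) - len (t [^] n) - q h\<bar> \<le> \<delta>" using q h by blast
  obtain N3 :: nat where N3: "\<And>n. n \<ge> N3 \<Longrightarrow> \<bar>D (g \<otimes> h) (t [^] n) - len (t [^] n) - q (g \<otimes> h)\<bar> \<le> \<delta>"
    using q gc h m_closed by blast
  obtain N4 :: nat where N4: "\<And>n. n \<ge> N4 \<Longrightarrow> len (t [^] n) > len g + len h + \<delta>"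
    using lox_len_unbounded[OF assms(1,2)] by blast
  define n where "n = max (max N1 N2) (max N3 N4)"
  let ?z = "t [^] n" and ?y = "t [^] n \<otimes> inv g"
  have zy: "?z \<in> carrier G" "?y \<in> carrier G" using t gc by auto
  have y: "?y = inv g \<otimes> ?z" using pow_comm[of "inv g" t n] centr_inv[OF t g] t by (auto simp: centr_def simp del: centr_carrier)
  have Dzy: "D ?z ?y = len g" using D_left[of ?z \<one> "inv g"] t gc by (simp add: len_def[symmetric])
  have Dyz: "D ?y ?z = len g" using Dzy zy by (simp add: D_sym)
  have Dy: "D \<one> ?y = D g ?z" unfolding y using D_left[of "inv g" g ?z] gc zy by simp
  have Dhy: "D h ?y = D (g \<otimes> h) ?z" unfolding y using D_left[of "inv g" "g \<otimes> h" ?z] gc h zy by simp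
  have Dz: "D \<one> ?z = len ?z" by (simp add: len_def)
  have h1: "D h \<one> = len h" using h by (simp add: D_one_right)
  have big: "len ?z > len g + len h + \<delta>" using N4[of n] by (simp add: n_def)
  have lower: "D h ?z \<ge> len ?z - len h" using D_triangle[of \<one> h ?z] h zy by (simp add: len_def)
  have lower2: "D g ?z \<ge> len ?z - len g" using D_triangle[of \<one> g ?z] gc zy by (simp add: len_def)
  have lower3: "D h ?y \<ge> len ?z - len h - len g" using D_triangle[of h ?y ?z] h zy lower Dyz by simp
  have s: "D ?y \<one> = D g ?z" "D ?z \<one> = len ?z" using Dy Dz zy by (simp_all add: D_sym)
  note facts = s big lower lower2 lower3 delta_nonneg Dy Dz h1 Dzy Dyz Dhy
  have "D h ?y + len ?z \<le> D h ?z + D g ?z + \<delta>"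
    by (rule D_four_cases[of h ?y \<one> ?z]) (use h zy in simp, use h zy in simp, use h zy in simp,
      use h zy in simp, (use facts in linarith)+)
  moreover have "D h ?z + D g ?z \<le> D h ?y + len ?z + \<delta>"
    by (rule D_four_cases[of h ?z \<one> ?y]) (use h zy in simp, use h zy in simp, use h zy in simp,
      use h zy in simp, (use facts in linarith)+)
  moreover have "\<bar>D g ?z - len ?z - q g\<bar> \<le> \<delta>" "\<bar>D h ?z - len ?z - q h\<bar> \<le> \<delta>"
    "\<bar>D (g \<otimes> h) ?z - len ?z - q (g \<otimes> h)\<bar> \<le> \<delta>"
    using N1[of n] N2[of n] N3[of n] by (simp_all add: n_def)
  ultimately show ?thesis using Dhy by linarith
qed

text \<open>An element commuting with \<open>t\<close> that moves far must move along the axis: the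
  four-point condition for \<open>1\<close>, \<open>g\<close> and the far points \<open>t^n\<close>
  and \<open>t^(-n)\<close> bounds \<open>len g\<close> by how far \<open>g\<close> recedes from one
  of the two ends. Receding from the second end is measured by \<open>q (inv g)\<close>, as
  \<open>D g (t^(-n)) = D (inv g) (t^n)\<close>.\<close>

lemma len_le_busemann:
  assumes t: "t \<in> carrier G" and "lox t"
    and q: "\<forall>g\<in>carrier G. \<exists>N::nat. \<forall>n\<ge>N. \<bar>D g (t [^] n) - len (t [^] n) - q g\<bar> \<le> \<delta>"
    and g: "g \<in> centr t"
  shows "len g \<le> len t + 3 * \<delta> + max (q g) (q (inv g))"
proof -
  have gc: "g \<in> carrier G" using g by simp
  obtain N1 :: nat where N1: "\<And>n. n \<ge> N1 \<Longrightarrow> \<bar>D g (t [^] n) - len (t [^] n) - q g\<bar> \<le> \<delta>" using q gc by blast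
  obtain N2 :: nat where N2: "\<And>n. n \<ge> N2 \<Longrightarrow> \<bar>D (inv g) (t [^] n) - len (t [^] n) - q (inv g)\<bar> \<le> \<delta>"
    using q gc by blast
  define n where "n = max N1 N2"
  let ?z = "t [^] n"
  have z: "?z \<in> carrier G" using t by simp
  have "D \<one> g + D ?z (inv ?z) \<le> max (D \<one> ?z + D g (inv ?z)) (D \<one> (inv ?z) + D g ?z) + \<delta>"
    using gc z by (intro D_four) auto
  moreover have "D ?z (inv ?z) = len (t [^] (n + n))"
    using D_len[of "inv ?z" ?z] z t by (simp add: D_sym nat_pow_mult)
  moreover have "D g (inv ?z) = D (inv g) ?z"
  proof -
    have "D g (inv ?z) = D (?z \<otimes> g) (?z \<otimes> inv ?z)" using gc z by (simp only: D_left inv_closed)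
    also have "\<dots> = len (g \<otimes> ?z)" using gc z pow_comm[of g t n] g t by (simp add: D_one_right centr_def del: centr_carrier)
    finally show ?thesis using gc z by (simp add: D_len)
  qed
  moreover have "len ?z + len ?z \<le> len (t [^] (n + n)) + len t + \<delta>"
    by (rule lox_quasi_additive[OF assms(1,2)])
  moreover have "D \<one> g = len g" "D \<one> ?z = len ?z" "D \<one> (inv ?z) = len ?z"
    using z by (auto simp: len_def[symmetric])
  moreover have "\<bar>D g ?z - len ?z - q g\<bar> \<le> \<delta>" "\<bar>D (inv g) ?z - len ?z - q (inv g)\<bar> \<le> \<delta>"
    using N1[of n] N2[of n] by (simp_all add: n_def)
  ultimately show ?thesis by linarith
qed

lemma homogenization:
  assumes t: "t \<in> carrier G"
    and q: "\<And>g h. \<lbrakk>g \<in> centr t; h \<in> centr t\<rbrakk> \<Longrightarrow> \<bar>q (g \<otimes> h) - q g - q h\<bar> \<le> K"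
  shows "\<exists>p. \<forall>g\<in>centr t. \<forall>n::nat. \<bar>q (g [^] n) - real n * p g\<bar> \<le> K"
proof -
  have "\<exists>r. \<forall>n::nat. \<bar>q (g [^] n) - real n * r\<bar> \<le> K" if g: "g \<in> centr t" for g
  proof (rule almost_additive_imp_near_linear)
    fix m n :: nat
    show "\<bar>q (g [^] (m + n)) - q (g [^] m) - q (g [^] n)\<bar> \<le> K"
      using q[of "g [^] m" "g [^] n"] g t by (simp add: nat_pow_mult)
  qed
  then show ?thesis by metis
qed

text \<open>The homogenized Busemann quasimorphism of a \<open>lox\<close> power of
  \<open>t\<close>. Exact additivity on commuting pairs and invariance under conjugation follow by
  comparing n-th powers, where the values grow with n and the error does not. A zero of
  \<open>q\<close> has powers of bounded length by \<open>len_le_busemann\<close>, hence is not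
  \<open>lin\<close>.\<close>

lemma centralizer_quasimorphism:
  assumes t: "t \<in> carrier G" and "lin t"
  shows "\<exists>(q :: 'a \<Rightarrow> real) K. (\<forall>g\<in>centr t. \<forall>h\<in>centr t. \<bar>q (g \<otimes> h) - q g - q h\<bar> \<le> K)
    \<and> (\<forall>g\<in>centr t. \<forall>h\<in>centr t. g \<otimes> h = h \<otimes> g \<longrightarrow> q (g \<otimes> h) = q g + q h)
    \<and> (\<forall>g\<in>centr t. \<forall>w\<in>centr t. q (w \<otimes> g \<otimes> inv w) = q g)
    \<and> (\<forall>g\<in>centr t. lin g \<longrightarrow> q g \<noteq> 0)"
proof -
  obtain k :: nat where k: "lox (t [^] k)" using lin_imp_lox_pow[OF assms] by blast
  let ?u = "t [^] k"
  have u: "?u \<in> carrier G" using t by simp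
  have cu: "g \<in> centr ?u" if "g \<in> centr t" for g using centr_subset_centr_pow[OF t] that by blast
  obtain q0 where q0: "\<forall>g\<in>carrier G. \<exists>N::nat. \<forall>n\<ge>N. \<bar>D g (?u [^] n) - len (?u [^] n) - q0 g\<bar> \<le> \<delta>"
    using busemann_exists[OF u k] by blast
  define K where "K = 4 * \<delta>"
  have qm: "\<bar>q0 (g \<otimes> h) - q0 g - q0 h\<bar> \<le> K" if "g \<in> centr t" "h \<in> centr t" for g h
    using busemann_quasimorphism[OF u k q0 cu] that by (simp add: K_def)
  obtain q where q: "\<And>g n. g \<in> centr t \<Longrightarrow> \<bar>q0 (g [^] (n::nat)) - real n * q g\<bar> \<le> K"
    using homogenization[OF t qm] by blast
  have near: "\<bar>q0 g - q g\<bar> \<le> K" if "g \<in> centr t" for g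
    using q[OF that, of 1] that by simp
  have c1: "\<bar>q (g \<otimes> h) - q g - q h\<bar> \<le> 4 * K" if "g \<in> centr t" "h \<in> centr t" for g h
    using near[of g] near[of h] near[of "g \<otimes> h"] qm[of g h] that t by (simp add: abs_le_iff)
  have c2: "q (g \<otimes> h) = q g + q h" if g: "g \<in> centr t" and h: "h \<in> centr t" and c: "g \<otimes> h = h \<otimes> g" for g h
  proof -
    have "real n * \<bar>q (g \<otimes> h) - q g - q h\<bar> \<le> 4 * K" for n :: nat
    proof -
      have "(g \<otimes> h) [^] n = g [^] n \<otimes> h [^] n"
        using g h by (intro pow_mult_distrib c) auto
      then have "\<bar>real n * q (g \<otimes> h) - real n * q g - real n * q h\<bar> \<le> 4 * K"
        using q[OF g, of n] q[OF h, of n] q[of "g \<otimes> h" n] qm[of "g [^] n" "h [^] n"] g h t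
        by (simp add: abs_le_iff)
      moreover have "real n * \<bar>q (g \<otimes> h) - q g - q h\<bar> = \<bar>real n * (q (g \<otimes> h) - q g - q h)\<bar>"
        by (simp add: abs_mult)
      ultimately show ?thesis by (simp only: right_diff_distrib)
    qed
    then have "q (g \<otimes> h) - q g - q h = 0" by (rule linear_bounded_imp_zero)
    then show ?thesis by simp
  qed
  have c3: "q (w \<otimes> g \<otimes> inv w) = q g" if g: "g \<in> centr t" and w: "w \<in> centr t" for g w
  proof -
    define B where "B = \<bar>q0 w\<bar> + \<bar>q0 (inv w)\<bar> + 4 * K"
    have "real n * \<bar>q (w \<otimes> g \<otimes> inv w) - q g\<bar> \<le> B" for n :: nat
    proof -
      have "(w \<otimes> g \<otimes> inv w) [^] n = w \<otimes> g [^] n \<otimes> inv w" using g w by (simp add: pow_conj)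
      then have "\<bar>q0 (w \<otimes> g [^] n \<otimes> inv w) - real n * q (w \<otimes> g \<otimes> inv w)\<bar> \<le> K"
        using q[of "w \<otimes> g \<otimes> inv w" n] g w t by simp
      moreover have "\<bar>q0 (w \<otimes> g [^] n \<otimes> inv w) - q0 (w \<otimes> g [^] n) - q0 (inv w)\<bar> \<le> K"
        "\<bar>q0 (w \<otimes> g [^] n) - q0 w - q0 (g [^] n)\<bar> \<le> K" "\<bar>q0 (g [^] n) - real n * q g\<bar> \<le> K"
        using qm q g w t by auto
      ultimately have "\<bar>real n * q (w \<otimes> g \<otimes> inv w) - real n * q g\<bar> \<le> B"
        unfolding B_def by linarith
      moreover have "real n * \<bar>q (w \<otimes> g \<otimes> inv w) - q g\<bar> = \<bar>real n * (q (w \<otimes> g \<otimes> inv w) - q g)\<bar>"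
        by (simp add: abs_mult)
      ultimately show ?thesis by (simp only: right_diff_distrib)
    qed
    then have "q (w \<otimes> g \<otimes> inv w) - q g = 0" by (rule linear_bounded_imp_zero)
    then show ?thesis by simp
  qed
  have c4: "q g \<noteq> 0" if g: "g \<in> centr t" and "lin g" for g
  proof
    assume z: "q g = 0"
    obtain c C where c: "c > 0" "\<And>n::nat. len (g [^] n) \<ge> c * real n - C"
      using \<open>lin g\<close> unfolding lin_def by blast
    have q1: "\<bar>q0 \<one>\<bar> \<le> K" using q[OF g, of 0] by simp
    have "real n * \<bar>c\<bar> \<le> C + len ?u + 3 * \<delta> + 3 * K" for n :: nat
    proof -
      have "len (g [^] n) \<le> len ?u + 3 * \<delta> + max (q0 (g [^] n)) (q0 (inv (g [^] n)))"
        using len_le_busemann[OF u k q0 cu] g t by simp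
      moreover have "\<bar>q0 (g [^] n)\<bar> \<le> K" using q[OF g, of n] z by simp
      moreover have "\<bar>q0 \<one> - q0 (g [^] n) - q0 (inv (g [^] n))\<bar> \<le> K"
        using qm[of "g [^] n" "inv (g [^] n)"] g t by simp
      ultimately have "len (g [^] n) \<le> len ?u + 3 * \<delta> + 3 * K" using q1 by linarith
      then show ?thesis using c(2)[of n] c(1) by (simp add: mult.commute)
    qed
    then have "c = 0" by (rule linear_bounded_imp_zero)
    then show False using c(1) by simp
  qed
  show ?thesis
    by (rule exI[of _ q], rule exI[of _ "4 * K"], intro conjI ballI impI)
      (erule (1) c1, erule (2) c2, erule (1) c3, erule (1) c4)
qed

lemma not_lox_if_bounded_powers:
  assumes "f \<in> carrier G" "\<And>n::nat. len (f [^] n) \<le> R"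
  shows "\<not> lox f"
  using lox_len_unbounded[of f R] assms by (meson not_le order_refl)

text \<open>The point \<open>z\<close> plays the role of a boundary point: the powers of \<open>f\<close> stay within a bounded
  distance of a horosphere.\<close>

lemma not_lox_if_horospherical:
  assumes f: "f \<in> carrier G"
    and z: "\<And>n::nat. \<exists>z\<in>carrier G. \<bar>D (f [^] n) z - len z\<bar> \<le> C \<and> \<bar>D (f [^] (2 * n)) z - len z\<bar> \<le> C"
  shows "\<not> lox f"
proof
  assume l: "lox f"
  \<comment> \<open>Quasi-additivity makes \<open>f^(2n)\<close> about twice as long as
    \<open>f^n\<close>, while lying near the horosphere through \<open>1\<close> forces it to be
    hardly longer than \<open>f^n\<close>.\<close>
  have "len (f [^] n) \<le> 2 * C + len f + 2 * \<delta>" for n :: nat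
  proof -
    obtain z where z: "z \<in> carrier G" "\<bar>D (f [^] n) z - len z\<bar> \<le> C" "\<bar>D (f [^] (2 * n)) z - len z\<bar> \<le> C"
      using assms(2) by blast
    have d: "D (f [^] (2 * n)) (f [^] n) = len (f [^] n)" using D_pow_le(2)[OF f, of n "2 * n"] by simp
    have "len (f [^] (2 * n)) \<le> len (f [^] n) + 2 * C + \<delta>"
    proof (rule D_four_cases[of \<one> "f [^] (2 * n)" "f [^] n" z])
      assume "D \<one> (f [^] (2 * n)) + D (f [^] n) z \<le> D \<one> (f [^] n) + D (f [^] (2 * n)) z + \<delta>"
      then show ?thesis using z(2,3) unfolding len_def by linarith
    next
      assume "D \<one> (f [^] (2 * n)) + D (f [^] n) z \<le> D \<one> z + D (f [^] (2 * n)) (f [^] n) + \<delta>"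
      then show ?thesis using z(2,3) d unfolding len_def by linarith
    qed (use z f in auto)
    moreover have "len (f [^] n) + len (f [^] n) \<le> len (f [^] (2 * n)) + len f + \<delta>"
      using lox_quasi_additive[OF f l, of n n] by (simp only: mult_2)
    ultimately show ?thesis by linarith
  qed
  then show False using not_lox_if_bounded_powers[OF f] l by blast
qed

end

section \<open>From the absence of loxodromics to property NL\<close>

lemma diverge_together_iff:
  "diverge_together M d \<sigma> \<tau> \<longleftrightarrow>
    (\<forall>p\<in>M. \<forall>Z. \<exists>N. \<forall>m\<ge>N. \<forall>n\<ge>N. Z \<le> gromov_product d p (\<sigma> m) (\<tau> n))"
  unfolding diverge_together_def filterlim_at_top eventually_prod_sequentially by fastforce

lemma gromov_hyperbolic_imp_Metric_space: "gromov_hyperbolic M d \<Longrightarrow> Metric_space M d"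
  by (simp add: gromov_hyperbolic_def)

lemma equiv_diverge_together:
  assumes "gromov_hyperbolic M d"
  shows "equiv (gromov_sequences M d)
    {(\<sigma>, \<tau>). \<sigma> \<in> gromov_sequences M d \<and> \<tau> \<in> gromov_sequences M d \<and> diverge_together M d \<sigma> \<tau>}"
proof (rule equivI)
  interpret Metric_space M d by (rule gromov_hyperbolic_imp_Metric_space[OF assms])
  let ?R = "{(\<sigma>, \<tau>). \<sigma> \<in> gromov_sequences M d \<and> \<tau> \<in> gromov_sequences M d \<and> diverge_together M d \<sigma> \<tau>}"
  show "?R \<subseteq> gromov_sequences M d \<times> gromov_sequences M d" by auto
  show "refl_on (gromov_sequences M d) ?R" by (auto simp: refl_on_def gromov_sequences_def)
  show "sym ?R"
  proof (rule symI, clarsimp)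
    fix \<sigma> \<tau> assume s: "\<sigma> \<in> gromov_sequences M d" "\<tau> \<in> gromov_sequences M d" "diverge_together M d \<sigma> \<tau>"
    have "gromov_product d p (\<tau> m) (\<sigma> n) = gromov_product d p (\<sigma> n) (\<tau> m)" for p m n
      by (simp add: gromov_product_def commute)
    then show "diverge_together M d \<tau> \<sigma>" using s(3) unfolding diverge_together_iff by metis
  qed
  show "trans ?R"
  proof (rule transI, clarsimp)
    fix \<sigma> \<tau> \<rho>
    assume s: "\<sigma> \<in> gromov_sequences M d" "\<tau> \<in> gromov_sequences M d" "\<rho> \<in> gromov_sequences M d"
      and st: "diverge_together M d \<sigma> \<tau>" and tr: "diverge_together M d \<tau> \<rho>"
    have M: "\<sigma> n \<in> M" "\<tau> n \<in> M" "\<rho> n \<in> M" for n using s by (auto simp: gromov_sequences_def)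
    obtain \<delta> where delta: "\<And>p x y z. \<lbrakk>p \<in> M; x \<in> M; y \<in> M; z \<in> M\<rbrakk> \<Longrightarrow>
        gromov_product d p x z \<ge> min (gromov_product d p x y) (gromov_product d p y z) - \<delta>"
      using assms unfolding gromov_hyperbolic_def by blast
    show "diverge_together M d \<sigma> \<rho>" unfolding diverge_together_iff
    proof (intro ballI allI)
      fix p Z assume p: "p \<in> M"
      obtain N1 where N1: "\<forall>m\<ge>N1. \<forall>n\<ge>N1. Z + \<delta> \<le> gromov_product d p (\<sigma> m) (\<tau> n)"
        using st p unfolding diverge_together_iff by blast
      obtain N2 where N2: "\<forall>m\<ge>N2. \<forall>n\<ge>N2. Z + \<delta> \<le> gromov_product d p (\<tau> m) (\<rho> n)"
        using tr p unfolding diverge_together_iff by blast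
      have "Z \<le> gromov_product d p (\<sigma> m) (\<rho> n)" if "m \<ge> max N1 N2" "n \<ge> max N1 N2" for m n
      proof -
        let ?k = "max N1 N2"
        have "Z + \<delta> \<le> gromov_product d p (\<sigma> m) (\<tau> ?k)" "Z + \<delta> \<le> gromov_product d p (\<tau> ?k) (\<rho> n)"
          using N1 N2 that by simp_all
        then show ?thesis using delta[OF p M(1) M(2) M(3), of m ?k n] by linarith
      qed
      then show "\<exists>N. \<forall>m\<ge>N. \<forall>n\<ge>N. Z \<le> gromov_product d p (\<sigma> m) (\<rho> n)" by blast
    qed
  qed
qed

lemma orbit_metric_hyperbolic:
  assumes "group \<Gamma>" "gromov_hyperbolic M d" "isometric_action \<Gamma> M d \<phi>" "x \<in> M"
  shows "\<exists>\<delta>. hyperbolic_metric_group \<Gamma> (\<lambda>g h. d (\<phi> g x) (\<phi> h x)) \<delta>"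
proof -
  interpret Metric_space M d by (rule gromov_hyperbolic_imp_Metric_space[OF assms(2)])
  interpret group_action \<Gamma> M \<phi> using assms(3) by (simp add: isometric_action_def)
  have iso: "d (\<phi> g u) (\<phi> g v) = d u v" if "g \<in> carrier \<Gamma>" "u \<in> M" "v \<in> M" for g u v
    using assms(3) that by (simp add: isometric_action_def)
  have inM: "\<phi> g x \<in> M" if "g \<in> carrier \<Gamma>" for g using element_image[OF that assms(4)] by simp
  obtain \<delta> where delta: "\<And>p x y z. \<lbrakk>p \<in> M; x \<in> M; y \<in> M; z \<in> M\<rbrakk> \<Longrightarrow>
      gromov_product d p x z \<ge> min (gromov_product d p x y) (gromov_product d p y z) - \<delta>"
    using assms(2) unfolding gromov_hyperbolic_def by blast
  \<comment> \<open>With \<open>e\<close> as base point the condition on Gromov products takes the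
    symmetric form; the factor 2 undoes the halving in \<open>gromov_product\<close>.\<close>
  have four: "d a b + d c e \<le> max (d a c + d b e) (d a e + d b c) + 2 * \<delta>"
    if "a \<in> M" "b \<in> M" "c \<in> M" "e \<in> M" for a b c e
    using delta[OF that(4) that(1) that(3) that(2)]
    by (simp add: gromov_product_def commute min_def max_def field_simps split: if_splits)
  have "hyperbolic_metric_group_axioms \<Gamma> (\<lambda>g h. d (\<phi> g x) (\<phi> h x)) (2 * \<delta>)"
  proof
    fix g h k assume "g \<in> carrier \<Gamma>" "h \<in> carrier \<Gamma>" "k \<in> carrier \<Gamma>"
    then show "d (\<phi> (k \<otimes>\<^bsub>\<Gamma>\<^esub> g) x) (\<phi> (k \<otimes>\<^bsub>\<Gamma>\<^esub> h) x) = d (\<phi> g x) (\<phi> h x)"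
      using iso inM assms(4) by (simp add: composition_rule)
  next
    fix g h k assume "g \<in> carrier \<Gamma>" "h \<in> carrier \<Gamma>" "k \<in> carrier \<Gamma>"
    then show "d (\<phi> g x) (\<phi> k x) \<le> d (\<phi> g x) (\<phi> h x) + d (\<phi> h x) (\<phi> k x)" using inM triangle by blast
  qed (use inM four commute in auto)
  then show ?thesis using assms(1) by (auto simp: hyperbolic_metric_group_def)
qed

text \<open>Without loxodromics \<open>D_le_max_len\<close> makes the orbit metric an ultrametric up
  to \<open>20 * \<delta>\<close>. Any two orbit points far from \<open>x0\<close> then have a large
  Gromov product, so all escaping sequences, in all orbits, define the same boundary point.\<close>

theorem no_loxodromics_imp_elliptic_or_parabolic:
  assumes \<Gamma>: "group \<Gamma>" and hyp: "gromov_hyperbolic M d" and act: "isometric_action \<Gamma> M d \<phi>"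
    and no_lox: "\<And>x \<delta> g. \<lbrakk>x \<in> M; g \<in> carrier \<Gamma>; hyperbolic_metric_group \<Gamma> (\<lambda>g h. d (\<phi> g x) (\<phi> h x)) \<delta>\<rbrakk>
      \<Longrightarrow> \<not> hyperbolic_metric_group.lox \<Gamma> (\<lambda>g h. d (\<phi> g x) (\<phi> h x)) \<delta> g"
  shows "elliptic_action \<Gamma> M d \<phi> \<or> parabolic_action \<Gamma> M d \<phi>"
proof (rule disjCI)
  assume notp: "\<not> parabolic_action \<Gamma> M d \<phi>"
  interpret Metric_space M d by (rule gromov_hyperbolic_imp_Metric_space[OF hyp])
  interpret group_action \<Gamma> M \<phi> using act by (simp add: isometric_action_def)
  interpret \<Gamma>: group \<Gamma> by (rule \<Gamma>)
  have iso: "d (\<phi> g u) (\<phi> g v) = d u v" if "g \<in> carrier \<Gamma>" "u \<in> M" "v \<in> M" for g u v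
    using act that by (simp add: isometric_action_def)
  have inM: "\<phi> g x \<in> M" if "g \<in> carrier \<Gamma>" "x \<in> M" for g x using element_image[OF that] by simp
  have one: "\<phi> \<one>\<^bsub>\<Gamma>\<^esub> x = x" if "x \<in> M" for x using id_eq_one that by (metis restrict_apply')
  let ?R = "{(\<sigma>, \<tau>). \<sigma> \<in> gromov_sequences M d \<and> \<tau> \<in> gromov_sequences M d \<and> diverge_together M d \<sigma> \<tau>}"
  show "elliptic_action \<Gamma> M d \<phi>"
  proof (rule ccontr)
    assume "\<not> ?thesis"
    then obtain x0 where x0: "x0 \<in> M" "\<not> mbounded (orbit \<Gamma> \<phi> x0)" by (auto simp: elliptic_action_def)
    have unbounded: "\<exists>g\<in>carrier \<Gamma>. d (\<phi> g x0) x0 \<ge> B" for B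
    proof (rule ccontr)
      assume "\<not> ?thesis"
      then have "orbit \<Gamma> \<phi> x0 \<subseteq> mcball x0 B"
        using x0 inM by (auto simp: Group_Action.orbit_def mcball_def commute not_le intro: less_imp_le)
      then show False using x0(2) unfolding mbounded_def by blast
    qed
    obtain \<delta> where hm: "hyperbolic_metric_group \<Gamma> (\<lambda>g h. d (\<phi> g x0) (\<phi> h x0)) \<delta>"
      using orbit_metric_hyperbolic[OF \<Gamma> hyp act x0(1)] by blast
    interpret H: hyperbolic_metric_group \<Gamma> "\<lambda>g h. d (\<phi> g x0) (\<phi> h x0)" \<delta> by (rule hm)
    have len: "H.len g = d (\<phi> g x0) x0" if "g \<in> carrier \<Gamma>" for g
      using that x0 by (simp add: H.len_def one commute)
    have ultra: "d (\<phi> g x0) (\<phi> h x0) \<le> max (d (\<phi> g x0) x0) (d (\<phi> h x0) x0) + 20 * \<delta>"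
      if "g \<in> carrier \<Gamma>" "h \<in> carrier \<Gamma>" for g h
      using H.D_le_max_len[OF that] no_lox[OF x0(1) _ hm] that by (simp add: len)
    have conv: "diverge_together M d (\<lambda>n. \<phi> (u n) x) (\<lambda>n. \<phi> (v n) y)"
      if u: "\<And>n. u n \<in> carrier \<Gamma>" "\<And>Z. \<exists>N. \<forall>n\<ge>N. Z \<le> d (\<phi> (u n) x0) x0"
        and v: "\<And>n. v n \<in> carrier \<Gamma>" "\<And>Z. \<exists>N. \<forall>n\<ge>N. Z \<le> d (\<phi> (v n) x0) x0"
        and xy: "x \<in> M" "y \<in> M" for u v :: "nat \<Rightarrow> _" and x y
      unfolding diverge_together_iff
    proof (intro ballI allI)
      fix p Z assume p: "p \<in> M"
      \<comment> \<open>Passing from the orbit of \<open>x0\<close> to those of \<open>x\<close> and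
        \<open>y\<close>, and from the base point \<open>x0\<close> to \<open>p\<close>, costs these
        distances; \<open>10 * \<delta>\<close> is half of the error in
        \<open>ultra\<close>.\<close>
      define W where "W = 2 * (Z + d x x0 + d y x0 + d p x0 + 10 * \<delta>)"
      obtain N1 where N1: "\<forall>n\<ge>N1. W \<le> d (\<phi> (u n) x0) x0" using u(2) by blast
      obtain N2 where N2: "\<forall>n\<ge>N2. W \<le> d (\<phi> (v n) x0) x0" using v(2) by blast
      have "Z \<le> gromov_product d p (\<phi> (u m) x) (\<phi> (v n) y)" if "m \<ge> max N1 N2" "n \<ge> max N1 N2" for m n
      proof -
        let ?a = "\<phi> (u m) x" and ?c = "\<phi> (u m) x0" and ?b = "\<phi> (v n) y" and ?e = "\<phi> (v n) x0"
        have M: "?a \<in> M" "?c \<in> M" "?b \<in> M" "?e \<in> M" using inM u v xy x0 by auto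
        have "d ?a ?c = d x x0" "d ?b ?e = d y x0"
          using iso[OF u(1) xy(1) x0(1)] iso[OF v(1) xy(2) x0(1)] .
        moreover have "d ?c x0 \<le> d ?a ?c + d ?a p + d p x0" "d ?e x0 \<le> d ?b ?e + d ?b p + d p x0"
          using triangle[OF M(2,1) x0(1)] triangle[OF M(1) p x0(1)] triangle[OF M(4,3) x0(1)] triangle[OF M(3) p x0(1)]
            commute[of ?c ?a] commute[of ?e ?b] by linarith+
        moreover have "d ?a ?b \<le> d ?a ?c + d ?c ?e + d ?b ?e"
          using triangle[OF M(1,2,3)] triangle[OF M(2,4,3)] commute[of ?e ?b] by linarith
        moreover have W: "W \<le> d ?c x0" "W \<le> d ?e x0" using N1 N2 that by auto
        have "d ?c ?e \<le> d ?c x0 + d ?e x0 - W + 20 * \<delta>"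
          using ultra[OF u(1) v(1), of m n] W by (cases "d ?c x0 \<le> d ?e x0") auto
        ultimately have "2 * Z \<le> d ?a p + d ?b p - d ?a ?b" unfolding W_def by (simp add: algebra_simps)
        then show ?thesis by (simp add: gromov_product_def)
      qed
      then show "\<exists>N. \<forall>m\<ge>N. \<forall>n\<ge>N. Z \<le> gromov_product d p (\<phi> (u m) x) (\<phi> (v n) y)" by blast
    qed
    define g where "g n = (SOME g. g \<in> carrier \<Gamma> \<and> d (\<phi> g x0) x0 \<ge> real n)" for n :: nat
    have g: "g n \<in> carrier \<Gamma>" "d (\<phi> (g n) x0) x0 \<ge> real n" for n
      using someI_ex[of "\<lambda>g. g \<in> carrier \<Gamma> \<and> d (\<phi> g x0) x0 \<ge> real n"] unbounded[of "real n"]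
      by (auto simp: g_def)
    have g_inf: "\<exists>N. \<forall>n\<ge>N. Z \<le> d (\<phi> (g n) x0) x0" for Z
    proof -
      obtain N :: nat where "Z \<le> real N" using real_arch_simple by blast
      then have "\<forall>n\<ge>N. Z \<le> d (\<phi> (g n) x0) x0" using g(2) by (meson of_nat_le_iff order_trans)
      then show ?thesis by blast
    qed
    define \<sigma>0 where "\<sigma>0 n = \<phi> (g n) x0" for n
    have gs: "(\<lambda>n. \<phi> (u n) x) \<in> gromov_sequences M d"
      if "\<And>n. u n \<in> carrier \<Gamma>" "\<And>Z. \<exists>N. \<forall>n\<ge>N. Z \<le> d (\<phi> (u n) x0) x0" "x \<in> M" for u :: "nat \<Rightarrow> _" and x
      using conv[OF that(1,2) that(1,2) that(3,3)] inM that by (auto simp: gromov_sequences_def)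
    have s0: "\<sigma>0 \<in> gromov_sequences M d" unfolding \<sigma>0_def using gs[OF g(1) g_inf x0(1)] .
    have eqv: "equiv (gromov_sequences M d) ?R" by (rule equiv_diverge_together[OF hyp])
    have "boundary_closure M d (orbit \<Gamma> \<phi> x) = {?R `` {\<sigma>0}}" if x: "x \<in> M" for x
    proof (intro equalityI subsetI)
      fix \<xi> assume "\<xi> \<in> boundary_closure M d (orbit \<Gamma> \<phi> x)"
      then obtain \<sigma> where s: "\<xi> \<in> gromov_boundary M d" "\<sigma> \<in> \<xi>" "range \<sigma> \<subseteq> orbit \<Gamma> \<phi> x"
        unfolding boundary_closure_def by blast
      then obtain \<tau> where t: "\<xi> = ?R `` {\<tau>}" "(\<tau>, \<sigma>) \<in> ?R" unfolding gromov_boundary_def quotient_def by blast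
      have "\<forall>n. \<exists>h\<in>carrier \<Gamma>. \<sigma> n = \<phi> h x" using s(3) by (auto simp: Group_Action.orbit_def)
      then obtain h where h: "\<And>n. h n \<in> carrier \<Gamma>" "\<And>n. \<sigma> n = \<phi> (h n) x" by metis
      have sg: "\<sigma> \<in> gromov_sequences M d" using t(2) by simp
      have "\<exists>N. \<forall>n\<ge>N. Z \<le> d (\<phi> (h n) x0) x0" for Z
      proof -
        have "diverge_together M d \<sigma> \<sigma>" using sg by (simp add: gromov_sequences_def)
        then obtain N where N: "\<forall>m\<ge>N. \<forall>n\<ge>N. Z + d x x0 \<le> gromov_product d x0 (\<sigma> m) (\<sigma> n)"
          using x0(1) unfolding diverge_together_iff by blast
        have "Z \<le> d (\<phi> (h n) x0) x0" if "n \<ge> N" for n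
        proof -
          have M: "\<phi> (h n) x \<in> M" "\<phi> (h n) x0 \<in> M" using inM h x x0 by auto
          have "Z + d x x0 \<le> gromov_product d x0 (\<sigma> n) (\<sigma> n)" using N that by blast
          also have "\<dots> = d (\<phi> (h n) x) x0" using M by (simp add: gromov_product_def h(2))
          also have "\<dots> \<le> d (\<phi> (h n) x) (\<phi> (h n) x0) + d (\<phi> (h n) x0) x0" by (rule triangle[OF M x0(1)])
          also have "d (\<phi> (h n) x) (\<phi> (h n) x0) = d x x0" by (rule iso[OF h(1) x x0(1)])
          finally show ?thesis by simp
        qed
        then show ?thesis by blast
      qed
      then have "diverge_together M d \<sigma> \<sigma>0"
        using conv[OF h(1) _ g(1) g_inf x x0(1)] by (simp add: h(2)[symmetric] \<sigma>0_def[symmetric] cong: if_cong)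
      then have "(\<sigma>, \<sigma>0) \<in> ?R" using sg s0 by simp
      then have "(\<tau>, \<sigma>0) \<in> ?R" using t(2) eqv by (meson equivE transE)
      then show "\<xi> \<in> {?R `` {\<sigma>0}}" using equiv_class_eq[OF eqv] t(1) by blast
    next
      fix \<xi> assume "\<xi> \<in> {?R `` {\<sigma>0}}"
      then have xi: "\<xi> = ?R `` {\<sigma>0}" by simp
      have "diverge_together M d \<sigma>0 (\<lambda>n. \<phi> (g n) x)"
        unfolding \<sigma>0_def by (rule conv[OF g(1) g_inf g(1) g_inf x0(1) x])
      then have "(\<lambda>n. \<phi> (g n) x) \<in> \<xi>" unfolding xi using s0 gs[OF g(1) g_inf x] by simp
      moreover have "range (\<lambda>n. \<phi> (g n) x) \<subseteq> orbit \<Gamma> \<phi> x" using g(1) by (auto simp: Group_Action.orbit_def)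
      moreover have "\<xi> \<in> gromov_boundary M d" unfolding xi gromov_boundary_def by (rule quotientI[OF s0])
      ultimately show "\<xi> \<in> boundary_closure M d (orbit \<Gamma> \<phi> x)" unfolding boundary_closure_def by blast
    qed
    then show False using notp unfolding parabolic_action_def by blast
  qed
qed

text \<open>Lets a metric on \<open>SVG\<close> be studied on the isomorphic group of piecewise
  maps.\<close>

lemma hyperbolic_metric_group_pullback:
  assumes "hyperbolic_metric_group \<Gamma> D \<delta>" "group H" "\<psi> \<in> hom H \<Gamma>"
  shows "hyperbolic_metric_group H (\<lambda>a b. D (\<psi> a) (\<psi> b)) \<delta>"
    and "a \<in> carrier H \<Longrightarrow> hyperbolic_metric_group.lox H (\<lambda>a b. D (\<psi> a) (\<psi> b)) \<delta> a \<longleftrightarrow> hyperbolic_metric_group.lox \<Gamma> D \<delta> (\<psi> a)"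
proof -
  interpret T: hyperbolic_metric_group \<Gamma> D \<delta> by (rule assms(1))
  interpret H: group H by (rule assms(2))
  interpret group_hom H \<Gamma> \<psi> using assms(3) by unfold_locales
  show "hyperbolic_metric_group H (\<lambda>a b. D (\<psi> a) (\<psi> b)) \<delta>"
    by unfold_locales (simp_all add: T.D_refl T.D_sym T.D_triangle T.D_left T.D_four)
  then interpret P: hyperbolic_metric_group H "\<lambda>a b. D (\<psi> a) (\<psi> b)" \<delta> .
  show "P.lox a \<longleftrightarrow> T.lox (\<psi> a)" if "a \<in> carrier H"
    using that by (simp add: P.lox_def T.lox_def P.len_def T.len_def)
qed

section \<open>Groups of piecewise monoid maps\<close>

abbreviation finv :: "('a \<Rightarrow> 'b) \<Rightarrow> 'b \<Rightarrow> 'a" where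
  "finv f \<equiv> inv_into UNIV f"

text \<open>The maps are extended by the identity outside \<open>Y\<close>, so that composing them needs no restrictions.\<close>

locale brick_monoid =
  fixes Y :: "'y set" and M :: "('y \<Rightarrow> 'y) set" and h0 h1 :: "'y \<Rightarrow> 'y"
  assumes nonempty: "Y \<noteq> {}"
    and M_id [simp]: "id \<in> M"
    and M_comp [simp]: "\<lbrakk>m \<in> M; n \<in> M\<rbrakk> \<Longrightarrow> m \<circ> n \<in> M"
    and M_inj: "m \<in> M \<Longrightarrow> inj m"
    and M_in [simp]: "\<lbrakk>m \<in> M; y \<in> Y\<rbrakk> \<Longrightarrow> m y \<in> Y"
    and M_out: "\<lbrakk>m \<in> M; y \<notin> Y\<rbrakk> \<Longrightarrow> m y = y"
    and meet: "\<lbrakk>m \<in> M; n \<in> M; y \<in> m ` Y; y \<in> n ` Y\<rbrakk> \<Longrightarrow>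
      \<exists>a\<in>M. \<exists>b\<in>M. m \<circ> a = n \<circ> b \<and> y \<in> (m \<circ> a) ` Y"
    and compl: "\<lbrakk>m \<in> M; y \<in> Y; y \<notin> m ` Y\<rbrakk> \<Longrightarrow> \<exists>n\<in>M. y \<in> n ` Y \<and> n ` Y \<inter> m ` Y = {}"
    and factor: "\<lbrakk>m \<in> M; n \<in> M; m ` Y \<subseteq> n ` Y\<rbrakk> \<Longrightarrow> \<exists>a\<in>M. m = n \<circ> a"
    and h0 [simp]: "h0 \<in> M" and h1 [simp]: "h1 \<in> M"
    and halves_disjoint: "h0 ` Y \<inter> h1 ` Y = {}"
    and halves_cover: "h0 ` Y \<union> h1 ` Y = Y"
begin

text \<open>Local membership in \<open>M\<close> is asked pointwise, so that closure under
  composition is a local matter; finite partitions are recovered from compactness in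
  \<open>domain_partition\<close>.\<close>

definition A :: "('y \<Rightarrow> 'y) set" where
  "A = {f. bij f \<and> (\<forall>y. y \<notin> Y \<longrightarrow> f y = y) \<and> (\<forall>y\<in>Y. \<exists>m\<in>M. y \<in> m ` Y \<and> f \<circ> m \<in> M)}"

definition PG :: "('y \<Rightarrow> 'y) monoid" where
  "PG = \<lparr>carrier = A, mult = (\<circ>), one = id\<rparr>"

definition swap :: "('y \<Rightarrow> 'y) \<Rightarrow> ('y \<Rightarrow> 'y) \<Rightarrow> 'y \<Rightarrow> 'y" where
  "swap m n y = (if y \<in> m ` Y then n (finv m y) else if y \<in> n ` Y then m (finv n y) else y)"

definition iota :: "('y \<Rightarrow> 'y) \<Rightarrow> ('y \<Rightarrow> 'y) \<Rightarrow> 'y \<Rightarrow> 'y" where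
  "iota m f y = (if y \<in> m ` Y then m (f (finv m y)) else y)"

lemma inv_M [simp]: "m \<in> M \<Longrightarrow> finv m (m y) = y"
  by (simp add: M_inj)

lemma M_eq_iff: "m \<in> M \<Longrightarrow> m x = m y \<longleftrightarrow> x = y"
  by (meson M_inj injD)

lemma image_M_subset: "m \<in> M \<Longrightarrow> m ` Y \<subseteq> Y"
  by auto

lemma disjoint_halves [simp]: "x \<in> Y \<Longrightarrow> y \<in> Y \<Longrightarrow> h0 x \<noteq> h1 y"
  using halves_disjoint by blast

lemma A_bij: "f \<in> A \<Longrightarrow> bij f"
  and A_out: "f \<in> A \<Longrightarrow> y \<notin> Y \<Longrightarrow> f y = y"
  and A_local: "f \<in> A \<Longrightarrow> y \<in> Y \<Longrightarrow> \<exists>m\<in>M. y \<in> m ` Y \<and> f \<circ> m \<in> M"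
  by (auto simp: A_def)

lemma A_I:
  assumes "\<And>y. g (f y) = y" "\<And>y. f (g y) = y" "\<And>y. y \<notin> Y \<Longrightarrow> f y = y"
    and "\<And>y. y \<in> Y \<Longrightarrow> \<exists>m\<in>M. y \<in> m ` Y \<and> f \<circ> m \<in> M"
  shows "f \<in> A"
proof -
  have "bij f" by (rule o_bij[of g]) (use assms in auto)
  then show ?thesis using assms by (auto simp: A_def)
qed

lemma A_in [simp]:
  assumes "f \<in> A" "y \<in> Y"
  shows "f y \<in> Y"
proof -
  obtain m where m: "m \<in> M" "y \<in> m ` Y" "f \<circ> m \<in> M" using A_local[OF assms] by blast
  then obtain x where "x \<in> Y" "y = m x" by blast
  then show ?thesis using M_in[OF m(3), of x] by simp
qed

lemma A_id [simp]: "id \<in> A"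
  by (rule A_I[of id]) (auto intro!: bexI[of _ id])

text \<open>\<open>meet\<close> shrinks a brick on which \<open>g\<close> is good until its image
  lies in a brick on which \<open>f\<close> is good.\<close>

lemma A_comp [simp]:
  assumes "f \<in> A" "g \<in> A"
  shows "f \<circ> g \<in> A"
proof -
  have "\<exists>m\<in>M. y \<in> m ` Y \<and> (f \<circ> g) \<circ> m \<in> M" if y: "y \<in> Y" for y
  proof -
    obtain m where m: "m \<in> M" "y \<in> m ` Y" "g \<circ> m \<in> M" using A_local[OF assms(2) y] by blast
    obtain n where n: "n \<in> M" "g y \<in> n ` Y" "f \<circ> n \<in> M" using A_local[OF assms(1), of "g y"] assms y by auto
    have "g y \<in> (g \<circ> m) ` Y" using m by auto
    from meet[OF m(3) n(1) this n(2)] obtain a b where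
      ab: "a \<in> M" "b \<in> M" "(g \<circ> m) \<circ> a = n \<circ> b" "g y \<in> ((g \<circ> m) \<circ> a) ` Y" by blast
    have "(f \<circ> g) \<circ> (m \<circ> a) = (f \<circ> n) \<circ> b" using ab(3) by (metis comp_assoc)
    then have "(f \<circ> g) \<circ> (m \<circ> a) \<in> M" using n ab by simp
    moreover have "y \<in> (m \<circ> a) ` Y"
      using ab(4) bij_is_inj[OF A_bij[OF assms(2)]] by (auto dest: injD)
    ultimately show ?thesis using m ab by (meson M_comp)
  qed
  then show ?thesis using assms by (auto simp: A_def bij_comp)
qed

lemma A_inv_apply [simp]:
  assumes "f \<in> A"
  shows "finv f (f y) = y" "f (finv f y) = y"
  using A_bij[OF assms] by (simp_all add: bij_is_inj bij_is_surj surj_f_inv_f)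

lemma A_inv [simp]:
  assumes "f \<in> A"
  shows "finv f \<in> A"
proof -
  have out: "finv f y = y" if "y \<notin> Y" for y using A_out[OF assms that] A_inv_apply(1)[OF assms, of y] by simp
  have "\<exists>m\<in>M. y \<in> m ` Y \<and> finv f \<circ> m \<in> M" if y: "y \<in> Y" for y
  proof -
    have "finv f y \<in> Y" using A_out[OF assms, of "finv f y"] assms y by (cases "finv f y \<in> Y") auto
    then obtain m where m: "m \<in> M" "finv f y \<in> m ` Y" "f \<circ> m \<in> M" using A_local[OF assms] by blast
    have "finv f \<circ> (f \<circ> m) = m" using assms by (auto simp: fun_eq_iff)
    moreover have "y \<in> (f \<circ> m) ` Y" using m(2) assms by (metis A_inv_apply(2) imageI image_comp)
    ultimately show ?thesis using m by (intro bexI[of _ "f \<circ> m"]) auto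
  qed
  then show ?thesis using assms out by (intro A_I[of f]) auto
qed

lemma group_PG: "group PG"
proof (rule groupI)
  fix f assume "f \<in> carrier PG"
  then show "\<exists>g\<in>carrier PG. g \<otimes>\<^bsub>PG\<^esub> f = \<one>\<^bsub>PG\<^esub>"
    by (intro bexI[of _ "finv f"]) (auto simp: PG_def fun_eq_iff)
qed (auto simp: PG_def comp_assoc)

lemma PG_simps [simp]: "carrier PG = A" "f \<otimes>\<^bsub>PG\<^esub> g = f \<circ> g" "\<one>\<^bsub>PG\<^esub> = id"
  by (auto simp: PG_def)

lemma inv_PG [simp]: "f \<in> A \<Longrightarrow> inv\<^bsub>PG\<^esub> f = finv f"
  by (rule group.inv_equality[OF group_PG]) (auto simp: fun_eq_iff)

lemma A_eqI: "\<lbrakk>f \<in> A; g \<in> A; \<And>y. y \<in> Y \<Longrightarrow> f y = g y\<rbrakk> \<Longrightarrow> f = g"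
  by (metis A_out ext)

section \<open>Swaps of disjoint bricks and copies supported in a brick\<close>

definition apart :: "('y \<Rightarrow> 'y) \<Rightarrow> ('y \<Rightarrow> 'y) \<Rightarrow> bool" where
  "apart m n \<longleftrightarrow> m ` Y \<inter> n ` Y = {}"

lemma apart_sym: "apart m n \<Longrightarrow> apart n m"
  by (auto simp: apart_def)

lemma image_comp_subset: "a \<in> M \<Longrightarrow> (m \<circ> a) ` Y \<subseteq> m ` Y"
  by auto

lemma apart_comp:
  assumes "apart m n" "a \<in> M"
  shows "apart (m \<circ> a) n" "apart m (n \<circ> a)"
  using assms(1) image_comp_subset[OF assms(2), of m] image_comp_subset[OF assms(2), of n]
  unfolding apart_def disjoint_iff subset_iff by metis+

lemma apart_inj_comp:
  assumes "inj m"
  shows "apart (m \<circ> a) (m \<circ> b) \<longleftrightarrow> apart a b"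
proof -
  have "(m \<circ> a) ` Y \<inter> (m \<circ> b) ` Y = m ` (a ` Y \<inter> b ` Y)"
    unfolding image_Int[OF assms] image_comp ..
  then show ?thesis by (simp only: apart_def image_is_empty)
qed

lemma apart_comp_left: "m \<in> M \<Longrightarrow> apart (m \<circ> a) (m \<circ> b) \<longleftrightarrow> apart a b"
  by (rule apart_inj_comp[OF M_inj])

lemma apart_A_comp: "f \<in> A \<Longrightarrow> apart (f \<circ> m) (f \<circ> n) \<longleftrightarrow> apart m n"
  by (rule apart_inj_comp[OF bij_is_inj[OF A_bij]])

lemma halves_apart [simp]: "apart h0 h1" "apart h1 h0"
  using halves_disjoint by (auto simp: apart_def)

context
  fixes m n assumes m: "m \<in> M" and n: "n \<in> M" and d: "apart m n"
begin

lemma swap_left: "y \<in> Y \<Longrightarrow> swap m n (m y) = n y"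
  using m n by (auto simp: swap_def)

lemma swap_right: "y \<in> Y \<Longrightarrow> swap m n (n y) = m y"
  using m n d by (auto simp: swap_def apart_def)

lemma swap_other: "y \<notin> m ` Y \<Longrightarrow> y \<notin> n ` Y \<Longrightarrow> swap m n y = y"
  by (auto simp: swap_def)

lemma swap_swap: "swap m n (swap m n y) = y"
proof -
  consider x where "x \<in> Y" "y = m x" | x where "x \<in> Y" "y = n x" | "y \<notin> m ` Y" "y \<notin> n ` Y" by blast
  then show ?thesis
    by cases (simp_all add: swap_left swap_right swap_other)
qed

lemma swap_comp_self: "swap m n \<circ> swap m n = id"
  by (auto simp: swap_swap)

lemma swap_out: "y \<notin> Y \<Longrightarrow> swap m n y = y"
  using image_M_subset m n by (intro swap_other) auto

lemma swap_comp_left: "swap m n \<circ> m = n"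
proof
  show "(swap m n \<circ> m) y = n y" for y
    by (cases "y \<in> Y") (simp_all add: swap_left swap_out M_out[OF m] M_out[OF n])
qed

lemma swap_comp_right: "swap m n \<circ> n = m"
proof
  show "(swap m n \<circ> n) y = m y" for y
    by (cases "y \<in> Y") (simp_all add: swap_right swap_out M_out[OF m] M_out[OF n])
qed

lemma swap_comp_other:
  assumes "c \<in> M" "apart c m" "apart c n"
  shows "swap m n \<circ> c = c"
proof
  fix y
  show "(swap m n \<circ> c) y = c y"
    using assms swap_other[of "c y"] swap_out M_out[OF assms(1)] by (cases "y \<in> Y") (auto simp: apart_def)
qed

lemma swap_in_A: "swap m n \<in> A"
proof (rule A_I[OF swap_swap swap_swap swap_out])
  fix y assume y: "y \<in> Y"
  consider "y \<in> m ` Y" | "y \<in> n ` Y" | "y \<notin> m ` Y" "y \<notin> n ` Y" by blast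
  then show "\<exists>c\<in>M. y \<in> c ` Y \<and> swap m n \<circ> c \<in> M"
  proof cases
    case 1
    then show ?thesis using m n swap_comp_left by metis
  next
    case 2
    then show ?thesis using m n swap_comp_right by metis
  next
    case 3
    obtain a where a: "a \<in> M" "y \<in> a ` Y" "apart a m" using compl[OF m y] 3 by (auto simp: apart_def)
    obtain b where b: "b \<in> M" "y \<in> b ` Y" "apart b n" using compl[OF n y] 3 by (auto simp: apart_def)
    obtain c c' where c: "c \<in> M" "c' \<in> M" "a \<circ> c = b \<circ> c'" "y \<in> (a \<circ> c) ` Y"
      using meet[OF a(1) b(1) a(2) b(2)] by blast
    have "apart (a \<circ> c) m" by (rule apart_comp(1)[OF a(3) c(1)])
    moreover have "apart (a \<circ> c) n" unfolding c(3) by (rule apart_comp(1)[OF b(3) c(2)])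
    ultimately show ?thesis using swap_comp_other[of "a \<circ> c"] a c by (metis M_comp)
  qed
qed

lemma inv_swap: "finv (swap m n) = swap m n"
  by (rule inv_unique_comp[OF swap_comp_self swap_comp_self])

end

lemma iota_apply [simp]: "\<lbrakk>m \<in> M; y \<in> Y\<rbrakk> \<Longrightarrow> iota m f (m y) = m (f y)"
  by (auto simp: iota_def)

lemma iota_other: "y \<notin> m ` Y \<Longrightarrow> iota m f y = y"
  by (simp add: iota_def)

lemma iota_out: "m \<in> M \<Longrightarrow> y \<notin> Y \<Longrightarrow> iota m f y = y"
  using image_M_subset by (intro iota_other) auto

lemma iota_id [simp]: "m \<in> M \<Longrightarrow> iota m id = id"
  by (auto simp: iota_def fun_eq_iff)

lemma iota_comp: "\<lbrakk>m \<in> M; f \<in> A; g \<in> A\<rbrakk> \<Longrightarrow> iota m (f \<circ> g) = iota m f \<circ> iota m g"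
  by (auto simp: fun_eq_iff iota_def)

lemma iota_comp_self: "\<lbrakk>m \<in> M; f \<in> A\<rbrakk> \<Longrightarrow> iota m f \<circ> m = m \<circ> f"
  by (rule ext, case_tac "x \<in> Y") (simp_all add: M_out A_out iota_out)

lemma iota_comp_other: "\<lbrakk>m \<in> M; n \<in> M; apart m n\<rbrakk> \<Longrightarrow> iota m f \<circ> n = n"
  by (rule ext, case_tac "x \<in> Y") (auto simp add: M_out iota_out apart_def intro!: iota_other)

lemma iota_in_A [simp]:
  assumes m: "m \<in> M" and f: "f \<in> A"
  shows "iota m f \<in> A"
proof (rule A_I[of "iota m (finv f)"])
  have *: "iota m f \<circ> iota m (finv f) = id" "iota m (finv f) \<circ> iota m f = id"
  proof -
    have "f \<circ> finv f = id" "finv f \<circ> f = id" using f by (auto simp: fun_eq_iff)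
    then show "iota m f \<circ> iota m (finv f) = id" "iota m (finv f) \<circ> iota m f = id"
      using m f by (simp_all flip: iota_comp)
  qed
  show "iota m (finv f) (iota m f y) = y" "iota m f (iota m (finv f) y) = y" for y
    using * by (metis comp_apply id_apply)+
  show "iota m f y = y" if "y \<notin> Y" for y using iota_out[OF m that] .
  fix y assume y: "y \<in> Y"
  show "\<exists>n\<in>M. y \<in> n ` Y \<and> iota m f \<circ> n \<in> M"
  proof (cases "y \<in> m ` Y")
    case True
    then obtain x where x: "x \<in> Y" "y = m x" by blast
    then obtain n where n: "n \<in> M" "x \<in> n ` Y" "f \<circ> n \<in> M" using A_local[OF f] by blast
    have "iota m f \<circ> (m \<circ> n) = m \<circ> (f \<circ> n)" using iota_comp_self[OF m f] by (metis comp_assoc)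
    then show ?thesis using n m x by (intro bexI[of _ "m \<circ> n"]) auto
  next
    case False
    then obtain n where "n \<in> M" "y \<in> n ` Y" "apart m n" using compl[OF m y] by (auto simp: apart_def)
    then show ?thesis using iota_comp_other[OF m] by (intro bexI[of _ n]) auto
  qed
qed

lemma iota_iota: "\<lbrakk>m \<in> M; n \<in> M\<rbrakk> \<Longrightarrow> iota m (iota n f) = iota (m \<circ> n) f"
proof
  fix y assume m: "m \<in> M" and n: "n \<in> M"
  consider x where "x \<in> Y" "y = (m \<circ> n) x" | z where "z \<in> Y" "z \<notin> n ` Y" "y = m z" | "y \<notin> m ` Y"
    by auto
  then show "iota m (iota n f) y = iota (m \<circ> n) f y"
  proof cases
    case 1
    then have "iota (m \<circ> n) f y = (m \<circ> n) (f x)" using m n by (simp only: iota_apply M_comp)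
    then show ?thesis using 1 m n by simp
  next
    case 2
    then have "y \<notin> (m \<circ> n) ` Y" using m by (auto simp: M_eq_iff)
    then show ?thesis using 2 m by (simp add: iota_other)
  next
    case 3
    then have "y \<notin> (m \<circ> n) ` Y" using image_comp_subset[OF n, of m] by blast
    then show ?thesis using 3 by (simp add: iota_other)
  qed
qed

lemma iota_conj:
  assumes g: "g \<in> A" and m: "m \<in> M" and n: "n \<in> M" and gm: "g \<circ> m = n" and f: "f \<in> A"
  shows "g \<circ> iota m f \<circ> finv g = iota n f"
proof -
  have g': "g (m y) = n y" for y using gm by auto
  have "g (iota m f y) = iota n f (g y)" if y: "y \<in> Y" for y
  proof (cases "y \<in> m ` Y")
    case True
    then show ?thesis using m n f g' by auto
  next
    case False
    then have "g y \<notin> n ` Y" using g' g by (metis (no_types, lifting) A_inv_apply(1) image_iff)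
    then show ?thesis using False by (simp add: iota_other)
  qed
  then have "g \<circ> iota m f = iota n f \<circ> g"
    using g m n f by (intro A_eqI) auto
  then show ?thesis using g by (auto simp: fun_eq_iff)
qed

text \<open>\<open>iota m f\<close> fixes the brick of \<open>n\<close> pointwise, so by
  \<open>iota_conj\<close> conjugation with it carries the copy in that brick to itself.\<close>

lemma iota_commute:
  assumes "m \<in> M" "n \<in> M" "apart m n" "f \<in> A" "g \<in> A"
  shows "iota m f \<circ> iota n g = iota n g \<circ> iota m f"
proof -
  have "iota m f \<circ> iota n g \<circ> finv (iota m f) = iota n g"
    by (rule iota_conj) (use assms in \<open>auto simp: iota_comp_other\<close>)
  then show ?thesis using assms by (metis A_comp A_inv A_inv_apply(1) comp_apply ext iota_in_A)
qed

text \<open>Fixing one half pointwise forces the other half to be preserved, and the induced map,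
  read in the coordinate \<open>h0\<close>, is the required \<open>g\<close>. That it is again
  locally in \<open>M\<close> uses \<open>meet\<close> to stay inside \<open>h0\<close> and
  \<open>factor\<close> to cancel it.\<close>

lemma fixing_imp_iota:
  assumes f: "f \<in> A" and "f \<circ> h1 = h1"
  shows "\<exists>g\<in>A. f = iota h0 g"
proof -
  have fh1: "f (h1 y) = h1 y" for y using assms by (metis comp_apply)
  have inv_h1: "finv f (h1 y) = h1 y" for y using fh1 f by (metis A_inv_apply(1))
  have pres: "F (h0 y) \<in> h0 ` Y" if F: "F \<in> A" "\<And>y. finv F (h1 y) = h1 y" and y: "y \<in> Y" for F y
  proof (rule ccontr)
    assume "F (h0 y) \<notin> h0 ` Y"
    then obtain x where x: "x \<in> Y" "F (h0 y) = h1 x" using halves_cover F y by (metis A_in M_in UnE h0 image_iff)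
    then have "h0 y = h1 x" using F by (metis A_inv_apply(1))
    then show False using x y by simp
  qed
  \<comment> \<open>The map stays an argument of \<open>G\<close>, so that the inverse of
    \<open>G f\<close> is \<open>G\<close> applied to the inverse of \<open>f\<close>.\<close>
  define G where "G F y = (if y \<in> Y then finv h0 (F (h0 y)) else y)" for F y
  have G: "h0 (G F y) = F (h0 y)" "G F y \<in> Y" if F: "F \<in> A" "\<And>y. finv F (h1 y) = h1 y" and y: "y \<in> Y" for F y
    using pres[OF F y] y by (auto simp: G_def)
  have ii: "finv (finv f) = f" using A_bij[OF f] by (simp add: inv_inv_eq)
  have G1: "h0 (G f y) = f (h0 y)" "G f y \<in> Y" if "y \<in> Y" for y using G f inv_h1 that by auto
  have G2: "h0 (G (finv f) y) = finv f (h0 y)" "G (finv f) y \<in> Y" if "y \<in> Y" for y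
    using G[of "finv f"] f fh1 ii that by auto
  have "G f \<in> A"
  proof (rule A_I[of "G (finv f)"])
    show "G (finv f) (G f y) = y" for y
    proof (cases "y \<in> Y")
      case True
      then have "h0 (G (finv f) (G f y)) = h0 y" using G1 G2 f by simp
      then show ?thesis by (simp add: M_eq_iff)
    qed (simp add: G_def)
    show "G f (G (finv f) y) = y" for y
    proof (cases "y \<in> Y")
      case True
      then have "h0 (G f (G (finv f) y)) = h0 y" using G1 G2 f by simp
      then show ?thesis by (simp add: M_eq_iff)
    qed (simp add: G_def)
    show "G f y = y" if "y \<notin> Y" for y using that by (simp add: G_def)
    fix y assume y: "y \<in> Y"
    then obtain m where m: "m \<in> M" "h0 y \<in> m ` Y" "f \<circ> m \<in> M" using A_local[OF f, of "h0 y"] by auto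
    obtain a b where ab: "a \<in> M" "b \<in> M" "h0 \<circ> a = m \<circ> b" "h0 y \<in> (h0 \<circ> a) ` Y"
      using meet[OF h0 m(1) _ m(2)] y by blast
    have fmb: "(f \<circ> m \<circ> b) x = f (h0 (a x))" for x using ab(3) by (metis comp_apply)
    have "(f \<circ> m \<circ> b) ` Y \<subseteq> h0 ` Y"
    proof (rule image_subsetI)
      fix x assume "x \<in> Y"
      then have "a x \<in> Y" using ab(1) by simp
      then show "(f \<circ> m \<circ> b) x \<in> h0 ` Y" unfolding fmb G1(1)[OF \<open>a x \<in> Y\<close>, symmetric] by (intro imageI G1(2))
    qed
    then obtain c where c: "c \<in> M" "f \<circ> m \<circ> b = h0 \<circ> c"
      using factor[OF M_comp[OF m(3) ab(2)] h0] by blast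
    have "G f \<circ> a = c"
    proof
      fix x
      show "(G f \<circ> a) x = c x"
      proof (cases "x \<in> Y")
        case True
        then have "h0 (G f (a x)) = f (h0 (a x))" using G1 ab by simp
        also have "\<dots> = h0 (c x)" using fmb c by (metis comp_apply)
        finally show ?thesis by (simp add: M_eq_iff)
      next
        case False
        then show ?thesis using ab c by (simp add: M_out G_def)
      qed
    qed
    moreover have "y \<in> a ` Y" using ab(4) unfolding image_comp[symmetric] by (auto simp: M_eq_iff)
    ultimately show "\<exists>m\<in>M. y \<in> m ` Y \<and> G f \<circ> m \<in> M" using ab c by metis
  qed
  moreover have "f = iota h0 (G f)"
  proof (rule A_eqI)
    fix y assume "y \<in> Y"
    then consider x where "x \<in> Y" "y = h0 x" | x where "x \<in> Y" "y = h1 x" using halves_cover by blast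
    then show "f y = iota h0 (G f) y"
    proof cases
      case 1
      then show ?thesis using G1 by simp
    next
      case 2
      then have "y \<notin> h0 ` Y" using halves_disjoint by blast
      then show ?thesis using fh1 2 by (simp add: iota_other)
    qed
  qed (use f \<open>G f \<in> A\<close> in auto)
  ultimately show ?thesis by blast
qed

end

section \<open>Excluding loxodromics\<close>

context brick_monoid
begin

text \<open>The brick with address \<open>1...10\<close>, with \<open>i\<close> letters 1. Since
  \<open>comb 0\<close> is \<open>h0\<close>, everything supported in \<open>h0\<close> fixes all
  the other bricks of the sequence.\<close>

definition comb :: "nat \<Rightarrow> 'y \<Rightarrow> 'y" where
  "comb i = ((\<circ>) h1 ^^ i) h0"

lemma comb_simps: "comb 0 = h0" "comb (Suc i) = h1 \<circ> comb i"
  by (simp_all add: comb_def)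

lemma comb_in_M [simp]: "comb i \<in> M"
  by (induction i) (simp_all only: comb_simps h0 h1 M_comp)

lemma comb_apart: "i < j \<Longrightarrow> apart (comb i) (comb j)"
proof (induction i arbitrary: j)
  case 0
  then obtain k where "j = Suc k" by (cases j) auto
  then show ?case using apart_comp(2)[OF halves_apart(1), of "comb k"] by (simp only: comb_simps comb_in_M)
next
  case (Suc i)
  then obtain k where "j = Suc k" "i < k" by (cases j) auto
  then show ?case using Suc.IH[of k] by (simp only: comb_simps apart_comp_left[OF h1])
qed

lemma comb_apart_neq: "i \<noteq> j \<Longrightarrow> apart (comb i) (comb j)"
  using comb_apart[of i j] comb_apart[of j i] apart_sym by (cases "i < j") auto

definition fixer :: "('y \<Rightarrow> 'y) \<Rightarrow> ('y \<Rightarrow> 'y) set" where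
  "fixer m = {f \<in> A. f \<circ> m = m}"

lemma fixer_in_A: "f \<in> fixer m \<Longrightarrow> f \<in> A"
  by (simp add: fixer_def)

lemma fixer_comp: "\<lbrakk>f \<in> fixer m; g \<in> fixer m\<rbrakk> \<Longrightarrow> f \<circ> g \<in> fixer m"
  by (simp add: fixer_def comp_assoc)

lemma fixer_inv: "f \<in> fixer m \<Longrightarrow> finv f \<in> fixer m"
  by (auto simp: fixer_def fun_eq_iff) (metis A_inv_apply(1))

text \<open>Moving \<open>comb k\<close> to \<open>h0\<close> and then \<open>h0\<close> to
  \<open>h1\<close> turns a map fixing \<open>comb k\<close> into one fixing \<open>h1\<close>,
  where \<open>fixing_imp_iota\<close> applies. A single conjugator serves the whole fixer, so that
  a length bound for the copies in \<open>h0\<close> carries over to it. The condition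
  \<open>k \<ge> 1\<close> keeps \<open>comb k\<close> apart from \<open>h0\<close>.\<close>

lemma comb_fixer_conj_iota:
  assumes "k \<ge> 1"
  shows "\<exists>c\<in>A. \<forall>f\<in>fixer (comb k). \<exists>g\<in>A. c \<circ> f \<circ> finv c = iota h0 g"
proof -
  define s where "s = swap (comb k) h0"
  define t where "t = swap h0 h1"
  have ap: "apart (comb k) h0" using comb_apart_neq[of k 0] assms by (simp add: comb_simps(1))
  have s: "s \<in> A" "s \<circ> s = id" "s \<circ> h0 = comb k" "s \<circ> comb k = h0" "finv s = s"
    using swap_in_A[OF _ _ ap] swap_comp_self[OF _ _ ap] swap_comp_left[OF _ _ ap] swap_comp_right[OF _ _ ap]
      inv_swap[OF _ _ ap] by (auto simp: s_def)
  have t: "t \<in> A" "t \<circ> t = id" "t \<circ> h0 = h1" "t \<circ> h1 = h0" "finv t = t"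
    using swap_in_A[OF h0 h1] swap_comp_self[OF h0 h1] swap_comp_left[OF h0 h1] swap_comp_right[OF h0 h1]
      inv_swap[OF h0 h1] by (auto simp: t_def)
  have inv: "finv (t \<circ> s) = s \<circ> t"
    using o_inv_distrib[OF A_bij[OF t(1)] A_bij[OF s(1)]] s(5) t(5) by simp
  have "\<exists>g\<in>A. t \<circ> s \<circ> f \<circ> finv (t \<circ> s) = iota h0 g" if f: "f \<in> fixer (comb k)" for f
  proof -
    have fA: "f \<in> A" "f \<circ> comb k = comb k" using f by (auto simp: fixer_def)
    have "(t \<circ> s \<circ> f \<circ> (s \<circ> t)) \<circ> h1 = t \<circ> (s \<circ> (f \<circ> (s \<circ> (t \<circ> h1))))" by (simp only: comp_assoc)
    also have "\<dots> = h1" by (simp only: t(4) s(3) fA(2) s(4) t(3))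
    finally show ?thesis unfolding inv using s t fA by (intro fixing_imp_iota) auto
  qed
  then show ?thesis using s t by (intro bexI[of _ "t \<circ> s"]) auto
qed

text \<open>\<open>compl\<close> gives a brick around \<open>y\<close> that misses \<open>c\<close>,
  and \<open>meet\<close> cuts it down to a part of \<open>m\<close>.\<close>

lemma avoid:
  assumes "m \<in> M" "c \<in> M" "y \<in> m ` Y" "y \<notin> c ` Y"
  shows "\<exists>a\<in>M. y \<in> (m \<circ> a) ` Y \<and> apart (m \<circ> a) c"
proof -
  have "y \<in> Y" using assms image_M_subset by blast
  then obtain n where n: "n \<in> M" "y \<in> n ` Y" "apart n c" using compl[OF assms(2) _ assms(4)] by (auto simp: apart_def)
  obtain a b where ab: "a \<in> M" "b \<in> M" "m \<circ> a = n \<circ> b" "y \<in> (m \<circ> a) ` Y" using meet[OF assms(1) n(1) assms(3) n(2)] by blast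
  have "apart (m \<circ> a) c" unfolding ab(3) using n ab by (intro apart_comp)
  then show ?thesis using ab by blast
qed

text \<open>\<open>u\<close> swaps a small brick \<open>E\<close> with \<open>comb k\<close>, and \<open>w\<close> swaps \<open>comb k\<close> with \<open>f E\<close> in the way
  prescribed by \<open>f\<close>.\<close>

lemma factorization:
  assumes f: "f \<in> A"
  shows "\<exists>k\<in>{1..4}. \<exists>l\<in>{1..4}. \<exists>u\<in>fixer (comb l). \<exists>v\<in>fixer (comb k). \<exists>w\<in>fixer (comb l). f = w \<circ> v \<circ> u"
proof -
  obtain y where y: "y \<in> Y" using nonempty by blast
  \<comment> \<open>Each of \<open>y\<close> and \<open>f y\<close> lies in at most one of the four
    disjoint bricks, so at least two indices are left: one for the brick fixed by \<open>v\<close>,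
    one for the brick fixed by \<open>u\<close> and \<open>w\<close>.\<close>
  define J where "J = {k\<in>{1..4}. y \<notin> comb k ` Y \<and> f y \<notin> comb k ` Y}"
  have two: "\<exists>k\<in>J. \<exists>l\<in>J. k \<noteq> l"
  proof -
    have ap: "\<not> (z \<in> comb i ` Y \<and> z \<in> comb j ` Y)" if "i \<noteq> j" for z i j
      using comb_apart_neq[OF that] by (auto simp: apart_def)
    obtain i where i: "\<And>k. y \<in> comb k ` Y \<Longrightarrow> k = i" using ap by metis
    obtain j where j: "\<And>k. f y \<in> comb k ` Y \<Longrightarrow> k = j" using ap by metis
    have "{1..4} - {i, j} \<subseteq> J" using i j by (auto simp: J_def)
    moreover have "card ({1..4} - {i, j}) \<ge> 4 - card {i, j}" using diff_card_le_card_Diff[of "{i,j}" "{1..4::nat}"] by simp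
    moreover have "card {i, j} \<le> 2" by (simp add: card_insert_if)
    moreover have "finite J" by (simp add: J_def)
    ultimately have "2 \<le> card J" using card_mono[of J "{1..4} - {i, j}"] by linarith
    then show ?thesis by (metis card_le_Suc0_iff_eq \<open>finite J\<close> not_less_eq_eq numeral_2_eq_2)
  qed
  then obtain k l where kl: "k \<in> J" "l \<in> J" "k \<noteq> l" by blast
  obtain m0 where m0: "m0 \<in> M" "y \<in> m0 ` Y" "f \<circ> m0 \<in> M" using A_local[OF f y] by blast
  let ?good = "\<lambda>m. m \<in> M \<and> y \<in> m ` Y \<and> f \<circ> m \<in> M"
  have step1: "\<exists>a\<in>M. ?good (m \<circ> a) \<and> apart (m \<circ> a) (comb i)" if m: "?good m" and i: "i \<in> J" for m i
  proof -
    have "y \<notin> comb i ` Y" using i by (simp add: J_def)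
    from avoid[OF _ comb_in_M _ this] m obtain a where a: "a \<in> M" "y \<in> (m \<circ> a) ` Y" "apart (m \<circ> a) (comb i)" by blast
    moreover have "f \<circ> (m \<circ> a) \<in> M" using M_comp[of "f \<circ> m" a] m a by (simp only: comp_assoc)
    ultimately show ?thesis using m by auto
  qed
  have step2: "\<exists>a\<in>M. ?good (m \<circ> a) \<and> apart (f \<circ> (m \<circ> a)) (comb i)" if m: "?good m" and i: "i \<in> J" for m i
  proof -
    have "f y \<notin> comb i ` Y" using i by (simp add: J_def)
    moreover have "f y \<in> (f \<circ> m) ` Y" using m by auto
    ultimately obtain a where a: "a \<in> M" "f y \<in> (f \<circ> m \<circ> a) ` Y" "apart (f \<circ> m \<circ> a) (comb i)"
      using avoid[of "f \<circ> m" "comb i" "f y"] m by auto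
    have "f \<circ> (m \<circ> a) \<in> M" using M_comp[of "f \<circ> m" a] m a by (simp only: comp_assoc)
    moreover have "y \<in> (m \<circ> a) ` Y"
      using a(2) bij_is_inj[OF A_bij[OF f]] unfolding comp_assoc image_comp[symmetric, of f] by (simp add: inj_image_mem_iff)
    ultimately show ?thesis using m a by (intro bexI[of _ a]) (auto simp: comp_assoc)
  qed
  \<comment> \<open>Four shrinkings make both the small brick and its image under \<open>f\<close>
    apart from \<open>comb k\<close> and \<open>comb l\<close>; each keeps what the earlier ones
    achieved.\<close>
  obtain a1 where a1: "a1 \<in> M" "?good (m0 \<circ> a1)" "apart (m0 \<circ> a1) (comb k)" using step1[of m0, OF _ kl(1)] m0 by blast
  obtain a2 where a2: "a2 \<in> M" "?good (m0 \<circ> a1 \<circ> a2)" "apart (m0 \<circ> a1 \<circ> a2) (comb l)" using step1[OF a1(2) kl(2)] by blast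
  obtain a3 where a3: "a3 \<in> M" "?good (m0 \<circ> a1 \<circ> a2 \<circ> a3)" "apart (f \<circ> (m0 \<circ> a1 \<circ> a2 \<circ> a3)) (comb k)"
    using step2[OF a2(2) kl(1)] by blast
  obtain a4 where a4: "a4 \<in> M" "?good (m0 \<circ> a1 \<circ> a2 \<circ> a3 \<circ> a4)" "apart (f \<circ> (m0 \<circ> a1 \<circ> a2 \<circ> a3 \<circ> a4)) (comb l)"
    using step2[OF a3(2) kl(2)] by blast
  define m where "m = m0 \<circ> a1 \<circ> a2 \<circ> a3 \<circ> a4"
  define c where "c = comb k"
  define d where "d = comb l"
  have m: "m \<in> M" "f \<circ> m \<in> M" using a4 by (auto simp: m_def)
  have cd: "c \<in> M" "d \<in> M" "apart c d" using comb_apart_neq[OF kl(3)] by (auto simp: c_def d_def)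
  have "apart m c" unfolding m_def c_def by (rule apart_comp(1)[OF apart_comp(1)[OF apart_comp(1)[OF a1(3) a2(1)] a3(1)] a4(1)])
  moreover have "apart m d" unfolding m_def d_def by (rule apart_comp(1)[OF apart_comp(1)[OF a2(3) a3(1)] a4(1)])
  moreover have "apart (f \<circ> m) d" using a4 by (simp add: m_def d_def)
  moreover have "apart (f \<circ> m) c" using apart_comp(1)[OF a3(3) a4(1)] by (simp only: m_def c_def comp_assoc)
  ultimately have ap: "apart m c" "apart m d" "apart c (f \<circ> m)" "apart (f \<circ> m) d" using apart_sym by auto
  define u where "u = swap m c"
  define w where "w = swap c (f \<circ> m)"
  have u: "u \<in> A" "u \<circ> u = id" "u \<circ> c = m" "u \<circ> d = d"
    unfolding u_def using swap_in_A[OF m(1) cd(1) ap(1)] swap_comp_self[OF m(1) cd(1) ap(1)]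
      swap_comp_right[OF m(1) cd(1) ap(1)] swap_comp_other[OF m(1) cd(1) ap(1) cd(2)] ap cd apart_sym by auto
  have w: "w \<in> A" "w \<circ> w = id" "w \<circ> (f \<circ> m) = c" "w \<circ> d = d"
    unfolding w_def using swap_in_A[OF cd(1) m(2) ap(3)] swap_comp_self[OF cd(1) m(2) ap(3)]
      swap_comp_right[OF cd(1) m(2) ap(3)] swap_comp_other[OF cd(1) m(2) ap(3) cd(2)] ap cd apart_sym by auto
  \<comment> \<open>On \<open>comb k\<close> the three factors lead to \<open>m\<close>, to its
    image under \<open>f\<close>, and back to \<open>comb k\<close>, so \<open>v\<close> fixes this
    brick. As \<open>u\<close> and \<open>w\<close> are involutions, \<open>f\<close> is recovered
    from \<open>v\<close>.\<close>
  define v where "v = w \<circ> f \<circ> u"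
  have "v \<circ> c = c" unfolding v_def by (simp only: comp_assoc u(3) w(3))
  then have "v \<in> fixer c" using u w f by (simp add: fixer_def v_def)
  moreover have "w \<circ> v \<circ> u = (w \<circ> w) \<circ> f \<circ> (u \<circ> u)" unfolding v_def by (simp only: comp_assoc)
  then have "f = w \<circ> v \<circ> u" by (simp add: u(2) w(2))
  moreover have "u \<in> fixer d" "w \<in> fixer d" using u w by (auto simp: fixer_def)
  moreover have "k \<in> {1..4}" "l \<in> {1..4}" using kl by (auto simp: J_def)
  ultimately show ?thesis unfolding c_def d_def by blast
qed

end

text \<open>\<open>vanishing\<close> isolates what the geometric part has to know about
  homomorphisms to the reals; \<open>homomorphism_vanishes\<close> supplies it.\<close>

locale hyperbolic_brick_group = brick_monoid Y M h0 h1 + H: hyperbolic_metric_group PG D \<delta>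
  for Y :: "'y set" and M :: "('y \<Rightarrow> 'y) set" and h0 h1 :: "'y \<Rightarrow> 'y" and D :: "('y \<Rightarrow> 'y) \<Rightarrow> ('y \<Rightarrow> 'y) \<Rightarrow> real" and \<delta> :: real +
  assumes vanishing: "\<And>p f. \<lbrakk>\<And>f g. \<lbrakk>f \<in> A; g \<in> A\<rbrakk> \<Longrightarrow> p (f \<circ> g) = p f + p g;
      \<And>m f. \<lbrakk>m \<in> M; f \<in> A\<rbrakk> \<Longrightarrow> p (iota m f) = p f; f \<in> A\<rbrakk> \<Longrightarrow> p f = (0::real)"
begin

abbreviation len :: "('y \<Rightarrow> 'y) \<Rightarrow> real" where
  "len \<equiv> H.len"

lemma centr_iff: "g \<in> H.centr t \<longleftrightarrow> g \<in> A \<and> g \<circ> t = t \<circ> g"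
  by (simp add: H.centr_def)

text \<open>A loxodromic \<open>t = iota h0 f\<close> commutes with infinitely many conjugates of itself. They all translate along
  the axis of \<open>t\<close>, and comparing \<open>k\<close> of them with each other shows that the quasimorphism measuring
  the translation is a homomorphism on each copy of the group.\<close>

lemma not_lin_iota_h0:
  assumes f: "f \<in> A"
  shows "\<not> H.lin (iota h0 f)"
proof
  assume lin: "H.lin (iota h0 f)"
  define t where "t = iota h0 f"
  have t: "t \<in> carrier PG" "H.lin t" using f lin by (auto simp: t_def)
  have tA: "t \<in> A" using t by simp
  obtain q :: "('y \<Rightarrow> 'y) \<Rightarrow> real" and K where Q:
    "(\<forall>g\<in>H.centr t. \<forall>h\<in>H.centr t. \<bar>q (g \<otimes>\<^bsub>PG\<^esub> h) - q g - q h\<bar> \<le> K)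
    \<and> (\<forall>g\<in>H.centr t. \<forall>h\<in>H.centr t. g \<otimes>\<^bsub>PG\<^esub> h = h \<otimes>\<^bsub>PG\<^esub> g \<longrightarrow> q (g \<otimes>\<^bsub>PG\<^esub> h) = q g + q h)
    \<and> (\<forall>g\<in>H.centr t. \<forall>w\<in>H.centr t. q (w \<otimes>\<^bsub>PG\<^esub> g \<otimes>\<^bsub>PG\<^esub> inv\<^bsub>PG\<^esub> w) = q g)
    \<and> (\<forall>g\<in>H.centr t. H.lin g \<longrightarrow> q g \<noteq> 0)"
    using H.centralizer_quasimorphism[OF t] by (elim exE) (rule that)
  have q:
    "\<And>g h. \<lbrakk>g \<in> H.centr t; h \<in> H.centr t\<rbrakk> \<Longrightarrow> \<bar>q (g \<circ> h) - q g - q h\<bar> \<le> K"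
    "\<And>g h. \<lbrakk>g \<in> H.centr t; h \<in> H.centr t; g \<circ> h = h \<circ> g\<rbrakk> \<Longrightarrow> q (g \<circ> h) = q g + q h"
    "\<And>g w. \<lbrakk>g \<in> H.centr t; w \<in> H.centr t\<rbrakk> \<Longrightarrow> q (w \<circ> g \<circ> inv\<^bsub>PG\<^esub> w) = q g"
    "\<And>g. \<lbrakk>g \<in> H.centr t; H.lin g\<rbrakk> \<Longrightarrow> q g \<noteq> 0"
    using Q unfolding PG_simps by blast+
  have iota_c: "iota m g \<in> H.centr t" if "m \<in> M" "apart m h0" "g \<in> A" for m g
    using that f iota_commute[of m h0 g f] by (simp add: centr_iff t_def)
  \<comment> \<open>The swap of two bricks apart from \<open>h0\<close> fixes the brick that carries
    \<open>t\<close>, hence commutes with \<open>t\<close>, and the conjugation invariance of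
    \<open>q\<close> applies to it.\<close>
  have q_swap: "q (iota m g) = q (iota n g)"
    if mn: "m \<in> M" "n \<in> M" "apart m n" "apart m h0" "apart n h0" and g: "g \<in> A" for m n g
  proof -
    let ?w = "swap m n"
    have w: "?w \<in> A" "?w \<circ> h0 = h0" "?w \<circ> m = n"
      using swap_in_A[OF mn(1-3)] swap_comp_other[OF mn(1-3) h0] swap_comp_left[OF mn(1-3)] mn apart_sym by auto
    have "?w \<circ> t \<circ> finv ?w = t" unfolding t_def by (rule iota_conj) (use w f in auto)
    then have "?w \<circ> t = t \<circ> ?w" using w(1) by (metis A_inv_apply(1) comp_apply ext)
    then have wc: "?w \<in> H.centr t" using w by (simp add: centr_iff)
    have "?w \<circ> iota m g \<circ> finv ?w = iota n g" by (rule iota_conj) (use w mn g in auto)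
    then show ?thesis using q(3)[OF iota_c[OF mn(1,4) g] wc] w(1) by simp
  qed
  have combs: "apart (comb (Suc i)) h0" for i using comb_apart_neq[of "Suc i" 0] by (simp add: comb_simps(1))
  define p where "p g = q (iota (comb 1) g)" for g
  have p_comb: "q (iota (comb (Suc i)) g) = p g" if "g \<in> A" for i g
  proof (cases "i = 0")
    case False
    then show ?thesis unfolding p_def
      using q_swap[OF comb_in_M comb_in_M comb_apart_neq combs combs that, of i 0] by simp
  qed (simp add: p_def)
  \<comment> \<open>Inside \<open>comb 1\<close>, the copy of \<open>iota m g\<close> is the copy of
    \<open>g\<close> in a smaller brick; swapping that brick with \<open>comb 2\<close> shows that
    its size does not matter.\<close>
  have p_iota: "p (iota m g) = p g" if m: "m \<in> M" and g: "g \<in> A" for m g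
  proof -
    have "p (iota m g) = q (iota (comb 1 \<circ> m) g)" using m by (simp only: p_def iota_iota comb_in_M)
    also have "\<dots> = q (iota (comb (Suc 1)) g)"
      using m g combs[of 0] by (intro q_swap M_comp comb_in_M apart_comp(1) combs comb_apart_neq) auto
    also have "\<dots> = p g" by (rule p_comb[OF g])
    finally show ?thesis .
  qed
  \<comment> \<open>The product of the copies of \<open>g\<close> in \<open>comb 1\<close>, ...,
    \<open>comb k\<close>; the successor skips \<open>comb 0 = h0\<close>, where \<open>t\<close>
    lives. For fixed \<open>k\<close> this is a homomorphism in \<open>g\<close>, and its value
    under \<open>q\<close> is \<open>k\<close> times \<open>p g\<close>.\<close>
  define X where "X k g = (rec_nat id (\<lambda>i F. iota (comb (Suc i)) g \<circ> F) k :: 'y \<Rightarrow> 'y)" for k g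
  have X0: "X 0 g = id" and XS: "X (Suc k) g = iota (comb (Suc k)) g \<circ> X k g" for k g by (simp_all add: X_def)
  have X_c: "X k g \<in> H.centr t" if "g \<in> A" for k g
  proof (induction k)
    case (Suc k)
    then show ?case using H.centr_mult[OF t(1) iota_c[OF comb_in_M combs that] Suc, of k] by (simp only: XS PG_simps)
  qed (simp only: X0 centr_iff A_id id_comp comp_id simp_thms)
  have X_A: "X k g \<in> A" if "g \<in> A" for k g using X_c[OF that] by (simp add: centr_iff)
  have X_comm: "iota (comb j) h \<circ> X k g = X k g \<circ> iota (comb j) h" if "g \<in> A" "h \<in> A" "j > k" for j k g h
    using that(3)
  proof (induction k)
    case (Suc k)
    have "iota (comb j) h \<circ> iota (comb (Suc k)) g = iota (comb (Suc k)) g \<circ> iota (comb j) h"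
      using that Suc.prems by (intro iota_commute comb_apart_neq comb_in_M) auto
    then show ?case using Suc by (metis Suc_lessD XS comp_assoc)
  qed (simp add: X0)
  have X_mult: "X k (g \<circ> h) = X k g \<circ> X k h" if "g \<in> A" "h \<in> A" for k g h
  proof (induction k)
    case (Suc k)
    have "X (Suc k) (g \<circ> h) = iota (comb (Suc k)) g \<circ> (iota (comb (Suc k)) h \<circ> X k g) \<circ> X k h"
      by (simp only: XS iota_comp[OF comb_in_M that] Suc comp_assoc)
    also have "\<dots> = X (Suc k) g \<circ> X (Suc k) h"
      by (simp only: XS X_comm[OF that lessI] comp_assoc)
    finally show ?case .
  qed (simp add: X0)
  have q_id: "q id = 0" using q(2)[of id id] tA by (simp add: centr_iff)
  have q_X: "q (X k g) = real k * p g" if "g \<in> A" for k g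
  proof (induction k)
    case (Suc k)
    have "q (X (Suc k) g) = q (iota (comb (Suc k)) g) + q (X k g)"
      using q(2)[OF iota_c[OF comb_in_M combs that] X_c[OF that], of k k] X_comm[OF that that lessI] by (simp only: XS PG_simps)
    then show ?case using Suc p_comb[OF that] by (simp only: of_nat_Suc) (simp add: algebra_simps)
  qed (simp only: X0 q_id of_nat_0 mult_zero_left)
  have p_add: "p (g \<circ> h) = p g + p h" if "g \<in> A" "h \<in> A" for g h
  proof -
    \<comment> \<open>The defect bound \<open>K\<close> of \<open>q\<close> does not depend on the
      number \<open>k\<close> of copies.\<close>
    have "real k * \<bar>p (g \<circ> h) - p g - p h\<bar> \<le> K" for k :: nat
    proof -
      have "\<bar>q (X k (g \<circ> h)) - q (X k g) - q (X k h)\<bar> \<le> K"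
        using q(1)[OF X_c[OF that(1)] X_c[OF that(2)], of k k] by (simp only: X_mult[OF that] PG_simps)
      moreover have "real k * \<bar>p (g \<circ> h) - p g - p h\<bar> = \<bar>real k * (p (g \<circ> h) - p g - p h)\<bar>" by (simp add: abs_mult)
      ultimately show ?thesis using that by (simp only: q_X A_comp right_diff_distrib)
    qed
    then have "p (g \<circ> h) - p g - p h = 0" by (rule linear_bounded_imp_zero)
    then show ?thesis by simp
  qed
  have "p f = 0" using vanishing[of p, OF p_add p_iota f] .
  \<comment> \<open>The conjugate of \<open>t\<close> by the swap of \<open>h0\<close> and
    \<open>comb 1\<close> is again \<open>lin\<close> and commutes with \<open>t\<close>, so
    \<open>q\<close> cannot vanish on it; but its value under \<open>q\<close> is
    \<open>p f\<close>.\<close>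
  moreover have "q (iota (comb 1) f) \<noteq> 0"
  proof (rule q(4))
    have ap: "apart h0 (comb 1)" using combs[of 0] by (simp add: apart_sym)
    have "swap h0 (comb 1) \<circ> iota h0 f \<circ> finv (swap h0 (comb 1)) = iota (comb 1) f"
      by (rule iota_conj) (use f swap_in_A[OF h0 comb_in_M ap] swap_comp_left[OF h0 comb_in_M ap] in auto)
    then show "H.lin (iota (comb 1) f)"
      using H.lin_conj[of "swap h0 (comb 1)" t] t swap_in_A[OF h0 comb_in_M ap] by (simp add: t_def)
    show "iota (comb 1) f \<in> H.centr t" using iota_c[OF comb_in_M combs[of 0] f] by simp
  qed
  ultimately show False by (simp add: p_def)
qed

text \<open>The element has to be conjugated into \<open>h0\<close>, and \<open>lin\<close>, unlike
  \<open>lox\<close>, is known to survive conjugation.\<close>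

lemma fixer_not_lox:
  assumes "k \<ge> 1" "f \<in> fixer (comb k)"
  shows "\<not> H.lox f"
proof
  assume l: "H.lox f"
  have fA: "f \<in> A" using assms fixer_in_A by blast
  obtain c where c: "c \<in> A" "\<forall>f\<in>fixer (comb k). \<exists>g\<in>A. c \<circ> f \<circ> finv c = iota h0 g"
    using comb_fixer_conj_iota[OF assms(1)] by blast
  then obtain g where g: "g \<in> A" "c \<circ> f \<circ> finv c = iota h0 g" using assms by blast
  have "H.lin (c \<circ> f \<circ> finv c)" using H.lin_conj[of c f] H.lox_imp_lin[of f] l c(1) fA by simp
  then show False using g not_lin_iota_h0 by simp
qed

text \<open>A fixer is closed under composition and contains no \<open>lox\<close> element, so
  \<open>D_le_max_len\<close> applies to all pairs in it.\<close>

lemma fixer_ultrametric: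
  assumes "k \<ge> 1" "f \<in> fixer (comb k)" "g \<in> fixer (comb k)"
  shows "D f g \<le> max (len f) (len g) + 20 * \<delta>"
  using H.D_le_max_len[of f g] fixer_not_lox[OF assms(1)] assms fixer_comp fixer_in_A by simp

lemma not_lox:
  assumes f: "f \<in> A"
  shows "\<not> H.lox f"
proof (cases "\<exists>R. \<forall>g\<in>A. len (iota h0 g) \<le> R")
  case True
  then obtain R where R: "\<And>g. g \<in> A \<Longrightarrow> len (iota h0 g) \<le> R" by blast
  have "\<exists>C. \<forall>f\<in>fixer (comb k). len f \<le> C" if k: "k \<ge> 1" for k
  proof -
    obtain c where c: "c \<in> A" "\<forall>f\<in>fixer (comb k). \<exists>g\<in>A. c \<circ> f \<circ> finv c = iota h0 g"
      using comb_fixer_conj_iota[OF k] by blast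
    have "len f \<le> R + 2 * len c" if fk: "f \<in> fixer (comb k)" for f
    proof -
      obtain g where g: "g \<in> A" "c \<circ> f \<circ> finv c = iota h0 g" using c fk by blast
      have "f = finv c \<circ> iota h0 g \<circ> c" using c(1) by (simp add: g(2)[symmetric] fun_eq_iff)
      then have "len f \<le> len (finv c \<circ> iota h0 g) + len c"
        using H.len_mult[of "finv c \<circ> iota h0 g" c] c g by simp
      also have "\<dots> \<le> len (finv c) + len (iota h0 g) + len c"
        using H.len_mult[of "finv c" "iota h0 g"] c g by simp
      finally show ?thesis using R[OF g(1)] H.len_inv[of c] c(1) by simp
    qed
    then show ?thesis by blast
  qed
  then obtain C where C: "\<And>k f. k \<ge> 1 \<Longrightarrow> f \<in> fixer (comb k) \<Longrightarrow> len f \<le> C k" by metis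
  define B where "B = Max (C ` {1..4})"
  have B: "len f \<le> B" if "k \<in> {1..4}" "f \<in> fixer (comb k)" for k f
    using C[of k f] that unfolding B_def by (intro Max_ge_iff[THEN iffD2]) auto
  have "len g \<le> 3 * B" if g: "g \<in> A" for g
  proof -
    obtain k l u v w where *: "k \<in> {1..4}" "l \<in> {1..4}" "u \<in> fixer (comb l)" "v \<in> fixer (comb k)" "w \<in> fixer (comb l)" "g = w \<circ> v \<circ> u"
      using factorization[OF g] by blast
    have "u \<in> A" "v \<in> A" "w \<in> A" using * fixer_in_A by blast+
    then show ?thesis using H.len_mult[of "w \<circ> v" u] H.len_mult[of w v] B[OF *(2,3)] B[OF *(1,4)] B[OF *(2,5)] *(6) by simp
  qed
  then show ?thesis using H.not_lox_if_bounded_powers[of f "3 * B"] f H.nat_pow_closed[of f] by simp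
next
  case unbounded: False
  \<comment> \<open>These elements fix every \<open>comb k\<close> with \<open>k \<ge> 1\<close>, so
    they belong to all the fixers at once. Long elements of \<open>Z\<close> stand for the limit
    point that the fixers share.\<close>
  define Z where "Z = iota h0 ` A"
  have Z_fix: "z \<in> fixer (comb k)" if "z \<in> Z" "k \<ge> 1" for z k
    using that iota_comp_other[OF h0 comb_in_M, of k] comb_apart_neq[of 0 k] by (auto simp: Z_def fixer_def comb_simps(1))
  have ZA: "z \<in> A" if "z \<in> Z" for z using that by (auto simp: Z_def)
  have d0: "\<delta> \<ge> 0" by (rule H.delta_nonneg)
  \<comment> \<open>For long \<open>z\<close>, the number \<open>D b z - len z\<close> approximates
    the horofunction of that point at \<open>b\<close>.\<close>
  let ?good = "\<lambda>C b. \<exists>R. \<forall>z\<in>Z. len z > R \<longrightarrow> \<bar>D b z - len z\<bar> \<le> C"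
  \<comment> \<open>Of the \<open>21 * \<delta>\<close>, twenty bound the difference between the
    lengths of \<open>z\<close> and of \<open>y\<close>, its translate by the inverse of
    \<open>a\<close>; one comes from the four-point condition for \<open>b\<close>,
    \<open>y\<close>, \<open>z\<close> and \<open>id\<close>.\<close>
  have good_comp: "?good (C + 21 * \<delta>) (a \<circ> b)"
    if a: "a \<in> fixer (comb k)" "k \<ge> 1" and b: "b \<in> A" and gb: "?good C b" for a b k C
  proof -
    obtain R where R: "\<And>z. z \<in> Z \<Longrightarrow> len z > R \<Longrightarrow> \<bar>D b z - len z\<bar> \<le> C" using gb by blast
    have aA: "a \<in> A" using a fixer_in_A by blast
    \<comment> \<open>In the lower bound for \<open>len z\<close>, the term with
      \<open>len a\<close> lets \<open>len z\<close> dominate in \<open>fixer_ultrametric\<close>,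
      and the term with \<open>len b\<close> excludes the four-point alternative that pairs
      \<open>b\<close> with \<open>id\<close> and \<open>y\<close> with \<open>z\<close>.\<close>
    have "\<bar>D (a \<circ> b) z - len z\<bar> \<le> C + 21 * \<delta>"
      if z: "z \<in> Z" and big: "len z > max R (max (len a + 20 * \<delta>) (2 * len b + 62 * \<delta>))" for z
    proof -
      define y where "y = finv a \<circ> z"
      have zA: "z \<in> A" and zk: "z \<in> fixer (comb k)" using z ZA Z_fix a by auto
      have yk: "y \<in> fixer (comb k)" unfolding y_def using fixer_comp[OF fixer_inv[OF a(1)] zk] .
      have yA: "y \<in> A" using yk fixer_in_A by blast
      have ay: "a \<circ> y = z" unfolding y_def using aA by (simp add: fun_eq_iff)
      have "len y = D a z" using H.D_len[of a z] aA zA by (simp add: y_def)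
      then have up: "len y \<le> len z + 20 * \<delta>" using fixer_ultrametric[OF a(2) a(1) zk] big d0 by (simp add: max_def split: if_splits)
      have ia: "finv a \<in> fixer (comb k)" by (rule fixer_inv[OF a(1)])
      have "D (finv a) y = len z" using H.D_len[of "finv a" y] aA yA ay A_bij[OF aA] by (simp add: inv_inv_eq)
      then have lo: "len y \<ge> len z - 20 * \<delta>"
        using fixer_ultrametric[OF a(2) ia yk] big H.len_inv[of a] aA d0 by (simp add: max_def split: if_splits)
      have yz: "D y z \<le> len z + 40 * \<delta>" using fixer_ultrametric[OF a(2) yk zk] up d0 by (simp add: max_def split: if_splits)
      have Dab: "D (a \<circ> b) z = D b y" using H.D_left[of a b y] aA b yA ay by simp
      have Dbz: "D b z \<ge> len z - len b" using H.D_triangle[of id b z] b zA by (simp add: H.len_def)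
      have one: "D id y = len y" "D id z = len z" "D b id = len b" "D z id = len z" "D y id = len y"
        "D z y = D y z" using b yA zA H.D_sym[of id z] H.D_sym[of id y] H.D_sym[of y z] H.D_sym[of b id] by (simp_all add: H.len_def)
      have bigb: "len z > 2 * len b + 62 * \<delta>" using big by simp
      note facts = one bigb yz Dbz lo d0
      have id: "id \<in> carrier PG" by simp
      have "D b y + len z \<le> D b z + len y + \<delta>"
      proof (rule H.D_four_cases[of b y id z])
        assume "D b y + D id z \<le> D b id + D y z + \<delta>"
        then show ?thesis using facts by linarith
      qed (use b yA zA one in auto)
      moreover have "D b z + len y \<le> D b y + len z + \<delta>"
      proof (rule H.D_four_cases[of b z id y])
        assume "D b z + D id y \<le> D b id + D z y + \<delta>"
        then show ?thesis using facts by linarith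
      qed (use b yA zA one in auto)
      moreover have "\<bar>D b z - len z\<bar> \<le> C" using R[OF z] big by simp
      ultimately show ?thesis unfolding Dab using up lo by linarith
    qed
    then show ?thesis by blast
  qed
  \<comment> \<open>Each of the three factors of \<open>g\<close> contributes
    \<open>21 * \<delta>\<close>, starting from 0 for the identity.\<close>
  have good: "?good (63 * \<delta>) g" if g: "g \<in> A" for g
  proof -
    obtain k l u v w where *: "k \<in> {1..4}" "l \<in> {1..4}" "u \<in> fixer (comb l)" "v \<in> fixer (comb k)" "w \<in> fixer (comb l)" "g = w \<circ> v \<circ> u"
      using factorization[OF g] by blast
    have uvw: "u \<in> A" "v \<in> A" "w \<in> A" using * fixer_in_A by blast+
    have "?good 0 id" by (simp add: H.len_def)
    then have "?good (0 + 21 * \<delta>) (u \<circ> id)" by (intro good_comp[OF *(3)]) (use * in auto)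
    then have "?good (0 + 21 * \<delta> + 21 * \<delta>) (v \<circ> (u \<circ> id))" by (intro good_comp[OF *(4)]) (use * uvw in auto)
    then have "?good (0 + 21 * \<delta> + 21 * \<delta> + 21 * \<delta>) (w \<circ> (v \<circ> (u \<circ> id)))" by (intro good_comp[OF *(5)]) (use * uvw in auto)
    moreover have "w \<circ> (v \<circ> (u \<circ> id)) = g" using *(6) by (simp add: comp_assoc)
    ultimately show ?thesis by (simp add: algebra_simps)
  qed
  show ?thesis
  proof (rule H.not_lox_if_horospherical[of f "63 * \<delta>"])
    fix n :: nat
    have "f [^]\<^bsub>PG\<^esub> n \<in> A" "f [^]\<^bsub>PG\<^esub> (2 * n) \<in> A" using H.nat_pow_closed[of f] f by simp_all
    then obtain R1 R2 where R: "\<forall>z\<in>Z. len z > R1 \<longrightarrow> \<bar>D (f [^]\<^bsub>PG\<^esub> n) z - len z\<bar> \<le> 63 * \<delta>"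
      "\<forall>z\<in>Z. len z > R2 \<longrightarrow> \<bar>D (f [^]\<^bsub>PG\<^esub> (2 * n)) z - len z\<bar> \<le> 63 * \<delta>"
      using good by meson
    obtain g where "g \<in> A" "len (iota h0 g) > max R1 R2" using unbounded by (meson not_le_imp_less)
    then have "iota h0 g \<in> Z" "len (iota h0 g) > R1" "len (iota h0 g) > R2" by (auto simp: Z_def)
    then show "\<exists>z\<in>carrier PG. \<bar>D (f [^]\<^bsub>PG\<^esub> n) z - len z\<bar> \<le> 63 * \<delta> \<and> \<bar>D (f [^]\<^bsub>PG\<^esub> (2 * n)) z - len z\<bar> \<le> 63 * \<delta>"
      using R ZA by (intro bexI[of _ "iota h0 g"]) auto
  qed (use f in simp)
qed

end

section \<open>Vanishing of homomorphisms to the reals\<close>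

text \<open>\<open>S\<close> is the set of cutting directions and \<open>e s i\<close> the map onto
  the half with letter \<open>i\<close> in direction \<open>s\<close>; \<open>U\<close> consists of
  invertible maps, which send directions to directions and keep the letters. In the application
  \<open>U\<close> comes from \<open>G\<close>, and the products of the \<open>e s i\<close>,
  collected in \<open>E\<close>, are the canonical maps of the bricks.\<close>

locale split_monoid = brick_monoid Y M h0 h1
  for Y :: "'y set" and M :: "('y \<Rightarrow> 'y) set" and h0 h1 :: "'y \<Rightarrow> 'y" +
  fixes S :: "'s set" and e :: "'s \<Rightarrow> bool \<Rightarrow> 'y \<Rightarrow> 'y" and U :: "('y \<Rightarrow> 'y) set"
  assumes S_nonempty: "S \<noteq> {}"
    and e_in_M: "s \<in> S \<Longrightarrow> e s i \<in> M"
    and e_disjoint: "s \<in> S \<Longrightarrow> e s False ` Y \<inter> e s True ` Y = {}"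
    and e_cover: "s \<in> S \<Longrightarrow> e s False ` Y \<union> e s True ` Y = Y"
    and e_comm: "\<lbrakk>s \<in> S; t \<in> S; s \<noteq> t\<rbrakk> \<Longrightarrow> e s i \<circ> e t j = e t j \<circ> e s i"
    and U_in_M: "u \<in> U \<Longrightarrow> u \<in> M"
    and U_bij: "u \<in> U \<Longrightarrow> bij u"
    and U_inv: "u \<in> U \<Longrightarrow> finv u \<in> U"
    and U_e: "\<lbrakk>u \<in> U; s \<in> S\<rbrakk> \<Longrightarrow> \<exists>t\<in>S. \<forall>i. u \<circ> e s i = e t i \<circ> u"
begin

section \<open>Partitions into bricks and their successive splittings\<close>

inductive_set E :: "('y \<Rightarrow> 'y) set" where
  E_id: "id \<in> E"
| E_step: "\<lbrakk>x \<in> E; s \<in> S\<rbrakk> \<Longrightarrow> x \<circ> e s i \<in> E"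

text \<open>Made of maps rather than of their images: a twist by an element of \<open>U\<close>
  stays visible, and elements of \<open>A\<close> act on partitions by composition from the
  left.\<close>

definition part :: "('y \<Rightarrow> 'y) set \<Rightarrow> bool" where
  "part P \<longleftrightarrow> finite P \<and> P \<subseteq> M \<and> (\<forall>m\<in>P. \<forall>n\<in>P. m \<noteq> n \<longrightarrow> apart m n) \<and> (\<forall>y\<in>Y. \<exists>m\<in>P. y \<in> m ` Y)"

definition spl :: "('y \<Rightarrow> 'y) set \<Rightarrow> ('y \<Rightarrow> 'y) \<Rightarrow> 's \<Rightarrow> ('y \<Rightarrow> 'y) set" where
  "spl P m s = insert (m \<circ> e s False) (insert (m \<circ> e s True) (P - {m}))"

inductive splits :: "('y \<Rightarrow> 'y) set \<Rightarrow> ('y \<Rightarrow> 'y) set \<Rightarrow> bool" where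
  splits_refl: "splits P P"
| splits_step: "\<lbrakk>splits P Q; m \<in> Q; s \<in> S\<rbrakk> \<Longrightarrow> splits P (spl Q m s)"

lemma splits_trans:
  assumes "splits Q R" "splits P Q"
  shows "splits P R"
  using assms by (induction rule: splits.induct) (auto intro: splits.intros)

lemma e_apart: "s \<in> S \<Longrightarrow> apart (e s False) (e s True)"
  using e_disjoint by (simp add: apart_def)

lemma e_apart_neq: "s \<in> S \<Longrightarrow> i \<noteq> j \<Longrightarrow> apart (e s i) (e s j)"
  using e_apart apart_sym by (cases i; cases j) auto

lemma e_obtain:
  assumes "s \<in> S" "y \<in> Y"
  obtains i x where "x \<in> Y" "y = e s i x"
  using e_cover[OF assms(1)] assms(2) by blast

lemma E_subset_M: "E \<subseteq> M"
proof
  fix x assume "x \<in> E"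
  then show "x \<in> M" by induction (simp_all only: M_id M_comp e_in_M)
qed

lemma U_in_A: "u \<in> U \<Longrightarrow> u \<in> A"
  using U_in_M U_bij M_out by (auto simp: A_def intro!: bexI[of _ id])

lemma not_apart_self: "m \<in> M \<Longrightarrow> \<not> apart m m"
  using nonempty by (auto simp: apart_def)

lemma part_M: "part P \<Longrightarrow> m \<in> P \<Longrightarrow> m \<in> M"
  and part_apart: "part P \<Longrightarrow> m \<in> P \<Longrightarrow> n \<in> P \<Longrightarrow> m \<noteq> n \<Longrightarrow> apart m n"
  and part_cover: "part P \<Longrightarrow> y \<in> Y \<Longrightarrow> \<exists>m\<in>P. y \<in> m ` Y"
  and part_finite: "part P \<Longrightarrow> finite P"
  by (auto simp: part_def)

lemma part_id: "part {id}"
  by (simp add: part_def)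

lemma part_eqI:
  assumes "part P" "f \<in> A" "g \<in> A" "\<And>m. m \<in> P \<Longrightarrow> f \<circ> m = g \<circ> m"
  shows "f = g"
proof (rule A_eqI[OF assms(2,3)])
  fix y assume "y \<in> Y"
  then obtain m x where "m \<in> P" "y = m x" using part_cover[OF assms(1)] by blast
  then show "f y = g y" using assms(4)[of m] by (metis comp_apply)
qed

lemma part_spl:
  assumes P: "part P" and m: "m \<in> P" and s: "s \<in> S"
  shows "part (spl P m s)"
proof -
  have mM: "m \<in> M" using part_M[OF P m] .
  have eM: "e s i \<in> M" for i using e_in_M[OF s] .
  have a: "apart (m \<circ> e s i) n" if "n \<in> P" "n \<noteq> m" for n i
    using part_apart[OF P m that(1)] that(2) by (intro apart_comp(1)[OF _ eM]) auto
  have b: "apart (m \<circ> e s i) (m \<circ> e s j)" if "i \<noteq> j" for i j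
    using e_apart_neq[OF s that] apart_comp_left[OF mM] by blast
  have "\<exists>n\<in>spl P m s. y \<in> n ` Y" if y: "y \<in> Y" for y
  proof -
    obtain n x where n: "n \<in> P" "x \<in> Y" "y = n x" using part_cover[OF P y] by blast
    show ?thesis
    proof (cases "n = m")
      case True
      obtain i z where z: "z \<in> Y" "x = e s i z" using e_obtain[OF s n(2)] by blast
      have "y \<in> (m \<circ> e s i) ` Y" using z n True by auto
      moreover have "m \<circ> e s i \<in> spl P m s" by (cases i) (auto simp: spl_def)
      ultimately show ?thesis by blast
    next
      case False
      then show ?thesis using n by (auto simp: spl_def)
    qed
  qed
  moreover have "apart x y" if x: "x \<in> spl P m s" and y: "y \<in> spl P m s" and ne: "x \<noteq> y" for x y
  proof -
    have "(\<exists>i. z = m \<circ> e s i) \<or> (z \<in> P \<and> z \<noteq> m)" if "z \<in> spl P m s" for z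
      using that by (auto simp: spl_def)
    from this[OF x] this[OF y] show ?thesis
    proof (elim disjE exE conjE)
      fix i j assume xy: "x = m \<circ> e s i" "y = m \<circ> e s j"
      then have "i \<noteq> j" using ne by auto
      then show ?thesis unfolding xy by (rule b)
    next
      fix i assume "x = m \<circ> e s i" "y \<in> P" "y \<noteq> m"
      then show ?thesis using a by simp
    next
      fix i assume "y = m \<circ> e s i" "x \<in> P" "x \<noteq> m"
      then show ?thesis using a apart_sym by simp
    next
      assume "x \<in> P" "y \<in> P"
      then show ?thesis using part_apart[OF P] ne by simp
    qed
  qed
  moreover have "spl P m s \<subseteq> M"
    using part_M[OF P] M_comp[OF mM eM] by (auto simp only: spl_def)
  ultimately show ?thesis using part_finite[OF P] by (simp add: part_def spl_def)
qed

lemma splits_part: "splits P Q \<Longrightarrow> part P \<Longrightarrow> part Q"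
  by (induction rule: splits.induct) (auto intro: part_spl)

lemma spl_E: "P \<subseteq> E \<Longrightarrow> m \<in> P \<Longrightarrow> s \<in> S \<Longrightarrow> spl P m s \<subseteq> E"
  using E_step by (auto simp only: spl_def)

lemma splits_E: "splits P Q \<Longrightarrow> P \<subseteq> E \<Longrightarrow> Q \<subseteq> E"
  by (induction rule: splits.induct) (auto dest: spl_E)

lemma card_spl:
  assumes P: "part P" and m: "m \<in> P" and s: "s \<in> S"
  shows "card (spl P m s) = Suc (card P)"
proof -
  have mM: "m \<in> M" using part_M[OF P m] .
  have eM: "e s i \<in> M" for i using e_in_M[OF s] .
  have a: "apart (m \<circ> e s i) n" if "n \<in> P" "n \<noteq> m" for n i
    using part_apart[OF P m that(1)] that(2) by (intro apart_comp(1)[OF _ eM]) auto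
  have 1: "m \<circ> e s i \<notin> P - {m}" for i using a not_apart_self[OF M_comp[OF mM eM]] by blast
  have 2: "m \<circ> e s False \<noteq> m \<circ> e s True"
    using e_apart[OF s] apart_comp_left[OF mM, of "e s False" "e s True"] not_apart_self[OF M_comp[OF mM eM]] by metis
  have "card P > 0" using m part_finite[OF P] by (auto simp: card_gt_0_iff)
  then show ?thesis using 1 2 m part_finite[OF P] by (simp add: spl_def card_Diff_singleton)
qed

lemma A_comp_inj: "f \<in> A \<Longrightarrow> inj ((\<circ>) f)"
proof (rule injI, rule ext)
  fix x y z assume f: "f \<in> A" and "f \<circ> x = f \<circ> y"
  then have "f (x z) = f (y z)" by (metis comp_apply)
  then show "x z = y z" using bij_is_inj[OF A_bij[OF f]] by (simp add: inj_eq)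
qed

lemma comp_image_comp: "(\<circ>) (f \<circ> g) ` P = (\<circ>) f ` (\<circ>) g ` P"
  unfolding image_image by (rule image_cong[OF refl]) (rule comp_assoc)

lemma comp_image_id: "(\<circ>) id ` P = P"
  by (simp add: image_iff set_eq_iff)

lemma A_image_spl:
  assumes f: "f \<in> A"
  shows "(\<circ>) f ` spl P m s = spl ((\<circ>) f ` P) (f \<circ> m) s"
proof -
  have "(\<circ>) f ` (P - {m}) = (\<circ>) f ` P - {f \<circ> m}"
    using image_set_diff[OF A_comp_inj[OF f], of P "{m}"] by simp
  then show ?thesis by (simp only: spl_def image_insert comp_assoc)
qed

text \<open>Splitting composes on the right and \<open>f\<close> on the left, so the two operations
  do not interfere.\<close>

lemma A_image_splits:
  assumes f: "f \<in> A" and "splits P Q"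
  shows "splits ((\<circ>) f ` P) ((\<circ>) f ` Q)"
  using assms(2)
proof induction
  case (splits_step P Q m s)
  show ?case unfolding A_image_spl[OF f]
    by (rule splits.splits_step[OF splits_step.IH imageI[OF splits_step.hyps(2)] splits_step.hyps(3)])
qed (rule splits_refl)

lemma A_image_part:
  assumes f: "f \<in> A" and P: "part P" and M: "\<And>m. m \<in> P \<Longrightarrow> f \<circ> m \<in> M"
  shows "part ((\<circ>) f ` P)"
proof -
  have "\<exists>n\<in>(\<circ>) f ` P. y \<in> n ` Y" if y: "y \<in> Y" for y
  proof -
    have "finv f y \<in> Y" using A_in[OF A_inv[OF f] y] .
    then obtain m x where m: "m \<in> P" "x \<in> Y" "finv f y = m x" using part_cover[OF P] by blast
    then have "y = (f \<circ> m) x" using A_inv_apply(2)[OF f, of y] by simp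
    then show ?thesis using m by blast
  qed
  moreover have "\<forall>m\<in>(\<circ>) f ` P. \<forall>n\<in>(\<circ>) f ` P. m \<noteq> n \<longrightarrow> apart m n"
    using part_apart[OF P] by (auto simp: apart_A_comp[OF f])
  ultimately show ?thesis using M part_finite[OF P] unfolding part_def by blast
qed

text \<open>In terms of simple splits, \<open>b\<close> is the inverse of the split along
  \<open>t\<close> after the split along \<open>s\<close>; it changes the direction of a
  cut.\<close>

lemma glue_halves:
  assumes s: "s \<in> S" and t: "t \<in> S"
  shows "\<exists>b\<in>A. \<forall>i. b \<circ> e s i = e t i"
proof -
  define b where "b s t y = (if y \<in> e s False ` Y then e t False (finv (e s False) y)
    else if y \<in> e s True ` Y then e t True (finv (e s True) y) else y)" for s t y
  have b_e: "b s t (e s i x) = e t i x" if st: "s \<in> S" "t \<in> S" for s t i x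
  proof (cases "x \<in> Y")
    case True
    then show ?thesis using e_disjoint[OF st(1)] e_in_M[OF st(1)] by (cases i) (auto simp: b_def)
  next
    case False
    then have "e s i x = x" "e t i x = x" using M_out e_in_M st by auto
    moreover have "x \<notin> e s j ` Y" for j using image_M_subset[OF e_in_M[OF st(1)]] False by blast
    ultimately show ?thesis by (simp add: b_def)
  qed
  have out: "b s t y = y" if "s \<in> S" "y \<notin> Y" for s t y
    using image_M_subset[OF e_in_M[OF that(1)]] that(2) by (auto simp: b_def)
  have inv: "b t s (b s t y) = y" if "s \<in> S" "t \<in> S" for s t y
  proof (cases "y \<in> Y")
    case True
    then show ?thesis using e_obtain[OF that(1)] b_e that by metis
  qed (simp add: out that)
  have be: "b s t \<circ> e s i = e t i" for i using b_e[OF s t] by auto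
  have "b s t \<in> A"
  proof (rule A_I[of "b t s"])
    fix y assume "y \<in> Y"
    then obtain i x where x: "x \<in> Y" "y = e s i x" using e_obtain[OF s] by blast
    show "\<exists>m\<in>M. y \<in> m ` Y \<and> b s t \<circ> m \<in> M"
      by (rule bexI[of _ "e s i"]) (use be x e_in_M s t in auto)
  qed (use inv out s t in auto)
  then show ?thesis using be by blast
qed

section \<open>The kernel of a homomorphism invariant under passing to smaller bricks\<close>

context
  fixes p :: "('y \<Rightarrow> 'y) \<Rightarrow> real"
  assumes p_add: "\<And>f g. \<lbrakk>f \<in> A; g \<in> A\<rbrakk> \<Longrightarrow> p (f \<circ> g) = p f + p g"
    and p_iota: "\<And>m f. \<lbrakk>m \<in> M; f \<in> A\<rbrakk> \<Longrightarrow> p (iota m f) = p f"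
begin

lemma p_id: "p id = 0"
  using p_add[OF A_id A_id] by simp

lemma p_inv:
  assumes "f \<in> A"
  shows "p (finv f) = - p f"
proof -
  have "f \<circ> finv f = id" using assms by (auto simp: fun_eq_iff)
  then show ?thesis using p_add[OF assms A_inv[OF assms]] p_id by simp
qed

lemma p_swap:
  assumes "m \<in> M" "n \<in> M" "apart m n"
  shows "p (swap m n) = 0"
  using p_add[OF swap_in_A[OF assms] swap_in_A[OF assms]] swap_comp_self[OF assms] p_id by simp

text \<open>Two copies in disjoint halves, each contributing \<open>p f\<close>; this doubling is
  the source of the equations \<open>p b = 2 * p b\<close>.\<close>

lemma copy_on_halves:
  assumes s: "s \<in> S" and f: "f \<in> A"
  shows "\<exists>F\<in>A. p F = 2 * p f \<and> (\<forall>i. \<forall>y\<in>Y. F (e s i y) = e s i (f y))"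
proof -
  have eM: "e s i \<in> M" for i using e_in_M s by auto
  define I where "I i = iota (e s i) f" for i
  have IA: "I i \<in> A" for i using iota_in_A[OF eM f] by (simp add: I_def)
  have I_same: "I i (e s i y) = e s i (f y)" if "y \<in> Y" for i y using that eM by (simp add: I_def)
  have I_other: "I i (e s j y) = e s j y" if "y \<in> Y" "i \<noteq> j" for i j y
    using that e_apart_neq[OF s that(2)] unfolding I_def by (intro iota_other) (auto simp: apart_def)
  have "(I False \<circ> I True) (e s i y) = e s i (f y)" if "y \<in> Y" for i y
    using that A_in[OF f that] by (cases i) (simp_all add: I_same I_other)
  moreover have "p (I False \<circ> I True) = 2 * p f"
    using p_add[OF IA IA] p_iota[OF eM f] by (simp add: I_def)
  ultimately show ?thesis using A_comp[OF IA IA] by blast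
qed

text \<open>Applying \<open>b\<close> on both halves agrees with \<open>b\<close> up to swapping two quarter bricks, so \<open>p b = 2 * p b\<close>.\<close>

lemma glue_halves_p:
  assumes s: "s \<in> S" and t: "t \<in> S"
  shows "\<exists>b\<in>A. p b = 0 \<and> (\<forall>i. b \<circ> e s i = e t i)"
proof (cases "s = t")
  case True
  then show ?thesis using p_id by (intro bexI[of _ id]) auto
next
  case ne: False
  obtain b where b: "b \<in> A" "\<And>i. b \<circ> e s i = e t i" using glue_halves[OF s t] by blast
  have eM: "e s i \<in> M" "e t i \<in> M" for i using e_in_M s t by auto
  \<comment> \<open>\<open>b\<close> sends \<open>e s i (e s j x)\<close> to
    \<open>e s j (e t i x)\<close>, while the copies of \<open>b\<close> on the two halves send it
    to \<open>e s i (e t j x)\<close>. The results differ only for \<open>i \<noteq> j\<close>, by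
    exchanging the mixed quarters \<open>?m\<close> and \<open>?n\<close>.\<close>
  let ?m = "e s False \<circ> e t True" and ?n = "e s True \<circ> e t False"
  have mn: "?m \<in> M" "?n \<in> M" "apart ?m ?n"
    using M_comp[OF eM(1) eM(2)] apart_comp(1)[OF apart_comp(2)[OF e_apart[OF s] eM(2)] eM(2)] by blast+
  let ?w = "swap ?m ?n"
  obtain F where F: "F \<in> A" "p F = 2 * p b" "\<And>i y. y \<in> Y \<Longrightarrow> F (e s i y) = e s i (b y)"
    using copy_on_halves[OF s b(1)] by blast
  have b': "b (e s i y) = e t i y" for i y using b(2) by (metis comp_apply)
  have comm: "e s i (e t j y) = e t j (e s i y)" for i j y using e_comm[OF s t ne] by (metis comp_apply)
  have "b = ?w \<circ> F"
  proof (rule A_eqI)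
    fix y assume "y \<in> Y"
    then obtain i z where z: "z \<in> Y" "y = e s i z" using e_obtain[OF s] by blast
    obtain j x where x: "x \<in> Y" "z = e s j x" using e_obtain[OF s z(1)] by blast
    have et: "e t j x \<in> Y" for j using M_in[OF eM(2) x(1)] .
    have "F y = e s i (b z)" using z F(3) by simp
    also have "\<dots> = e s i (e t j x)" using x b' by simp
    also have "?w \<dots> = e s j (e t i x)"
    proof -
      have ap: "apart (e s k \<circ> e t k) ?m" "apart (e s k \<circ> e t k) ?n" for k
      proof -
        have tt: "apart (e t False) (e t True)" "apart (e t True) (e t False)" using e_apart_neq[OF t, of False True] e_apart_neq[OF t, of True False] by simp_all
        have st: "apart (e s False \<circ> e t k) (e s True \<circ> e t l)" "apart (e s True \<circ> e t k) (e s False \<circ> e t l)" for k l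
          using apart_comp(1)[OF apart_comp(2)[OF e_apart_neq[OF s, of False True] eM(2)] eM(2)]
            apart_comp(1)[OF apart_comp(2)[OF e_apart_neq[OF s, of True False] eM(2)] eM(2)] by simp_all
        show "apart (e s k \<circ> e t k) ?m" "apart (e s k \<circ> e t k) ?n"
          using st tt apart_comp_left[OF eM(1)] by (cases k; auto)+
      qed
      consider "i = j" | "i = False" "j = True" | "i = True" "j = False" by (cases i; cases j) auto
      then show ?thesis
      proof cases
        case 1
        have "?w \<circ> (e s i \<circ> e t i) = e s i \<circ> e t i"
          by (rule swap_comp_other[OF mn M_comp[OF eM(1) eM(2)] ap])
        from fun_cong[OF this, of x] show ?thesis unfolding 1 by (simp only: comp_apply)
      next
        case 2
        then show ?thesis using swap_left[OF mn x(1)] by simp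
      next
        case 3
        then show ?thesis using swap_right[OF mn x(1)] by simp
      qed
    qed
    also have "\<dots> = b y" using z x b' comm by simp
    finally show "b y = (?w \<circ> F) y" unfolding comp_apply by (rule sym)
  qed (intro b(1) A_comp F(1) swap_in_A[OF mn])+
  then have "p b = p ?w + p F" using p_add[OF swap_in_A[OF mn] F(1)] by (simp only:)
  then have "p b = 0" using p_swap[OF mn] F(2) by simp
  then show ?thesis using b by blast
qed

text \<open>A unit acts like its own copies on the two halves along \<open>s\<close>, followed by
  the change of direction from \<open>s\<close> to \<open>t\<close>. The latter has value 0, so
  \<open>p u = 2 * p u\<close>.\<close>

lemma p_unit:
  assumes u: "u \<in> U"
  shows "p u = 0"
proof -
  obtain s where s: "s \<in> S" using S_nonempty by blast
  obtain t where t: "t \<in> S" "\<And>i. u \<circ> e s i = e t i \<circ> u" using U_e[OF u s] by blast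
  obtain b where b: "b \<in> A" "p b = 0" "\<And>i. b \<circ> e s i = e t i" using glue_halves_p[OF s t(1)] by blast
  have uA: "u \<in> A" using U_in_A[OF u] .
  obtain F where F: "F \<in> A" "p F = 2 * p u" "\<And>i y. y \<in> Y \<Longrightarrow> F (e s i y) = e s i (u y)"
    using copy_on_halves[OF s uA] by blast
  have "u = b \<circ> F"
  proof (rule A_eqI)
    fix y assume "y \<in> Y"
    then obtain i z where z: "z \<in> Y" "y = e s i z" using e_obtain[OF s] by blast
    have "F y = e s i (u z)" using z F(3) by simp
    also have "b \<dots> = e t i (u z)" using b(3) by (metis comp_apply)
    also have "\<dots> = u y" using t(2) z by (metis comp_apply)
    finally show "u y = (b \<circ> F) y" unfolding comp_apply by (rule sym)
  qed (intro uA b(1) A_comp F(1))+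
  then have "p u = p b + p F" using p_add[OF b(1) F(1)] by (simp only:)
  then show ?thesis using b(2) F(2) by simp
qed

definition eqv :: "('y \<Rightarrow> 'y) set \<Rightarrow> ('y \<Rightarrow> 'y) set \<Rightarrow> bool" where
  "eqv P Q \<longleftrightarrow> (\<exists>f\<in>A. p f = 0 \<and> (\<circ>) f ` P = Q)"

lemma swap_image_part:
  assumes P: "part P" and mn: "m \<in> P" "n \<in> P" "m \<noteq> n"
  shows "(\<circ>) (swap m n) ` P = P"
proof -
  have M: "m \<in> M" "n \<in> M" "apart m n" using part_M[OF P] part_apart[OF P] mn by auto
  have "swap m n \<circ> k = k" if "k \<in> P" "k \<noteq> m" "k \<noteq> n" for k
    using swap_comp_other[OF M part_M[OF P that(1)]] part_apart[OF P that(1)] that mn by blast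
  then have "(\<circ>) (swap m n) ` (P - {m, n}) = (\<lambda>k. k) ` (P - {m, n})" by (intro image_cong) auto
  then have "(\<circ>) (swap m n) ` (P - {m, n}) = P - {m, n}" by (simp only: image_ident)
  moreover have "P = insert m (insert n (P - {m, n}))" using mn by auto
  ultimately have "(\<circ>) (swap m n) ` P = insert (swap m n \<circ> m) (insert (swap m n \<circ> n) (P - {m, n}))"
    by (metis image_insert)
  also have "\<dots> = P" unfolding swap_comp_left[OF M] swap_comp_right[OF M] using mn by blast
  finally show ?thesis .
qed

text \<open>Such an \<open>f\<close> is a product of swaps of members of \<open>P\<close>, on which
  \<open>p\<close> vanishes. The induction reduces the number of moved members.\<close>

lemma p_permuting:
  assumes P: "part P"
  shows "f \<in> A \<Longrightarrow> (\<circ>) f ` P = P \<Longrightarrow> p f = 0"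
proof (induction "card {m\<in>P. f \<circ> m \<noteq> m}" arbitrary: f rule: less_induct)
  case less
  show ?case
  proof (cases "\<forall>m\<in>P. f \<circ> m = m")
    case True
    then have "f = id" by (intro part_eqI[OF P less.prems(1) A_id]) auto
    then show ?thesis using p_id by simp
  next
    case False
    then obtain m where m: "m \<in> P" "f \<circ> m \<noteq> m" by blast
    define n where "n = f \<circ> m"
    have n: "n \<in> P" "n \<noteq> m" using m less.prems(2) by (auto simp: n_def)
    have M: "n \<in> M" "m \<in> M" "apart n m" using part_M[OF P] part_apart[OF P] m n by auto
    \<comment> \<open>Bringing \<open>n\<close> back to \<open>m\<close> makes \<open>m\<close>
      fixed, and it disturbs no member that was fixed before, since \<open>n\<close> is the image of
      \<open>m\<close> alone.\<close>
    let ?w = "swap n m"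
    have g: "?w \<circ> f \<in> A" by (rule A_comp[OF swap_in_A[OF M] less.prems(1)])
    have img: "(\<circ>) (?w \<circ> f) ` P = P"
      by (simp only: comp_image_comp less.prems(2) swap_image_part[OF P n(1) m(1) n(2)])
    have "?w \<circ> f \<circ> m = m" using swap_comp_left[OF M] by (simp only: n_def[symmetric] comp_assoc)
    moreover have "?w \<circ> f \<circ> k = k" if k: "k \<in> P" "f \<circ> k = k" for k
    proof -
      have "k \<noteq> m" using k m by auto
      moreover have "k \<noteq> n" using k \<open>k \<noteq> m\<close> injD[OF A_comp_inj[OF less.prems(1)], of k m] by (auto simp: n_def)
      ultimately have "apart k n" "apart k m" using part_apart[OF P k(1)] n m by auto
      then have "?w \<circ> k = k" by (rule swap_comp_other[OF M part_M[OF P k(1)]])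
      then show ?thesis using k(2) by (simp only: comp_assoc)
    qed
    ultimately have "{k\<in>P. ?w \<circ> f \<circ> k \<noteq> k} \<subset> {k\<in>P. f \<circ> k \<noteq> k}" using m by blast
    then have "card {k\<in>P. ?w \<circ> f \<circ> k \<noteq> k} < card {k\<in>P. f \<circ> k \<noteq> k}"
      by (rule psubset_card_mono[rotated]) (use part_finite[OF P] in simp)
    then have "p (?w \<circ> f) = 0" using less.hyps g img by blast
    then show ?thesis using p_add[OF swap_in_A[OF M] less.prems(1)] p_swap[OF M] by simp
  qed
qed

text \<open>Neither the member that is cut nor the direction matters: \<open>w\<close> permutes
  \<open>Q\<close> and brings the image of \<open>m\<close> to \<open>n\<close>, and the copy of
  \<open>b\<close> in the brick of \<open>n\<close> turns the cut along \<open>s\<close> into the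
  cut along \<open>t\<close>. All of these lie in the kernel of \<open>p\<close>.\<close>

lemma eqv_spl:
  assumes P: "part P" and Q: "part Q" and PQ: "eqv P Q" and m: "m \<in> P" and n: "n \<in> Q"
    and s: "s \<in> S" and t: "t \<in> S"
  shows "eqv (spl P m s) (spl Q n t)"
proof -
  obtain f where f: "f \<in> A" "p f = 0" "(\<circ>) f ` P = Q" using PQ by (auto simp: eqv_def)
  have "\<exists>w\<in>A. p w = 0 \<and> (\<circ>) w ` Q = Q \<and> w \<circ> (f \<circ> m) = n"
  proof (cases "f \<circ> m = n")
    case True
    then show ?thesis using p_id by (intro bexI[of _ id]) auto
  next
    case False
    have fm: "f \<circ> m \<in> Q" using f m by auto
    have M: "f \<circ> m \<in> M" "n \<in> M" "apart (f \<circ> m) n" using part_M[OF Q] part_apart[OF Q] fm n False by blast+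
    show ?thesis
      using swap_in_A[OF M] p_swap[OF M] swap_image_part[OF Q fm n False] swap_comp_left[OF M] by blast
  qed
  then obtain w where w: "w \<in> A" "p w = 0" "(\<circ>) w ` Q = Q" "w \<circ> (f \<circ> m) = n" by blast
  define g where "g = w \<circ> f"
  have g: "g \<in> A" "p g = 0" "(\<circ>) g ` P = Q" "g \<circ> m = n"
  proof -
    show "g \<in> A" unfolding g_def by (rule A_comp[OF w(1) f(1)])
    show "p g = 0" using w f p_add by (simp add: g_def)
    show "(\<circ>) g ` P = Q" by (simp only: g_def comp_image_comp w(3) f(3))
    show "g \<circ> m = n" using w(4) by (simp only: g_def comp_assoc)
  qed
  obtain b where b: "b \<in> A" "p b = 0" "\<And>i. b \<circ> e s i = e t i" using glue_halves_p[OF s t] by blast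
  have nM: "n \<in> M" using part_M[OF Q n] .
  let ?I = "iota n b"
  have 1: "?I \<circ> (n \<circ> e s i) = n \<circ> e t i" for i
    using iota_comp_self[OF nM b(1)] b(3) by (metis comp_assoc)
  have "?I \<circ> k = k" if "k \<in> Q - {n}" for k
    using that part_M[OF Q] part_apart[OF Q n] by (intro iota_comp_other[OF nM]) auto
  then have "(\<circ>) ?I ` (Q - {n}) = (\<lambda>k. k) ` (Q - {n})" by (intro image_cong) auto
  then have "(\<circ>) ?I ` (Q - {n}) = Q - {n}" by (simp only: image_ident)
  then have I: "(\<circ>) ?I ` spl Q n s = spl Q n t"
    by (simp only: spl_def image_insert 1)
  have "(\<circ>) (?I \<circ> g) ` spl P m s = (\<circ>) ?I ` ((\<circ>) g ` spl P m s)"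
    by (rule comp_image_comp)
  also have "\<dots> = spl Q n t" by (simp only: A_image_spl[OF g(1)] g(3,4) I)
  finally have "(\<circ>) (?I \<circ> g) ` spl P m s = spl Q n t" .
  moreover have "p (?I \<circ> g) = 0" using p_add[OF iota_in_A[OF nM b(1)] g(1)] p_iota[OF nM b(1)] b g by simp
  ultimately show ?thesis unfolding eqv_def using iota_in_A[OF nM b(1)] g(1) A_comp by blast
qed

text \<open>By \<open>eqv_spl\<close> the last cuts of two trees can be matched as soon as the trees
  without them can, so only the number of leaves counts.\<close>

lemma tree_eqv:
  assumes "splits {id} T" "splits {id} T'" "card T = card T'"
  shows "eqv T T'"
proof -
  have card: "card Q \<ge> 1" if "splits {id} Q" for Q
  proof -
    have Q: "part Q" using splits_part[OF that part_id] .
    then have "Q \<noteq> {}" using nonempty part_cover[OF Q] by blast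
    then show ?thesis using part_finite[OF Q] by (simp add: Suc_le_eq card_gt_0_iff)
  qed
  \<comment> \<open>Rule induction needs a variable for the start of the splitting; an equation ties
    it to \<open>{id}\<close>.\<close>
  have "splits R T \<Longrightarrow> R = {id} \<Longrightarrow> splits {id} T' \<Longrightarrow> card T = card T' \<Longrightarrow> eqv T T'" for R T T'
  proof (induction arbitrary: T' rule: splits.induct)
    case (splits_refl P)
    show ?case using splits_refl(2)
    proof cases
      case splits_refl
      then show ?thesis using p_id \<open>P = {id}\<close> by (auto simp: eqv_def intro!: bexI[of _ id])
    next
      case (splits_step Q m s)
      then have "card T' = Suc (card Q)" using card_spl splits_part part_id by blast
      then show ?thesis using card[OF splits_step(2)] splits_refl by simp
    qed
  next
    case (splits_step P Q m s)
    have Q: "part Q" using splits_step.hyps(1) splits_step.prems(1) splits_part part_id by blast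
    have cQ: "card (spl Q m s) = Suc (card Q)" by (rule card_spl[OF Q splits_step.hyps(2,3)])
    have cQ1: "card Q \<ge> 1" using card splits_step.hyps(1) splits_step.prems(1) by blast
    show ?case using splits_step.prems(2)
    proof cases
      case splits_refl
      then show ?thesis using cQ cQ1 splits_step.prems(3) by simp
    next
      case inner: (splits_step Q' n t)
      have Q': "part Q'" using inner(2) splits_part part_id by blast
      have "card T' = Suc (card Q')" using card_spl[OF Q' inner(3,4)] inner(1) by simp
      then have "card Q = card Q'" using cQ splits_step.prems(3) by simp
      then have "eqv Q Q'" by (rule splits_step.IH[OF splits_step.prems(1) inner(2)])
      then show ?thesis unfolding inner(1) using Q Q' splits_step.hyps inner by (intro eqv_spl) auto
    qed
  qed
  then show ?thesis using assms by blast
qed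

end

end

text \<open>A separate locale, because the assumptions speak of \<open>E\<close>,
  \<open>part\<close> and \<open>splits\<close>. In the application \<open>domain_partition\<close>
  is where the compactness of the cube enters.\<close>

locale split_monoid_refine = split_monoid Y M h0 h1 S e U
  for Y :: "'y set" and M :: "('y \<Rightarrow> 'y) set" and h0 h1 :: "'y \<Rightarrow> 'y"
    and S :: "'s set" and e :: "'s \<Rightarrow> bool \<Rightarrow> 'y \<Rightarrow> 'y" and U :: "('y \<Rightarrow> 'y) set" +
  assumes decomp: "m \<in> M \<Longrightarrow> \<exists>x\<in>E. \<exists>u\<in>U. m = x \<circ> u"
    and domain_partition: "f \<in> A \<Longrightarrow> \<exists>P. part P \<and> (\<forall>m\<in>P. m \<in> E \<and> f \<circ> m \<in> M)"
    and common_refinement: "\<lbrakk>part P; P \<subseteq> E\<rbrakk> \<Longrightarrow> \<exists>T. splits {id} T \<and> splits P T"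
begin

text \<open>For \<open>m = x u\<close>, the copy of the inverse of \<open>u\<close> in the brick of
  \<open>m\<close> replaces \<open>m\<close> by \<open>x\<close>. By \<open>p_iota\<close> and
  \<open>p_unit\<close> it lies in the kernel of \<open>p\<close>, and each round lowers the number
  of twisted members.\<close>

lemma untwist:
  assumes p_add: "\<And>f g. \<lbrakk>f \<in> A; g \<in> A\<rbrakk> \<Longrightarrow> p (f \<circ> g) = p f + p g"
    and p_iota: "\<And>m f. \<lbrakk>m \<in> M; f \<in> A\<rbrakk> \<Longrightarrow> p (iota m f) = p f"
  shows "part Q \<Longrightarrow> \<exists>f\<in>A. p f = (0::real) \<and> part ((\<circ>) f ` Q) \<and> (\<circ>) f ` Q \<subseteq> E"
proof (induction "card (Q - E)" arbitrary: Q rule: less_induct)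
  case less
  show ?case
  proof (cases "Q \<subseteq> E")
    case True
    then show ?thesis using less.prems p_id[OF p_add p_iota] A_id comp_image_id by metis
  next
    case False
    then obtain m where m: "m \<in> Q" "m \<notin> E" by blast
    have mM: "m \<in> M" using part_M[OF less.prems m(1)] .
    obtain x u where xu: "x \<in> E" "u \<in> U" "m = x \<circ> u" using decomp[OF mM] by blast
    have iu: "finv u \<in> A" "finv u \<in> M" using U_in_A[OF U_inv] U_in_M[OF U_inv] xu(2) by auto
    let ?I = "iota m (finv u)"
    have IA: "?I \<in> A" by (rule iota_in_A[OF mM iu(1)])
    have "m \<circ> finv u = x" using U_bij[OF xu(2)] by (simp add: xu(3) comp_assoc bij_is_surj surj_iff[THEN iffD1])
    then have Im: "?I \<circ> m = x" using iota_comp_self[OF mM iu(1)] by simp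
    have fixed: "?I \<circ> k = k" if "k \<in> Q - {m}" for k
      using that part_M[OF less.prems] part_apart[OF less.prems m(1)] by (intro iota_comp_other[OF mM]) auto
    then have "(\<circ>) ?I ` (Q - {m}) = (\<lambda>k. k) ` (Q - {m})" by (intro image_cong) auto
    then have rest: "(\<circ>) ?I ` (Q - {m}) = Q - {m}" by (simp only: image_ident)
    have "(\<circ>) ?I ` Q = (\<circ>) ?I ` insert m (Q - {m})" by (simp only: insert_Diff[OF m(1)])
    also have "\<dots> = insert x (Q - {m})" by (simp only: image_insert Im rest)
    finally have img: "(\<circ>) ?I ` Q = insert x (Q - {m})" .
    have "?I \<circ> k \<in> M" if k: "k \<in> Q" for k
    proof (cases "k = m")
      case True
      then show ?thesis using Im xu(1) E_subset_M by auto
    next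
      case False
      then have "?I \<circ> k = k" using fixed k by simp
      then show ?thesis using part_M[OF less.prems k] by simp
    qed
    then have part: "part ((\<circ>) ?I ` Q)" by (rule A_image_part[OF IA less.prems])
    have diff: "insert x (Q - {m}) - E = Q - E - {m}" using xu(1) by auto
    have "card ((\<circ>) ?I ` Q - E) < card (Q - E)"
      unfolding img diff by (rule card_Diff1_less) (use part_finite[OF less.prems] m in simp_all)
    from less.hyps[OF this part] obtain f where f: "f \<in> A" "p f = 0" "part ((\<circ>) f ` (\<circ>) ?I ` Q)" "(\<circ>) f ` (\<circ>) ?I ` Q \<subseteq> E"
      by blast
    have "(\<circ>) f ` (\<circ>) ?I ` Q = (\<circ>) (f \<circ> ?I) ` Q" by (rule comp_image_comp[symmetric])
    moreover have "p (f \<circ> ?I) = 0"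
      using p_add[OF f(1) IA] f(2) p_iota[OF mM iu(1)] p_unit[OF p_add p_iota U_inv[OF xu(2)]] by simp
    ultimately show ?thesis using f A_comp[OF f(1) IA] by (intro bexI[of _ "f \<circ> ?I"]) auto
  qed
qed

text \<open>After untwisting, \<open>f\<close> carries one tree to another with equally many leaves.
  By \<open>tree_eqv\<close> an element of the kernel does so too, and the two differ by a
  permutation of the leaves, to which \<open>p_permuting\<close> applies.\<close>

theorem homomorphism_vanishes:
  assumes p_add: "\<And>f g. \<lbrakk>f \<in> A; g \<in> A\<rbrakk> \<Longrightarrow> p (f \<circ> g) = p f + p g"
    and p_iota: "\<And>m f. \<lbrakk>m \<in> M; f \<in> A\<rbrakk> \<Longrightarrow> p (iota m f) = p f"
    and f: "f \<in> A"
  shows "p f = (0::real)"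
proof -
  note pp = p_add p_iota
  obtain P where P: "part P" "\<And>m. m \<in> P \<Longrightarrow> m \<in> E" "\<And>m. m \<in> P \<Longrightarrow> f \<circ> m \<in> M" using domain_partition[OF f] by blast
  obtain h where h: "h \<in> A" "p h = 0" "part ((\<circ>) h ` (\<circ>) f ` P)" "(\<circ>) h ` (\<circ>) f ` P \<subseteq> E"
    using untwist[OF pp A_image_part[OF f P(1,3)]] by blast
  define g where "g = h \<circ> f"
  have g: "g \<in> A" "p g = p f" using h f p_add[OF h(1) f] A_comp[OF h(1) f] by (auto simp: g_def)
  have gP: "(\<circ>) g ` P = (\<circ>) h ` (\<circ>) f ` P" unfolding g_def by (rule comp_image_comp)
  have PE: "P \<subseteq> E" using P(2) by blast
  \<comment> \<open>Two refinements in turn: \<open>T1\<close> refines the source to a tree,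
    \<open>T2\<close> then refines the image of \<open>T1\<close> to a tree. The preimage
    \<open>T3\<close> of \<open>T2\<close> is still a tree, because it arises from \<open>T1\<close>
    by splitting.\<close>
  obtain T1 where T1: "splits {id} T1" "splits P T1" using common_refinement[OF P(1) PE] by blast
  have s1: "splits ((\<circ>) g ` P) ((\<circ>) g ` T1)" by (rule A_image_splits[OF g(1) T1(2)])
  have "part ((\<circ>) g ` T1)" "(\<circ>) g ` T1 \<subseteq> E"
    using splits_part[OF s1] splits_E[OF s1] h(3,4) by (simp_all only: gP)
  then obtain T2 where T2: "splits {id} T2" "splits ((\<circ>) g ` T1) T2" using common_refinement by blast
  define T3 where "T3 = (\<circ>) (finv g) ` T2"
  have gi: "finv g \<circ> g = id" "g \<circ> finv g = id" using g(1) by (auto simp: fun_eq_iff)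
  have "(\<circ>) (finv g) ` (\<circ>) g ` T1 = T1"
    by (simp only: comp_image_comp[symmetric] gi(1) comp_image_id)
  then have "splits T1 T3" using A_image_splits[OF A_inv[OF g(1)] T2(2)] by (simp only: T3_def)
  then have T3: "splits {id} T3" using splits_trans T1(1) by blast
  have gT3: "(\<circ>) g ` T3 = T2" by (simp only: T3_def comp_image_comp[symmetric] gi(2) comp_image_id)
  have "card T3 = card T2" unfolding T3_def
    by (rule card_image) (rule inj_on_subset[OF A_comp_inj[OF A_inv[OF g(1)]] subset_UNIV])
  then have "eqv p T3 T2" using tree_eqv[OF pp T3 T2(1)] by blast
  then obtain k where k: "k \<in> A" "p k = 0" "(\<circ>) k ` T3 = T2" using eqv_def[OF pp] by blast
  have "(\<circ>) (finv g \<circ> k) ` T3 = (\<circ>) (finv g) ` (\<circ>) k ` T3" by (rule comp_image_comp)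
  also have "\<dots> = (\<circ>) (finv g) ` T2" by (simp only: k(3))
  also have "\<dots> = T3" by (simp only: T3_def)
  finally have "p (finv g \<circ> k) = 0"
    using p_permuting[OF pp splits_part[OF T3 part_id]] A_comp[OF A_inv[OF g(1)] k(1)] by blast
  then show ?thesis using p_add[OF A_inv[OF g(1)] k(1)] k(2) p_inv[OF pp g(1)] g(2) by simp
qed

end

section \<open>Twisted Brin--Thompson groups\<close>

lemma prepend_Nil [simp]: "prepend [] x = x"
  by (auto simp: prepend_def)

lemma prepend_append: "prepend (u @ v) x = prepend u (prepend v x)"
  by (rule ext) (auto simp: prepend_def nth_append)

lemma prepend_add [simp]: "prepend w x (n + length w) = x n" "prepend w x (length w + n) = x n"
  by (simp_all add: prepend_def)

lemma prepend_inj: "prepend w x = prepend w y \<longleftrightarrow> x = y"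
proof
  assume eq: "prepend w x = prepend w y"
  show "x = y"
  proof
    show "x n = y n" for n using prepend_add(1)[of w x n] prepend_add(1)[of w y n] by (simp add: eq)
  qed
qed simp

lemma prefix_of_prepend [simp]: "prefix_of w (prepend w x)"
  by (simp add: prefix_of_def prepend_def)

lemma prefix_of_Nil [simp]: "prefix_of [] x"
  by (simp add: prefix_of_def)

lemma prepend_tail: "prefix_of w x \<Longrightarrow> prepend w (\<lambda>n. x (n + length w)) = x"
  by (rule ext) (auto simp: prefix_of_def prepend_def)

lemma prefix_of_comparable:
  assumes "prefix_of u x" "prefix_of v x" "length u \<le> length v"
  shows "u @ drop (length u) v = v"
proof -
  have "take (length u) v = u"
    using assms by (intro nth_equalityI) (auto simp: prefix_of_def)
  then show ?thesis by (metis append_take_drop_id)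
qed

lemma prefix_of_eq: "\<lbrakk>prefix_of u x; prefix_of v x; length u = length v\<rbrakk> \<Longrightarrow> u = v"
  by (auto simp: prefix_of_def intro: nth_equalityI)

lemma cube_points_eq: "cube_points S = extensional S"
  by (simp add: cantor_cube_def cantor_space_def PiE_UNIV_domain PiE_def)

definition cat :: "('s \<Rightarrow> bool list) \<Rightarrow> ('s \<Rightarrow> bool list) \<Rightarrow> 's \<Rightarrow> bool list" where
  "cat \<psi> \<phi> s = \<psi> s @ \<phi> s"

definition single :: "'s \<Rightarrow> bool list \<Rightarrow> 's \<Rightarrow> bool list" where
  "single s w t = (if t = s then w else [])"

definition cylinder :: "'s set \<Rightarrow> 's cantor_point \<Rightarrow> ('s \<Rightarrow> nat) \<Rightarrow> 's \<Rightarrow> bool list" where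
  "cylinder F \<kappa> k s = (if s \<in> F then map (\<kappa> s) (upt 0 (k s)) else [])"

locale twisted = group_action G S \<alpha> for G (structure) and S :: "'s set" and \<alpha> +
  assumes S_nonempty: "S \<noteq> {}"
begin

abbreviation "X \<equiv> cube_points S"
abbreviation "L \<equiv> brick_labels S"
abbreviation "can \<equiv> canonical_map S"
abbreviation "cact \<equiv> cube_action G S \<alpha>"

text \<open>The second coordinate records \<gamma>: the pair \<open>(h, \<gamma>)\<close> sends
  \<open>(\<kappa>, a)\<close> to \<open>(h \<kappa>, \<gamma> \<kappa> a)\<close>, so that
  composition reproduces the product of pairs, even if \<open>G\<close> does not act faithfully on
  \<open>S\<close>.\<close>

definition Yp :: "('s cantor_point \<times> 'a) set" where
  "Yp = X \<times> carrier G"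

definition eps :: "('s \<Rightarrow> bool list) \<Rightarrow> 's cantor_point \<times> 'a \<Rightarrow> 's cantor_point \<times> 'a" where
  "eps \<psi> y = (if y \<in> Yp then (can \<psi> (fst y), snd y) else y)"

definition theta :: "'a \<Rightarrow> 's cantor_point \<times> 'a \<Rightarrow> 's cantor_point \<times> 'a" where
  "theta g y = (if y \<in> Yp then (cact g (fst y), g \<otimes> snd y) else y)"

definition lact :: "'a \<Rightarrow> ('s \<Rightarrow> bool list) \<Rightarrow> 's \<Rightarrow> bool list" where
  "lact g \<psi> s = \<psi> (\<alpha> (inv g) s)"

definition Mp :: "('s cantor_point \<times> 'a \<Rightarrow> 's cantor_point \<times> 'a) set" where
  "Mp = {eps \<psi> \<circ> theta g | \<psi> g. \<psi> \<in> L \<and> g \<in> carrier G}"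

definition ee :: "'s \<Rightarrow> bool \<Rightarrow> 's cantor_point \<times> 'a \<Rightarrow> 's cantor_point \<times> 'a" where
  "ee s i = eps (single s [i])"

definition s0 :: 's where
  "s0 = (SOME s. s \<in> S)"

lemma s0: "s0 \<in> S"
  using S_nonempty unfolding s0_def by (simp add: some_in_eq)

lemma group_G: "group G"
  using group_hom by (rule group_hom.axioms(1))

sublocale group G
  by (rule group_G)

lemma alpha_in [simp]: "g \<in> carrier G \<Longrightarrow> s \<in> S \<Longrightarrow> \<alpha> g s \<in> S"
  using element_image by blast

lemma alpha_one [simp]: "s \<in> S \<Longrightarrow> \<alpha> \<one> s = s"
  using id_eq_one by (metis restrict_apply')

lemma alpha_inv [simp]: "g \<in> carrier G \<Longrightarrow> s \<in> S \<Longrightarrow> \<alpha> (inv g) (\<alpha> g s) = s"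
  "g \<in> carrier G \<Longrightarrow> s \<in> S \<Longrightarrow> \<alpha> g (\<alpha> (inv g) s) = s"
  by (simp_all flip: composition_rule)

lemma X_eqI: "\<lbrakk>\<kappa> \<in> X; \<kappa>' \<in> X; \<And>s. s \<in> S \<Longrightarrow> \<kappa> s = \<kappa>' s\<rbrakk> \<Longrightarrow> \<kappa> = \<kappa>'"
  unfolding cube_points_eq by (rule extensionalityI)

lemma can_in [simp]: "can \<psi> \<kappa> \<in> X"
  by (simp add: cube_points_eq canonical_map_def)

lemma can_apply [simp]: "s \<in> S \<Longrightarrow> can \<psi> \<kappa> s = prepend (\<psi> s) (\<kappa> s)"
  by (simp add: canonical_map_def)

lemma cact_in [simp]: "cact g \<kappa> \<in> X"
  by (simp add: cube_points_eq cube_action_def)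

lemma cact_apply [simp]: "s \<in> S \<Longrightarrow> cact g \<kappa> s = \<kappa> (\<alpha> (inv g) s)"
  by (simp add: cube_action_def)

lemma can_cong: "(\<And>s. s \<in> S \<Longrightarrow> \<psi> s = \<phi> s) \<Longrightarrow> can \<psi> \<kappa> = can \<phi> \<kappa>"
  by (rule X_eqI) auto

lemma can_can: "can \<psi> (can \<phi> \<kappa>) = can (cat \<psi> \<phi>) \<kappa>"
  by (rule X_eqI) (auto simp: cat_def prepend_append)

lemma can_Nil: "(\<And>s. s \<in> S \<Longrightarrow> \<psi> s = []) \<Longrightarrow> \<kappa> \<in> X \<Longrightarrow> can \<psi> \<kappa> = \<kappa>"
  by (rule X_eqI) auto

lemma can_inj: "\<kappa> \<in> X \<Longrightarrow> \<kappa>' \<in> X \<Longrightarrow> can \<psi> \<kappa> = can \<psi> \<kappa>' \<Longrightarrow> \<kappa> = \<kappa>'"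
  by (rule X_eqI) (metis can_apply prepend_inj)+

lemma cact_cact: "g \<in> carrier G \<Longrightarrow> h \<in> carrier G \<Longrightarrow> cact g (cact h \<kappa>) = cact (g \<otimes> h) \<kappa>"
  by (rule X_eqI) (auto simp: inv_mult_group composition_rule)

lemma cact_one: "\<kappa> \<in> X \<Longrightarrow> cact \<one> \<kappa> = \<kappa>"
  by (rule X_eqI) auto

lemma cact_can: "g \<in> carrier G \<Longrightarrow> cact g (can \<psi> \<kappa>) = can (lact g \<psi>) (cact g \<kappa>)"
  by (rule X_eqI) (auto simp: lact_def)

lemma brick_iff: "\<kappa> \<in> brick S \<psi> \<longleftrightarrow> (\<exists>\<kappa>'\<in>X. \<kappa> = can \<psi> \<kappa>')"
proof
  assume k: "\<kappa> \<in> brick S \<psi>"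
  define \<kappa>' where "\<kappa>' = (\<lambda>s\<in>S. \<lambda>n. \<kappa> s (n + length (\<psi> s)))"
  have "\<kappa>' \<in> X" by (simp add: cube_points_eq \<kappa>'_def)
  moreover have "\<kappa> = can \<psi> \<kappa>'"
    using k by (intro X_eqI) (auto simp: brick_def \<kappa>'_def prepend_tail)
  ultimately show "\<exists>\<kappa>'\<in>X. \<kappa> = can \<psi> \<kappa>'" by blast
qed (auto simp: brick_def)

lemma cat_label [simp]: "\<psi> \<in> L \<Longrightarrow> \<phi> \<in> L \<Longrightarrow> cat \<psi> \<phi> \<in> L"
  unfolding brick_labels_def
  by (auto simp: cat_def intro: finite_subset[of _ "{s \<in> S. \<psi> s \<noteq> []} \<union> {s \<in> S. \<phi> s \<noteq> []}"])

lemma single_label [simp]: "single s w \<in> L"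
  unfolding brick_labels_def by (auto simp: single_def intro: finite_subset[of _ "{s}"])

lemma Nil_label [simp]: "(\<lambda>_. []) \<in> L"
  by (simp add: brick_labels_def)

lemma lact_label [simp]:
  assumes "g \<in> carrier G" "\<psi> \<in> L"
  shows "lact g \<psi> \<in> L"
proof -
  have "{s \<in> S. lact g \<psi> s \<noteq> []} \<subseteq> \<alpha> g ` {s \<in> S. \<psi> s \<noteq> []}"
    using assms(1) by (auto simp: lact_def intro!: image_eqI[of _ "\<alpha> g" "\<alpha> (inv g) _"])
  then show ?thesis using assms(2) unfolding brick_labels_def by (auto intro: finite_subset)
qed

lemma tail_label:
  assumes "\<psi> \<in> L"
  shows "(\<lambda>s. drop (f s) (\<psi> s)) \<in> L"
  using assms unfolding brick_labels_def by (auto elim!: rev_finite_subset)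

lemma eps_in [simp]: "y \<in> Yp \<Longrightarrow> eps \<psi> y \<in> Yp"
  by (auto simp: eps_def Yp_def)

lemma theta_in [simp]: "g \<in> carrier G \<Longrightarrow> y \<in> Yp \<Longrightarrow> theta g y \<in> Yp"
  by (auto simp: theta_def Yp_def)

lemma eps_out: "y \<notin> Yp \<Longrightarrow> eps \<psi> y = y"
  by (simp add: eps_def)

lemma theta_out: "y \<notin> Yp \<Longrightarrow> theta g y = y"
  by (simp add: theta_def)

lemma eps_eps: "eps \<psi> \<circ> eps \<phi> = eps (cat \<psi> \<phi>)"
  by (rule ext) (auto simp: eps_def can_can Yp_def)

lemma eps_cong: "(\<And>s. s \<in> S \<Longrightarrow> \<psi> s = \<phi> s) \<Longrightarrow> eps \<psi> = eps \<phi>"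
  unfolding eps_def using can_cong by metis

lemma eps_Nil: "(\<And>s. s \<in> S \<Longrightarrow> \<psi> s = []) \<Longrightarrow> eps \<psi> = id"
  by (rule ext) (auto simp: eps_def can_Nil Yp_def)

lemma theta_theta: "g \<in> carrier G \<Longrightarrow> h \<in> carrier G \<Longrightarrow> theta g \<circ> theta h = theta (g \<otimes> h)"
  by (rule ext) (auto simp: theta_def cact_cact Yp_def m_assoc)

lemma theta_one: "theta \<one> = id"
  by (rule ext) (auto simp: theta_def cact_one Yp_def)

lemma theta_inv: "g \<in> carrier G \<Longrightarrow> theta g \<circ> theta (inv g) = id" "g \<in> carrier G \<Longrightarrow> theta (inv g) \<circ> theta g = id"
  by (simp_all only: theta_theta inv_closed r_inv l_inv theta_one)

text \<open>For the label \<open>single s [i]\<close> this is the groupoid relation between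
  \<open>g\<close> and the splits along \<open>s\<close> and its translate.\<close>

lemma theta_eps: "g \<in> carrier G \<Longrightarrow> theta g \<circ> eps \<psi> = eps (lact g \<psi>) \<circ> theta g"
  by (rule ext) (auto simp: theta_def eps_def cact_can Yp_def)

lemma theta_bij: "g \<in> carrier G \<Longrightarrow> bij (theta g)"
  by (rule o_bij[of "theta (inv g)"]) (simp_all only: theta_inv)

lemma theta_image: "g \<in> carrier G \<Longrightarrow> theta g ` Yp = Yp"
proof
  assume g: "g \<in> carrier G"
  show "theta g ` Yp \<subseteq> Yp" using g by auto
  show "Yp \<subseteq> theta g ` Yp"
  proof
    fix y assume "y \<in> Yp"
    then have "theta (inv g) y \<in> Yp" using g by simp
    moreover have "theta g (theta (inv g) y) = y" using theta_inv(1)[OF g] by (metis comp_apply id_apply)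
    ultimately show "y \<in> theta g ` Yp" by (metis imageI)
  qed
qed

lemma eps_image: "eps \<psi> ` Yp = brick S \<psi> \<times> carrier G"
proof
  show "eps \<psi> ` Yp \<subseteq> brick S \<psi> \<times> carrier G" by (auto simp: eps_def Yp_def brick_iff)
  show "brick S \<psi> \<times> carrier G \<subseteq> eps \<psi> ` Yp"
  proof
    fix y assume "y \<in> brick S \<psi> \<times> carrier G"
    then obtain \<kappa> a where *: "\<kappa> \<in> X" "a \<in> carrier G" "y = (can \<psi> \<kappa>, a)" by (auto simp: brick_iff)
    then have "y = eps \<psi> (\<kappa>, a)" by (simp add: eps_def Yp_def)
    then show "y \<in> eps \<psi> ` Yp" using * by (auto simp: Yp_def)
  qed
qed

lemma eps_inj: "inj (eps \<psi>)"
proof (rule injI)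
  fix x y assume eq: "eps \<psi> x = eps \<psi> y"
  have iff: "x \<in> Yp \<longleftrightarrow> y \<in> Yp"
    using eps_in[of x \<psi>] eps_in[of y \<psi>] eps_out[of x \<psi>] eps_out[of y \<psi>] eq by metis
  show "x = y"
  proof (cases "x \<in> Yp")
    case True
    then have "can \<psi> (fst x) = can \<psi> (fst y)" "snd x = snd y" using eq iff by (auto simp: eps_def)
    moreover have "fst x \<in> X" "fst y \<in> X" using True iff by (auto simp: Yp_def)
    ultimately show ?thesis using can_inj by (intro prod_eqI)
  next
    case False
    then show ?thesis using eq iff by (simp add: eps_out)
  qed
qed

lemma Mp_I: "\<psi> \<in> L \<Longrightarrow> g \<in> carrier G \<Longrightarrow> eps \<psi> \<circ> theta g \<in> Mp"
  by (auto simp only: Mp_def)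

lemma Mp_E:
  assumes "m \<in> Mp"
  obtains \<psi> g where "\<psi> \<in> L" "g \<in> carrier G" "m = eps \<psi> \<circ> theta g"
  using assms by (auto simp only: Mp_def)

lemma eps_Mp: "\<psi> \<in> L \<Longrightarrow> eps \<psi> \<in> Mp"
  using Mp_I[of \<psi> \<one>] by (simp only: theta_one comp_id one_closed)

lemma theta_Mp: "g \<in> carrier G \<Longrightarrow> theta g \<in> Mp"
  using Mp_I[of "\<lambda>_. []" g] by (simp only: eps_Nil id_comp Nil_label)

lemma Mp_comp:
  assumes "m \<in> Mp" "n \<in> Mp"
  shows "m \<circ> n \<in> Mp"
proof -
  obtain \<psi> g where m: "\<psi> \<in> L" "g \<in> carrier G" "m = eps \<psi> \<circ> theta g" using assms(1) by (rule Mp_E)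
  obtain \<phi> h where n: "\<phi> \<in> L" "h \<in> carrier G" "n = eps \<phi> \<circ> theta h" using assms(2) by (rule Mp_E)
  have "m \<circ> n = eps \<psi> \<circ> (theta g \<circ> eps \<phi>) \<circ> theta h" by (simp only: m n comp_assoc)
  also have "\<dots> = (eps \<psi> \<circ> eps (lact g \<phi>)) \<circ> (theta g \<circ> theta h)" by (simp only: theta_eps[OF m(2)] comp_assoc)
  also have "\<dots> = eps (cat \<psi> (lact g \<phi>)) \<circ> theta (g \<otimes> h)" by (simp only: eps_eps theta_theta m n)
  finally show ?thesis using Mp_I[of "cat \<psi> (lact g \<phi>)" "g \<otimes> h"] m n by (simp only: cat_label lact_label m_closed)
qed

lemma Mp_image: "g \<in> carrier G \<Longrightarrow> (eps \<psi> \<circ> theta g) ` Yp = brick S \<psi> \<times> carrier G"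
  by (simp only: image_comp[symmetric] theta_image eps_image)

lemma brick_apart:
  assumes "s \<in> S" "length (\<psi> s) = length (\<phi> s)" "\<psi> s \<noteq> \<phi> s"
  shows "brick S \<psi> \<inter> brick S \<phi> = {}"
  using assms prefix_of_eq by (fastforce simp: brick_def)

lemma brick_subset_prefix:
  assumes "brick S \<psi> \<subseteq> brick S \<phi>" "s \<in> S"
  shows "\<phi> s @ drop (length (\<phi> s)) (\<psi> s) = \<psi> s"
proof -
  \<comment> \<open>Were \<open>\<phi> s\<close> longer than \<open>\<psi> s\<close>, the point
    \<open>can \<psi> \<kappa>\<close> would disagree with \<open>\<phi> s\<close> in the first
    letter after \<open>\<psi> s\<close>.\<close>
  define \<kappa> where "\<kappa> = (\<lambda>s\<in>S. \<lambda>n. \<not> \<phi> s ! (length (\<psi> s) + n))"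
  have "\<kappa> \<in> X" by (simp add: \<kappa>_def cube_points_eq)
  then have "can \<psi> \<kappa> \<in> brick S \<phi>" using assms(1) brick_iff by blast
  then have p: "prefix_of (\<phi> s) (prepend (\<psi> s) (\<kappa> s))" using assms(2) by (auto simp: brick_def)
  have "length (\<phi> s) \<le> length (\<psi> s)"
  proof (rule ccontr)
    assume "\<not> ?thesis"
    then have "prepend (\<psi> s) (\<kappa> s) (length (\<psi> s)) = \<phi> s ! length (\<psi> s)" using p by (simp add: prefix_of_def)
    moreover have "prepend (\<psi> s) (\<kappa> s) (length (\<psi> s)) = (\<not> \<phi> s ! length (\<psi> s))"
      using assms(2) by (simp add: prepend_def \<kappa>_def)
    ultimately show False by simp
  qed
  then show ?thesis using p prefix_of_comparable by fastforce
qed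

lemma brick_subset_factor:
  assumes "brick S \<psi> \<subseteq> brick S \<phi>" "\<psi> \<in> L"
  obtains \<rho> where "\<rho> \<in> L" "eps \<psi> = eps \<phi> \<circ> eps \<rho>"
proof (rule that)
  show "(\<lambda>s. drop (length (\<phi> s)) (\<psi> s)) \<in> L" by (rule tail_label[OF assms(2)])
  show "eps \<psi> = eps \<phi> \<circ> eps (\<lambda>s. drop (length (\<phi> s)) (\<psi> s))"
    unfolding eps_eps by (rule eps_cong) (simp add: cat_def brick_subset_prefix[OF assms(1)])
qed

lemma cylinder_label: "finite F \<Longrightarrow> cylinder F \<kappa> k \<in> L"
  by (auto simp: brick_labels_def cylinder_def elim: rev_finite_subset)

lemma in_cylinder: "\<kappa> \<in> X \<Longrightarrow> \<kappa> \<in> brick S (cylinder F \<kappa> k)"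
  by (auto simp: brick_def prefix_of_def cylinder_def)

lemma halves_inter: "s \<in> S \<Longrightarrow> ee s False ` Yp \<inter> ee s True ` Yp = {}"
  using brick_apart[of s "single s [False]" "single s [True]"] by (auto simp only: ee_def eps_image) (simp add: single_def, blast)

lemma halves_union:
  assumes "s \<in> S"
  shows "ee s False ` Yp \<union> ee s True ` Yp = Yp"
proof -
  have "brick S (single s [False]) \<union> brick S (single s [True]) = X"
    using assms by (auto simp: brick_def single_def prefix_of_def)
  then show ?thesis unfolding ee_def eps_image by (simp only: Yp_def Sigma_Un_distrib1[symmetric])
qed

sublocale B: brick_monoid Yp Mp "ee s0 False" "ee s0 True"
proof
  show "Yp \<noteq> {}" using one_closed by (auto simp: Yp_def cube_points_eq intro!: exI[of _ "\<lambda>_\<in>S. undefined"])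
  show "id \<in> Mp" using theta_Mp[OF one_closed] by (simp only: theta_one)
  show "m \<circ> n \<in> Mp" if "m \<in> Mp" "n \<in> Mp" for m n using Mp_comp that .
  show "inj m" if "m \<in> Mp" for m
    using that by (elim Mp_E) (simp only: inj_compose eps_inj bij_is_inj theta_bij)
  show "m y \<in> Yp" if "m \<in> Mp" "y \<in> Yp" for m y using that by (elim Mp_E) simp
  show "m y = y" if "m \<in> Mp" "y \<notin> Yp" for m y using that by (elim Mp_E) (simp add: eps_out theta_out)
  show "ee s0 False \<in> Mp" "ee s0 True \<in> Mp" by (simp_all only: ee_def eps_Mp single_label)
  show "ee s0 False ` Yp \<inter> ee s0 True ` Yp = {}"
    by (rule halves_inter[OF s0])
  show "ee s0 False ` Yp \<union> ee s0 True ` Yp = Yp"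
    by (rule halves_union[OF s0])
  show "\<exists>n\<in>Mp. y \<in> n ` Yp \<and> n ` Yp \<inter> m ` Yp = {}" if mM: "m \<in> Mp" and y: "y \<in> Yp" and ym: "y \<notin> m ` Yp" for m y
  proof -
    obtain \<psi> g where m: "\<psi> \<in> L" "g \<in> carrier G" "m = eps \<psi> \<circ> theta g" using mM by (rule Mp_E)
    obtain \<kappa> a where ya: "y = (\<kappa>, a)" "\<kappa> \<in> X" "a \<in> carrier G" using y by (auto simp: Yp_def)
    have "\<kappa> \<notin> brick S \<psi>" using ym ya by (simp add: m(3) Mp_image[OF m(2)] del: o_apply)
    then obtain s where s: "s \<in> S" "\<not> prefix_of (\<psi> s) (\<kappa> s)" using ya by (auto simp: brick_def)
    \<comment> \<open>One coordinate in which \<kappa> leaves the brick suffices; equal word lengths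
      there allow \<open>brick_apart\<close>.\<close>
    define \<rho> where "\<rho> = cylinder {s} \<kappa> (\<lambda>_. length (\<psi> s))"
    have c: "\<rho> \<in> L" "\<kappa> \<in> brick S \<rho>" using cylinder_label in_cylinder ya by (auto simp: \<rho>_def)
    have "\<psi> s \<noteq> \<rho> s" using c(2) s by (auto simp: brick_def)
    then have "brick S \<rho> \<inter> brick S \<psi> = {}" using brick_apart[OF s(1), of \<rho> \<psi>] by (simp add: \<rho>_def cylinder_def)
    then have "eps \<rho> ` Yp \<inter> m ` Yp = {}" unfolding m(3) Mp_image[OF m(2)] eps_image by blast
    moreover have "y \<in> eps \<rho> ` Yp" using c(2) ya by (simp add: eps_image)
    ultimately show ?thesis using eps_Mp[OF c(1)] by blast
  qed
  show "\<exists>a\<in>Mp. \<exists>b\<in>Mp. m \<circ> a = n \<circ> b \<and> y \<in> (m \<circ> a) ` Yp"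
    if mM: "m \<in> Mp" and nM: "n \<in> Mp" and y: "y \<in> m ` Yp" "y \<in> n ` Yp" for m n y
  proof -
    obtain \<psi> g where m: "\<psi> \<in> L" "g \<in> carrier G" "m = eps \<psi> \<circ> theta g" using mM by (rule Mp_E)
    obtain \<phi> h where n: "\<phi> \<in> L" "h \<in> carrier G" "n = eps \<phi> \<circ> theta h" using nM by (rule Mp_E)
    obtain \<kappa> a where ya: "y = (\<kappa>, a)" "\<kappa> \<in> brick S \<psi>" "\<kappa> \<in> brick S \<phi>" "a \<in> carrier G"
      using y by (auto simp only: m(3) n(3) Mp_image[OF m(2)] Mp_image[OF n(2)])
    \<comment> \<open>At every coordinate both labels are prefixes of the same sequence, so one
      extends the other; \<open>drop\<close> gives the missing part of the shorter word and
      \<open>[]\<close> for the longer one.\<close>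
    define \<rho> where "\<rho> = (\<lambda>s. drop (length (\<psi> s)) (\<phi> s))"
    define \<xi> where "\<xi> = (\<lambda>s. drop (length (\<phi> s)) (\<psi> s))"
    have lab: "\<rho> \<in> L" "\<xi> \<in> L" using tail_label m n by (auto simp: \<rho>_def \<xi>_def)
    have pre: "prefix_of (\<psi> s) (\<kappa> s)" "prefix_of (\<phi> s) (\<kappa> s)" if "s \<in> S" for s using ya that by (auto simp: brick_def)
    have cc: "cat \<psi> \<rho> s = (if length (\<psi> s) \<le> length (\<phi> s) then \<phi> s else \<psi> s)"
      "cat \<phi> \<xi> s = (if length (\<psi> s) \<le> length (\<phi> s) then \<phi> s else \<psi> s)" if "s \<in> S" for s
      using prefix_of_comparable[OF pre(1)[OF that] pre(2)[OF that]] prefix_of_comparable[OF pre(2)[OF that] pre(1)[OF that]]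
      by (auto simp: cat_def \<rho>_def \<xi>_def)
    have eq: "eps \<psi> \<circ> eps \<rho> = eps \<phi> \<circ> eps \<xi>" unfolding eps_eps by (rule eps_cong) (simp add: cc)
    have ma: "m \<circ> (theta (inv g) \<circ> eps \<rho>) = eps \<psi> \<circ> eps \<rho>"
    proof -
      have "m \<circ> (theta (inv g) \<circ> eps \<rho>) = eps \<psi> \<circ> (theta g \<circ> theta (inv g)) \<circ> eps \<rho>" by (simp only: m(3) comp_assoc)
      then show ?thesis by (simp only: theta_inv[OF m(2)] comp_id)
    qed
    have nb: "n \<circ> (theta (inv h) \<circ> eps \<xi>) = eps \<phi> \<circ> eps \<xi>"
    proof -
      have "n \<circ> (theta (inv h) \<circ> eps \<xi>) = eps \<phi> \<circ> (theta h \<circ> theta (inv h)) \<circ> eps \<xi>" by (simp only: n(3) comp_assoc)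
      then show ?thesis by (simp only: theta_inv[OF n(2)] comp_id)
    qed
    have "\<kappa> \<in> brick S (cat \<psi> \<rho>)" using ya pre by (auto simp: brick_def cc)
    then have "y \<in> (eps \<psi> \<circ> eps \<rho>) ` Yp" using ya by (simp only: eps_eps eps_image) simp
    moreover have "theta (inv g) \<circ> eps \<rho> \<in> Mp" "theta (inv h) \<circ> eps \<xi> \<in> Mp"
      using Mp_comp theta_Mp eps_Mp lab m n inv_closed by metis+
    ultimately show ?thesis using ma nb eq by metis
  qed
  show "\<exists>a\<in>Mp. m = n \<circ> a" if mM: "m \<in> Mp" and nM: "n \<in> Mp" and sub: "m ` Yp \<subseteq> n ` Yp" for m n
  proof -
    obtain \<psi> g where m: "\<psi> \<in> L" "g \<in> carrier G" "m = eps \<psi> \<circ> theta g" using mM by (rule Mp_E)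
    obtain \<phi> h where n: "\<phi> \<in> L" "h \<in> carrier G" "n = eps \<phi> \<circ> theta h" using nM by (rule Mp_E)
    have "brick S \<psi> \<subseteq> brick S \<phi>"
      using sub one_closed unfolding m(3) n(3) Mp_image[OF m(2)] Mp_image[OF n(2)] by blast
    then obtain \<rho> where c: "\<rho> \<in> L" "eps \<psi> = eps \<phi> \<circ> eps \<rho>" using m(1) by (rule brick_subset_factor)
    have "n \<circ> (theta (inv h) \<circ> (eps \<rho> \<circ> theta g)) = eps \<phi> \<circ> (theta h \<circ> theta (inv h)) \<circ> (eps \<rho> \<circ> theta g)"
      by (simp only: n(3) comp_assoc)
    also have "\<dots> = m" by (simp only: theta_inv[OF n(2)] comp_id m(3) c(2) comp_assoc)
    finally have "m = n \<circ> (theta (inv h) \<circ> (eps \<rho> \<circ> theta g))" by (rule sym)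
    moreover have "theta (inv h) \<circ> (eps \<rho> \<circ> theta g) \<in> Mp"
      by (intro Mp_comp theta_Mp eps_Mp inv_closed c m n)
    ultimately show ?thesis by blast
  qed
qed

sublocale B: split_monoid Yp Mp "ee s0 False" "ee s0 True" S ee "theta ` carrier G"
proof
  show "S \<noteq> {}" by (rule S_nonempty)
  show "ee s i \<in> Mp" for s i by (simp only: ee_def eps_Mp single_label)
  show "ee s False ` Yp \<inter> ee s True ` Yp = {}" if "s \<in> S" for s
    using halves_inter[OF that] .
  show "ee s False ` Yp \<union> ee s True ` Yp = Yp" if "s \<in> S" for s
    using halves_union[OF that] .
  show "ee s i \<circ> ee t j = ee t j \<circ> ee s i" if "s \<noteq> t" for s t i j
    unfolding ee_def eps_eps using that by (intro eps_cong) (simp add: cat_def single_def)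
  show "u \<in> Mp" if "u \<in> theta ` carrier G" for u using that theta_Mp by blast
  show "bij u" if "u \<in> theta ` carrier G" for u using that theta_bij by blast
  show "finv u \<in> theta ` carrier G" if u: "u \<in> theta ` carrier G" for u
  proof -
    obtain g where g: "g \<in> carrier G" "u = theta g" using u by blast
    have "finv u = theta (inv g)" unfolding g(2) using theta_inv[OF g(1)] by (intro inv_unique_comp) auto
    then show ?thesis using g by blast
  qed
  show "\<exists>t\<in>S. \<forall>i. u \<circ> ee s i = ee t i \<circ> u" if u: "u \<in> theta ` carrier G" and s: "s \<in> S" for u s
  proof -
    obtain g where g: "g \<in> carrier G" "u = theta g" using u by blast
    have "\<alpha> (inv g) t = s \<longleftrightarrow> t = \<alpha> g s" if "t \<in> S" for t using that s g alpha_inv by metis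
    then have "eps (lact g (single s [i])) = eps (single (\<alpha> g s) [i])" for i
      by (intro eps_cong) (simp add: lact_def single_def)
    then show ?thesis unfolding g(2) ee_def using theta_eps[OF g(1)] s g by (intro bexI[of _ "\<alpha> g s"]) auto
  qed
qed

end

section \<open>Bricks are open in the compact Hausdorff cube\<close>

lemma openin_coordinate:
  assumes "s \<in> S"
  shows "openin (cantor_cube S) {\<kappa> \<in> cube_points S. \<kappa> s n \<in> U}"
proof -
  have "continuous_map (cantor_cube S) cantor_space (\<lambda>\<kappa>. \<kappa> s)"
    unfolding cantor_cube_def by (rule continuous_map_product_projection[OF assms])
  moreover have "continuous_map cantor_space (discrete_topology UNIV) (\<lambda>x. x n)"
    unfolding cantor_space_def by (rule continuous_map_product_projection) simp
  ultimately have "continuous_map (cantor_cube S) (discrete_topology UNIV) ((\<lambda>x. x n) \<circ> (\<lambda>\<kappa>. \<kappa> s))"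
    by (rule continuous_map_compose)
  from openin_continuous_map_preimage[OF this, of U] show ?thesis by simp
qed

lemma openin_brick:
  assumes "\<psi> \<in> brick_labels S"
  shows "openin (cantor_cube S) (brick S \<psi>)"
proof -
  let ?I = "SIGMA s:{s \<in> S. \<psi> s \<noteq> []}. {..<length (\<psi> s)}"
  have "finite ?I" using assms by (auto simp: brick_labels_def intro: finite_SigmaI)
  then have "openin (cantor_cube S)
      ((\<Inter>x\<in>?I. {\<kappa> \<in> cube_points S. \<kappa> (fst x) (snd x) \<in> {\<psi> (fst x) ! snd x}}) \<inter> cube_points S)"
    by (rule openin_INT) (rule openin_coordinate, auto)
  moreover have "(\<Inter>x\<in>?I. {\<kappa> \<in> cube_points S. \<kappa> (fst x) (snd x) \<in> {\<psi> (fst x) ! snd x}}) \<inter> cube_points S = brick S \<psi>"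
  proof (intro equalityI subsetI)
    fix \<kappa> assume k: "\<kappa> \<in> (\<Inter>x\<in>?I. {\<kappa> \<in> cube_points S. \<kappa> (fst x) (snd x) \<in> {\<psi> (fst x) ! snd x}}) \<inter> cube_points S"
    have "\<kappa> s i = \<psi> s ! i" if "s \<in> S" "i < length (\<psi> s)" for s i
    proof -
      have "(s, i) \<in> ?I" using that by auto
      then show ?thesis using k by fastforce
    qed
    then show "\<kappa> \<in> brick S \<psi>" using k by (auto simp: brick_def prefix_of_def)
  qed (auto simp: brick_def prefix_of_def)
  ultimately show ?thesis by simp
qed

lemma compact_cantor_cube: "compact_space (cantor_cube S)"
  by (simp add: cantor_cube_def cantor_space_def compact_space_product_topology compact_space_discrete_topology)

lemma Hausdorff_cantor_cube: "Hausdorff_space (cantor_cube S)"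
  by (simp add: cantor_cube_def cantor_space_def Hausdorff_space_product_topology)

section \<open>Uniform grids of bricks as common refinements\<close>

context twisted
begin

lemma E_eps:
  assumes "x \<in> B.E"
  shows "\<exists>\<psi>\<in>L. x = eps \<psi>"
  using assms
proof induction
  case E_id
  show ?case by (intro bexI[of _ "\<lambda>_. []"]) (simp_all only: eps_Nil Nil_label)
next
  case (E_step x s i)
  then obtain \<psi> where "\<psi> \<in> L" "x = eps \<psi>" by blast
  then show ?case by (intro bexI[of _ "cat \<psi> (single s [i])"]) (simp_all only: ee_def eps_eps cat_label single_label)
qed

lemma eps_E_aux:
  assumes "finite F" "F \<subseteq> S" "\<And>s. s \<in> S \<Longrightarrow> s \<notin> F \<Longrightarrow> \<psi> s = []"
  shows "eps \<psi> \<in> B.E"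
  using assms
proof (induction F arbitrary: \<psi> rule: finite_induct)
  case empty
  then have "eps \<psi> = id" by (intro eps_Nil) auto
  then show ?case using B.E_id by (simp only:)
next
  case (insert s F)
  have "eps (\<psi>(s := w)) \<in> B.E" for w
  proof (induction w rule: rev_induct)
    case Nil
    show ?case by (rule insert.IH) (use insert.prems in auto)
  next
    case (snoc i w)
    have "eps (\<psi>(s := w @ [i])) = eps (\<psi>(s := w)) \<circ> ee s i"
      unfolding ee_def eps_eps by (rule eps_cong) (simp add: cat_def single_def)
    moreover have "s \<in> S" using insert.prems by simp
    ultimately show ?case using B.E_step[OF snoc, of s i] by (simp only:)
  qed
  from this[of "\<psi> s"] show ?case by simp
qed

lemma eps_E: "\<psi> \<in> L \<Longrightarrow> eps \<psi> \<in> B.E"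
  by (rule eps_E_aux[of "{s \<in> S. \<psi> s \<noteq> []}"]) (auto simp: brick_labels_def)

text \<open>The words are empty outside \<open>F\<close> even at arguments outside \<open>S\<close>,
  which \<open>eps\<close> ignores; this makes \<open>eps\<close> injective on these labels.\<close>

definition Lb :: "'s set \<Rightarrow> nat \<Rightarrow> ('s \<Rightarrow> bool list) set" where
  "Lb F d = {\<psi>. (\<forall>s\<in>F. length (\<psi> s) \<le> d) \<and> (\<forall>s. s \<notin> F \<longrightarrow> \<psi> s = [])}"

definition Fl :: "'s set \<Rightarrow> nat \<Rightarrow> ('s \<Rightarrow> bool list) set" where
  "Fl F d = {\<psi>. (\<forall>s\<in>F. length (\<psi> s) = d) \<and> (\<forall>s. s \<notin> F \<longrightarrow> \<psi> s = [])}"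

lemma Fl_L: "finite F \<Longrightarrow> Fl F d \<subseteq> L"
  by (auto simp: Fl_def brick_labels_def elim!: rev_finite_subset)

lemma finite_Fl:
  assumes "finite F"
  shows "finite (Fl F d)"
proof -
  have "finite {w :: bool list. length w = d}" using finite_lists_length_eq[of "UNIV :: bool set" d] by simp
  from finite_set_of_finite_funs[OF assms this, of "[]"] show ?thesis
    by (rule rev_finite_subset) (auto simp: Fl_def)
qed

lemma brick_nonempty: "brick S \<psi> \<noteq> {}"
  using brick_iff[of "can \<psi> (\<lambda>_\<in>S. undefined)" \<psi>] by (auto simp: cube_points_eq)

lemma apart_eps: "B.apart (eps \<psi>) (eps \<phi>) \<longleftrightarrow> brick S \<psi> \<inter> brick S \<phi> = {}"
  unfolding B.apart_def eps_image using one_closed by blast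

lemma Fl_apart:
  assumes "F \<subseteq> S" "\<psi> \<in> Fl F d" "\<phi> \<in> Fl F d" "\<psi> \<noteq> \<phi>"
  shows "B.apart (eps \<psi>) (eps \<phi>)"
proof -
  obtain s where "\<psi> s \<noteq> \<phi> s" using assms(4) by blast
  then have "s \<in> F" using assms(2,3) by (cases "s \<in> F") (auto simp: Fl_def)
  then show ?thesis unfolding apart_eps using assms \<open>\<psi> s \<noteq> \<phi> s\<close> by (intro brick_apart[of s]) (auto simp: Fl_def)
qed

lemma part_full:
  assumes F: "finite F" "F \<subseteq> S"
  shows "B.part (eps ` Fl F d)"
proof -
  have "\<exists>m\<in>eps ` Fl F d. y \<in> m ` Yp" if yY: "y \<in> Yp" for y
  proof -
    obtain \<kappa> a where y: "y = (\<kappa>, a)" "\<kappa> \<in> X" "a \<in> carrier G" using yY by (auto simp: Yp_def)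
    have "cylinder F \<kappa> (\<lambda>_. d) \<in> Fl F d" by (auto simp: Fl_def cylinder_def)
    moreover have "y \<in> eps (cylinder F \<kappa> (\<lambda>_. d)) ` Yp" using y in_cylinder by (simp add: eps_image)
    ultimately show ?thesis by blast
  qed
  moreover have "eps ` Fl F d \<subseteq> Mp" using Fl_L[OF F(1)] eps_Mp by blast
  ultimately show ?thesis unfolding B.part_def using finite_Fl[OF F(1)] Fl_apart[OF F(2)] by blast
qed

lemma labels_bounded:
  assumes "finite \<Psi>" "\<Psi> \<subseteq> L"
  shows "\<exists>F d. finite F \<and> F \<subseteq> S \<and> (\<forall>\<psi>\<in>\<Psi>. \<forall>s\<in>S. length (\<psi> s) \<le> (if s \<in> F then d else 0))"
proof -
  define F where "F = (\<Union>\<psi>\<in>\<Psi>. {s \<in> S. \<psi> s \<noteq> []})"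
  have F: "finite F" "F \<subseteq> S" using assms by (auto simp: F_def brick_labels_def)
  define d where "d = Max ((\<lambda>(\<psi>, s). length (\<psi> s)) ` (\<Psi> \<times> F))"
  have "length (\<psi> s) \<le> d" if "\<psi> \<in> \<Psi>" "s \<in> F" for \<psi> s
    unfolding d_def using that assms(1) F(1) by (intro Max_ge) (auto intro!: image_eqI[of _ _ "(\<psi>, s)"])
  moreover have "\<psi> s = []" if "\<psi> \<in> \<Psi>" "s \<in> S" "s \<notin> F" for \<psi> s using that by (auto simp: F_def)
  ultimately show ?thesis using F by (intro exI[of _ F] exI[of _ d]) auto
qed

lemma part_subset_eq:
  assumes "B.part P" "B.part Q" "P \<subseteq> Q"
  shows "P = Q"
proof
  show "Q \<subseteq> P"
  proof
    fix n assume n: "n \<in> Q"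
    obtain y where y: "y \<in> n ` Yp" using B.nonempty by blast
    then have "y \<in> Yp" using B.image_M_subset[OF B.part_M[OF assms(2) n]] by blast
    then obtain m where m: "m \<in> P" "y \<in> m ` Yp" using B.part_cover[OF assms(1)] by blast
    then have "\<not> B.apart m n" using y by (auto simp: B.apart_def)
    then have "m = n" using B.part_apart[OF assms(2) _ n] m assms(3) by blast
    then show "n \<in> P" using m by simp
  qed
qed (rule assms(3))

lemma Lb_eps_inj:
  assumes "F \<subseteq> S" "\<psi> \<in> Lb F d" "\<phi> \<in> Lb F d" "eps \<psi> = eps \<phi>"
  shows "\<psi> = \<phi>"
proof
  fix s
  have "brick S \<psi> \<times> carrier G = brick S \<phi> \<times> carrier G"
    using assms(4) eps_image[of \<psi>] eps_image[of \<phi>] by simp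
  then have b: "brick S \<psi> = brick S \<phi>" using one_closed by blast
  show "\<psi> s = \<phi> s"
  proof (cases "s \<in> F")
    case True
    then have "s \<in> S" using assms by blast
    then have "\<phi> s @ drop (length (\<phi> s)) (\<psi> s) = \<psi> s" "\<psi> s @ drop (length (\<psi> s)) (\<phi> s) = \<phi> s"
      using brick_subset_prefix b by blast+
    then show ?thesis by (metis append_eq_append_conv2 append_self_conv append_eq_conv_conj drop_all le_cases take_all)
  next
    case False
    then show ?thesis using assms by (simp add: Lb_def)
  qed
qed

definition deficit :: "'s set \<Rightarrow> nat \<Rightarrow> ('s \<Rightarrow> bool list) \<Rightarrow> nat" where
  "deficit F d \<psi> = (\<Sum>s\<in>F. d - length (\<psi> s))"

text \<open>Partitions consist of maps, so the label has to be recovered; it is unique by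
  \<open>Lb_eps_inj\<close>. With base 2 a split would leave the total unchanged.\<close>

definition weight :: "'s set \<Rightarrow> nat \<Rightarrow> ('s cantor_point \<times> 'a \<Rightarrow> 's cantor_point \<times> 'a) \<Rightarrow> nat" where
  "weight F d m = 3 ^ deficit F d (THE \<psi>. \<psi> \<in> Lb F d \<and> m = eps \<psi>)"

lemma weight_eps:
  assumes "F \<subseteq> S" "\<psi> \<in> Lb F d"
  shows "weight F d (eps \<psi>) = 3 ^ deficit F d \<psi>"
proof -
  have "(THE \<phi>. \<phi> \<in> Lb F d \<and> eps \<psi> = eps \<phi>) = \<psi>"
  proof (rule the_equality)
    show "\<phi> = \<psi>" if "\<phi> \<in> Lb F d \<and> eps \<psi> = eps \<phi>" for \<phi>
      by (rule Lb_eps_inj[OF assms(1) conjunct1[OF that] assms(2) sym[OF conjunct2[OF that]]])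
  qed (use assms(2) in simp)
  then show ?thesis by (simp add: weight_def)
qed

text \<open>Splitting a brick of deficit \<open>k\<close> replaces \<open>3 ^ k\<close> by \<open>2 * 3 ^ (k - 1)\<close> in the sum of the weights.\<close>

lemma splits_full:
  assumes F: "finite F" "F \<subseteq> S"
  shows "B.part P \<Longrightarrow> P \<subseteq> eps ` Lb F d \<Longrightarrow> B.splits P (eps ` Fl F d)"
proof (induction "\<Sum>m\<in>P. weight F d m" arbitrary: P rule: less_induct)
  case less
  show ?case
  proof (cases "P \<subseteq> eps ` Fl F d")
    case True
    then have "P = eps ` Fl F d" by (rule part_subset_eq[OF less.prems(1) part_full[OF F]])
    then show ?thesis using B.splits_refl by simp
  next
    case False
    then obtain \<psi> where psi: "\<psi> \<in> Lb F d" "eps \<psi> \<in> P" "\<psi> \<notin> Fl F d" using less.prems(2) by blast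
    then obtain s where s: "s \<in> F" "length (\<psi> s) < d" by (auto simp: Lb_def Fl_def order_less_le)
    have sS: "s \<in> S" using s F by blast
    define \<phi> where "\<phi> i = \<psi>(s := \<psi> s @ [i])" for i
    have phi: "\<phi> i \<in> Lb F d" for i using psi s by (auto simp: \<phi>_def Lb_def)
    have step: "eps \<psi> \<circ> ee s i = eps (\<phi> i)" for i
      unfolding ee_def eps_eps by (rule eps_cong) (simp add: cat_def single_def \<phi>_def)
    have def: "deficit F d \<psi> = Suc (deficit F d (\<phi> i))" for i
    proof -
      have "(\<Sum>t\<in>F - {s}. d - length (\<phi> i t)) = (\<Sum>t\<in>F - {s}. d - length (\<psi> t))"
        by (rule sum.cong) (auto simp: \<phi>_def)
      then show ?thesis using s unfolding deficit_def sum.remove[OF F(1) s(1)] by (simp add: \<phi>_def)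
    qed
    let ?Q = "B.spl P (eps \<psi>) s"
    have Q: "?Q = insert (eps (\<phi> False)) (insert (eps (\<phi> True)) (P - {eps \<psi>}))" by (simp only: B.spl_def step)
    have fin: "finite P" using B.part_finite[OF less.prems(1)] .
    \<comment> \<open>An inequality spares the proof that the new members differ from each other and
      from the old ones.\<close>
    have "(\<Sum>m\<in>?Q. weight F d m) \<le> weight F d (eps (\<phi> False)) + (weight F d (eps (\<phi> True)) + (\<Sum>m\<in>P - {eps \<psi>}. weight F d m))"
      unfolding Q using fin by (simp add: sum.insert_if)
    also have "\<dots> < weight F d (eps \<psi>) + (\<Sum>m\<in>P - {eps \<psi>}. weight F d m)"
      using weight_eps[OF F(2) psi(1)] weight_eps[OF F(2) phi] def[of False] def[of True] by simp
    also have "\<dots> = (\<Sum>m\<in>P. weight F d m)" using sum.remove[OF fin psi(2), of "weight F d"] by simp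
    finally have "B.splits ?Q (eps ` Fl F d)"
    proof (rule less.hyps)
      show "B.part ?Q" by (rule B.part_spl[OF less.prems(1) psi(2) sS])
      show "?Q \<subseteq> eps ` Lb F d" unfolding Q using less.prems(2) phi by blast
    qed
    then show ?thesis by (rule B.splits_trans) (rule B.splits_step[OF B.splits_refl psi(2) sS])
  qed
qed

lemma eps_Lb:
  assumes "F \<subseteq> S" "\<forall>s\<in>S. length (\<psi> s) \<le> (if s \<in> F then d else 0)"
  shows "eps \<psi> \<in> eps ` Lb F d"
proof -
  define \<phi> where "\<phi> s = (if s \<in> F then \<psi> s else [])" for s
  have "length (\<psi> s) \<le> d" if "s \<in> F" for s using assms(2)[rule_format, of s] assms(1) that by auto
  then have "\<phi> \<in> Lb F d" by (auto simp: \<phi>_def Lb_def)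
  moreover have "eps \<psi> = eps \<phi>" by (rule eps_cong) (use assms in \<open>force simp: \<phi>_def\<close>)
  ultimately show ?thesis by blast
qed

lemma compact_bricks:
  assumes "\<And>\<kappa>. \<kappa> \<in> X \<Longrightarrow> \<exists>\<psi>\<in>\<Psi>. \<kappa> \<in> brick S \<psi>" "\<Psi> \<subseteq> L"
  shows "\<exists>\<Psi>'\<subseteq>\<Psi>. finite \<Psi>' \<and> (\<forall>\<kappa>\<in>X. \<exists>\<psi>\<in>\<Psi>'. \<kappa> \<in> brick S \<psi>)"
proof -
  have "\<forall>U\<in>brick S ` \<Psi>. openin (cantor_cube S) U" using assms(2) openin_brick by blast
  moreover have "X \<subseteq> \<Union>(brick S ` \<Psi>)" using assms(1) by blast
  ultimately obtain \<F> where F: "finite \<F>" "\<F> \<subseteq> brick S ` \<Psi>" "X \<subseteq> \<Union>\<F>"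
    using compact_cantor_cube[of S] unfolding compact_space_alt by metis
  then obtain \<Psi>' where "\<Psi>' \<subseteq> \<Psi>" "finite \<Psi>'" "\<F> = brick S ` \<Psi>'" by (meson finite_subset_image)
  then show ?thesis using F(3) by (intro exI[of _ \<Psi>']) auto
qed

sublocale B: split_monoid_refine Yp Mp "ee s0 False" "ee s0 True" S ee "theta ` carrier G"
proof
  show "\<exists>x\<in>B.E. \<exists>u\<in>theta ` carrier G. m = x \<circ> u" if "m \<in> Mp" for m
    using that eps_E by (elim Mp_E) blast
  show "\<exists>P. B.part P \<and> (\<forall>m\<in>P. m \<in> B.E \<and> f \<circ> m \<in> Mp)" if f: "f \<in> B.A" for f
  proof -
    \<comment> \<open>The candidates are untwisted, so a twist found locally is composed away.
      Compactness leaves finitely many of them, whose labels some \<open>F\<close> and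
      \<open>d\<close> bound.\<close>
    define \<Psi> where "\<Psi> = {\<psi> \<in> L. f \<circ> eps \<psi> \<in> Mp}"
    have "\<exists>\<psi>\<in>\<Psi>. \<kappa> \<in> brick S \<psi>" if k: "\<kappa> \<in> X" for \<kappa>
    proof -
      have "(\<kappa>, \<one>) \<in> Yp" using k by (simp add: Yp_def)
      then obtain m where m: "m \<in> Mp" "(\<kappa>, \<one>) \<in> m ` Yp" "f \<circ> m \<in> Mp" using B.A_local[OF f] by blast
      obtain \<psi> g where pg: "\<psi> \<in> L" "g \<in> carrier G" "m = eps \<psi> \<circ> theta g" using m(1) by (rule Mp_E)
      have "(f \<circ> m) \<circ> theta (inv g) = f \<circ> eps \<psi> \<circ> (theta g \<circ> theta (inv g))" by (simp only: pg(3) comp_assoc)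
      also have "\<dots> = f \<circ> eps \<psi>" by (simp only: theta_inv[OF pg(2)] comp_id)
      finally have "f \<circ> eps \<psi> \<in> Mp" using Mp_comp[OF m(3) theta_Mp[OF inv_closed[OF pg(2)]]] by simp
      moreover have "\<kappa> \<in> brick S \<psi>" using m(2) unfolding pg(3) Mp_image[OF pg(2)] by blast
      ultimately show ?thesis using pg(1) by (auto simp: \<Psi>_def)
    qed
    then obtain \<Psi>' where P': "\<Psi>' \<subseteq> \<Psi>" "finite \<Psi>'" "\<And>\<kappa>. \<kappa> \<in> X \<Longrightarrow> \<exists>\<psi>\<in>\<Psi>'. \<kappa> \<in> brick S \<psi>"
      using compact_bricks[of \<Psi>] by (auto simp: \<Psi>_def)
    have "\<Psi>' \<subseteq> L" using P'(1) by (auto simp: \<Psi>_def)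
    then obtain F d where Fd: "finite F" "F \<subseteq> S" "\<And>\<psi> s. \<psi> \<in> \<Psi>' \<Longrightarrow> s \<in> S \<Longrightarrow> length (\<psi> s) \<le> (if s \<in> F then d else 0)"
      using labels_bounded[OF P'(2)] by blast
    \<comment> \<open>A grid brick lies in the selected brick through any of its points, because its
      words are at least as long.\<close>
    have "f \<circ> eps \<rho> \<in> Mp" if r: "\<rho> \<in> Fl F d" for \<rho>
    proof -
      obtain \<kappa> where k: "\<kappa> \<in> brick S \<rho>" using brick_nonempty by blast
      then have "\<kappa> \<in> X" by (simp add: brick_def)
      then obtain \<psi> where psi: "\<psi> \<in> \<Psi>'" "\<kappa> \<in> brick S \<psi>" using P'(3) by blast
      have "\<psi> s @ drop (length (\<psi> s)) (\<rho> s) = \<rho> s" if "s \<in> S" for s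
        using k psi(2) Fd(3)[OF psi(1) that] that r
        by (intro prefix_of_comparable[of _ "\<kappa> s"]) (auto simp: brick_def Fl_def split: if_splits)
      then have "eps \<rho> = eps \<psi> \<circ> eps (\<lambda>s. drop (length (\<psi> s)) (\<rho> s))"
        unfolding eps_eps by (intro eps_cong) (simp add: cat_def)
      moreover have "\<rho> \<in> L" using r Fl_L[OF Fd(1)] by blast
      then have "eps (\<lambda>s. drop (length (\<psi> s)) (\<rho> s)) \<in> Mp" by (intro eps_Mp tail_label)
      moreover have "f \<circ> eps \<psi> \<in> Mp" using psi(1) P'(1) by (auto simp: \<Psi>_def)
      ultimately show ?thesis using Mp_comp[of "f \<circ> eps \<psi>"] by (simp only: comp_assoc)
    qed
    moreover have "eps \<rho> \<in> B.E" if "\<rho> \<in> Fl F d" for \<rho> using that Fl_L[OF Fd(1)] eps_E by blast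
    ultimately show ?thesis using part_full[OF Fd(1,2), of d] by blast
  qed
  show "\<exists>T. B.splits {id} T \<and> B.splits P T" if P: "B.part P" "P \<subseteq> B.E" for P
  proof -
    have "P \<subseteq> eps ` L" using P(2) E_eps by blast
    then obtain \<Psi> where Psi: "\<Psi> \<subseteq> L" "finite \<Psi>" "P = eps ` \<Psi>" using finite_subset_image[OF B.part_finite[OF P(1)]] by blast
    \<comment> \<open>Once \<open>F\<close> and \<open>d\<close> bound all labels, \<open>P\<close>
      and the trivial partition both split into the grid \<open>Fl F d\<close>.\<close>
    obtain F d where Fd: "finite F" "F \<subseteq> S" "\<And>\<psi>. \<psi> \<in> \<Psi> \<Longrightarrow> \<forall>s\<in>S. length (\<psi> s) \<le> (if s \<in> F then d else 0)"
      using labels_bounded[OF Psi(2,1)] by blast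
    have "P \<subseteq> eps ` Lb F d" unfolding Psi(3) using eps_Lb[OF Fd(2,3)] by blast
    then have "B.splits P (eps ` Fl F d)" by (rule splits_full[OF Fd(1,2) P(1)])
    moreover have "id \<in> eps ` Lb F d"
      by (rule image_eqI[of _ _ "\<lambda>_. []"]) (simp_all add: Lb_def eps_Nil)
    then have "B.splits {id} (eps ` Fl F d)" by (intro splits_full[OF Fd(1,2) B.part_id]) blast
    ultimately show ?thesis by blast
  qed
qed

section \<open>The isomorphism between the group of piecewise maps and \<open>SVG\<close>\<close>

abbreviation "\<Gamma> \<equiv> SVG G S \<alpha>"

definition toA :: "('s cantor_point \<Rightarrow> 's cantor_point) \<times> ('s cantor_point \<Rightarrow> 'a) \<Rightarrow> 's cantor_point \<times> 'a \<Rightarrow> 's cantor_point \<times> 'a" where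
  "toA x y = (if y \<in> Yp then (fst x (fst y), snd x (fst y) \<otimes> snd y) else y)"

definition fromA :: "('s cantor_point \<times> 'a \<Rightarrow> 's cantor_point \<times> 'a) \<Rightarrow> ('s cantor_point \<Rightarrow> 's cantor_point) \<times> ('s cantor_point \<Rightarrow> 'a)" where
  "fromA f = (\<lambda>\<kappa>\<in>X. fst (f (\<kappa>, \<one>)), \<lambda>\<kappa>\<in>X. snd (f (\<kappa>, \<one>)))"

lemma in_Yp [simp]: "(\<kappa>, a) \<in> Yp \<longleftrightarrow> \<kappa> \<in> X \<and> a \<in> carrier G"
  by (simp add: Yp_def)

lemma Mp_equivariant:
  assumes "m \<in> Mp" "\<kappa> \<in> X" "a \<in> carrier G" "b \<in> carrier G"
  shows "m (\<kappa>, a \<otimes> b) = (fst (m (\<kappa>, a)), snd (m (\<kappa>, a)) \<otimes> b)"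
  using assms by (elim Mp_E) (simp add: eps_def theta_def m_assoc)

text \<open>Elements of \<open>Mp\<close> commute with right multiplication in the second
  coordinate, and this passes to \<open>A\<close> locally. Hence \<open>f\<close> is determined by
  its values at second coordinate 1, which is all that \<open>fromA\<close> reads off.\<close>

lemma A_equivariant:
  assumes f: "f \<in> B.A" and k: "\<kappa> \<in> X" and a: "a \<in> carrier G" and b: "b \<in> carrier G"
  shows "f (\<kappa>, a \<otimes> b) = (fst (f (\<kappa>, a)), snd (f (\<kappa>, a)) \<otimes> b)"
proof -
  obtain m where m: "m \<in> Mp" "(\<kappa>, a) \<in> m ` Yp" "f \<circ> m \<in> Mp" using B.A_local[OF f, of "(\<kappa>, a)"] k a by auto
  obtain \<kappa>' c where c: "\<kappa>' \<in> X" "c \<in> carrier G" "(\<kappa>, a) = m (\<kappa>', c)" using m(2) by auto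
  have "m (\<kappa>', c \<otimes> b) = (\<kappa>, a \<otimes> b)" using Mp_equivariant[OF m(1) c(1,2) b] unfolding c(3)[symmetric] by simp
  then have "f (\<kappa>, a \<otimes> b) = (f \<circ> m) (\<kappa>', c \<otimes> b)" by simp
  also have "\<dots> = (fst ((f \<circ> m) (\<kappa>', c)), snd ((f \<circ> m) (\<kappa>', c)) \<otimes> b)" by (rule Mp_equivariant[OF m(3) c(1,2) b])
  also have "(f \<circ> m) (\<kappa>', c) = f (\<kappa>, a)" by (simp add: c(3))
  finally show ?thesis .
qed

lemma A_equivariant_one:
  assumes "f \<in> B.A" "\<kappa> \<in> X" "a \<in> carrier G"
  shows "f (\<kappa>, a) = (fst (f (\<kappa>, \<one>)), snd (f (\<kappa>, \<one>)) \<otimes> a)"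
  using A_equivariant[OF assms(1,2) one_closed assms(3)] assms(3) by simp

text \<open>Pairs of functions of the right type, without continuity or bricks. Products stay
  inside, so \<open>fromA\<close> can be shown multiplicative before \<open>SVG\<close> is known to
  be closed under products.\<close>

definition shape :: "(('s cantor_point \<Rightarrow> 's cantor_point) \<times> ('s cantor_point \<Rightarrow> 'a)) set" where
  "shape = (X \<rightarrow>\<^sub>E X) \<times> (X \<rightarrow>\<^sub>E carrier G)"

lemma fromA_shape: "f \<in> B.A \<Longrightarrow> fromA f \<in> shape"
  unfolding shape_def fromA_def using B.A_in[of f "(_, \<one>)"] by (fastforce simp: Yp_def)

lemma toA_fromA:
  assumes "f \<in> B.A"
  shows "toA (fromA f) = f"
proof
  fix y
  show "toA (fromA f) y = f y"
  proof (cases "y \<in> Yp")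
    case True
    then obtain \<kappa> a where y: "y = (\<kappa>, a)" "\<kappa> \<in> X" "a \<in> carrier G" by (auto simp: Yp_def)
    then show ?thesis using A_equivariant_one[OF assms y(2,3)] by (simp add: toA_def fromA_def)
  next
    case False
    then show ?thesis using B.A_out[OF assms] by (simp add: toA_def)
  qed
qed

lemma fromA_toA:
  assumes "x \<in> shape"
  shows "fromA (toA x) = x"
proof (rule prod_eqI)
  show "fst (fromA (toA x)) = fst x"
    by (rule extensionalityI[of _ X]) (use assms in \<open>auto simp: fromA_def toA_def shape_def PiE_def\<close>)
  show "snd (fromA (toA x)) = snd x"
    by (rule extensionalityI[of _ X]) (use assms in \<open>auto simp: fromA_def toA_def shape_def PiE_def Pi_iff\<close>)
qed

lemma SVG_shape:
  assumes "x \<in> carrier \<Gamma>"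
  shows "x \<in> shape" "fst x ` X = X" "inj_on (fst x) X"
proof -
  have h: "fst x \<in> extensional X" "homeomorphic_map (cantor_cube S) (cantor_cube S) (fst x)" "snd x \<in> X \<rightarrow>\<^sub>E carrier G"
    using assms by (auto simp: SVG_def SVG_elements_def)
  show "fst x ` X = X" "inj_on (fst x) X"
    using homeomorphic_imp_surjective_map[OF h(2)] homeomorphic_imp_injective_map[OF h(2)] by auto
  then show "x \<in> shape" using h by (cases x) (auto simp: shape_def PiE_def)
qed

lemma shape_apply: "x \<in> shape \<Longrightarrow> \<kappa> \<in> X \<Longrightarrow> fst x \<kappa> \<in> X" "x \<in> shape \<Longrightarrow> \<kappa> \<in> X \<Longrightarrow> snd x \<kappa> \<in> carrier G"
  by (auto simp: shape_def)

lemma toA_in_A: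
  assumes "x \<in> carrier \<Gamma>"
  shows "toA x \<in> B.A"
proof -
  define h where "h = fst x"
  define \<gamma> where "\<gamma> = snd x"
  note sh = SVG_shape[OF assms]
  have hX: "h \<kappa> \<in> X" and gX: "\<gamma> \<kappa> \<in> carrier G" if "\<kappa> \<in> X" for \<kappa> using shape_apply[OF sh(1) that] by (auto simp: h_def \<gamma>_def)
  define k where "k = inv_into X h"
  have k: "k \<kappa> \<in> X" "h (k \<kappa>) = \<kappa>" if "\<kappa> \<in> X" for \<kappa>
    using that sh(2) unfolding k_def h_def by (metis inv_into_into, metis f_inv_into_f)
  have kh: "k (h \<kappa>) = \<kappa>" if "\<kappa> \<in> X" for \<kappa> using sh(3) that unfolding k_def h_def by (rule inv_into_f_f)
  have "(h, \<gamma>) \<in> SVG_elements G S \<alpha>" using assms by (simp add: SVG_def h_def \<gamma>_def)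
  then obtain n \<psi> \<phi> g where D: "brick_partition S n \<psi> \<and> brick_partition S n \<phi> \<and>
      (\<forall>i<n. g i \<in> carrier G \<and> (\<forall>\<kappa>\<in>X. h (can (\<psi> i) \<kappa>) = can (\<phi> i) (cact (g i) \<kappa>)) \<and>
        (\<forall>\<kappa>\<in>brick S (\<psi> i). \<gamma> \<kappa> = g i))"
    unfolding SVG_elements_def by blast
  have d: "brick_partition S n \<psi>" "brick_partition S n \<phi>"
    "\<And>i. i < n \<Longrightarrow> g i \<in> carrier G"
    "\<And>i \<kappa>. i < n \<Longrightarrow> \<kappa> \<in> X \<Longrightarrow> h (can (\<psi> i) \<kappa>) = can (\<phi> i) (cact (g i) \<kappa>)"
    "\<And>i \<kappa>. i < n \<Longrightarrow> \<kappa> \<in> brick S (\<psi> i) \<Longrightarrow> \<gamma> \<kappa> = g i"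
    using D by simp_all
  have toA: "toA x (\<kappa>, a) = (h \<kappa>, \<gamma> \<kappa> \<otimes> a)" if "\<kappa> \<in> X" "a \<in> carrier G" for \<kappa> a
    using that by (simp add: toA_def h_def \<gamma>_def)
  show ?thesis
  proof (rule B.A_I[of "\<lambda>y. if y \<in> Yp then (k (fst y), inv (\<gamma> (k (fst y))) \<otimes> snd y) else y"])
    fix y
    show "(if toA x y \<in> Yp then (k (fst (toA x y)), inv (\<gamma> (k (fst (toA x y)))) \<otimes> snd (toA x y)) else toA x y) = y"
    proof (cases "y \<in> Yp")
      case True
      then obtain \<kappa> a where y: "y = (\<kappa>, a)" "\<kappa> \<in> X" "a \<in> carrier G" by (auto simp: Yp_def)
      then show ?thesis using hX gX by (simp add: toA kh m_assoc[symmetric])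
    next
      case False
      then show ?thesis by (simp add: toA_def)
    qed
    show "toA x (if y \<in> Yp then (k (fst y), inv (\<gamma> (k (fst y))) \<otimes> snd y) else y) = y"
    proof (cases "y \<in> Yp")
      case True
      then obtain \<kappa> a where y: "y = (\<kappa>, a)" "\<kappa> \<in> X" "a \<in> carrier G" by (auto simp: Yp_def)
      then show ?thesis using k gX by (simp add: toA m_assoc[symmetric])
    next
      case False
      then show ?thesis by (simp add: toA_def)
    qed
    show "toA x y = y" if "y \<notin> Yp" using that by (simp add: toA_def)
    assume "y \<in> Yp"
    then obtain \<kappa> a where y: "y = (\<kappa>, a)" "\<kappa> \<in> X" "a \<in> carrier G" by (auto simp: Yp_def)
    then obtain i where i: "i < n" "\<kappa> \<in> brick S (\<psi> i)" using d(1) by (auto simp: brick_partition_def)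
    have lab: "\<psi> i \<in> L" "\<phi> i \<in> L" using d(1,2) i by (auto simp: brick_partition_def)
    have "toA x \<circ> eps (\<psi> i) = eps (\<phi> i) \<circ> theta (g i)"
    proof
      fix z
      show "(toA x \<circ> eps (\<psi> i)) z = (eps (\<phi> i) \<circ> theta (g i)) z"
      proof (cases "z \<in> Yp")
        case True
        then obtain \<kappa>' b where z: "z = (\<kappa>', b)" "\<kappa>' \<in> X" "b \<in> carrier G" by (auto simp: Yp_def)
        have "\<gamma> (can (\<psi> i) \<kappa>') = g i" using d(5)[OF i(1)] z brick_iff by blast
        then show ?thesis using z d(3,4)[OF i(1)] by (simp add: eps_def theta_def toA)
      next
        case False
        then show ?thesis by (simp add: eps_def theta_def toA_def)
      qed
    qed
    then have "toA x \<circ> eps (\<psi> i) \<in> Mp" using Mp_I[OF lab(2) d(3)[OF i(1)]] by (simp only:)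
    moreover have "y \<in> eps (\<psi> i) ` Yp" using i y by (simp add: eps_image)
    ultimately show "\<exists>m\<in>Mp. y \<in> m ` Yp \<and> toA x \<circ> m \<in> Mp" using eps_Mp[OF lab(1)] by blast
  qed
qed

text \<open>Only the images of the members are compared with bricks, so the lemma serves the
  untwisted partition of the domain as well as its image under an element of \<open>A\<close>, whose
  members carry twists.\<close>

lemma part_eps_brick_partition:
  assumes P: "B.part P" and n: "bij_betw f {..<n} P" and \<psi>: "\<And>i. i < n \<Longrightarrow> \<psi> i \<in> L"
    and img: "\<And>i. i < n \<Longrightarrow> f i ` Yp = brick S (\<psi> i) \<times> carrier G"
  shows "brick_partition S n \<psi>"
  unfolding brick_partition_def
proof (intro conjI allI impI)
  have fP: "f i \<in> P" if "i < n" for i using n that by (auto simp: bij_betw_def)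
  show "disjoint_family_on (\<lambda>i. brick S (\<psi> i)) {..<n}"
    unfolding disjoint_family_on_def
  proof (intro ballI impI)
    fix i j assume ij: "i \<in> {..<n}" "j \<in> {..<n}" "i \<noteq> j"
    then have "f i \<noteq> f j" using n by (auto simp: bij_betw_def inj_on_def)
    then have "f i ` Yp \<inter> f j ` Yp = {}" using B.part_apart[OF P fP fP, of i j] ij by (simp add: B.apart_def)
    then show "brick S (\<psi> i) \<inter> brick S (\<psi> j) = {}" using img ij one_closed by fastforce
  qed
  show "(\<Union>i<n. brick S (\<psi> i)) = X"
  proof
    show "(\<Union>i<n. brick S (\<psi> i)) \<subseteq> X" by (auto simp: brick_def)
    show "X \<subseteq> (\<Union>i<n. brick S (\<psi> i))"
    proof
      fix \<kappa> assume "\<kappa> \<in> X"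
      then have "(\<kappa>, \<one>) \<in> Yp" by simp
      then obtain m where m: "m \<in> P" "(\<kappa>, \<one>) \<in> m ` Yp" using B.part_cover[OF P] by blast
      then obtain i where "i < n" "m = f i" using n by (auto simp: bij_betw_def)
      then show "\<kappa> \<in> (\<Union>i<n. brick S (\<psi> i))" using m(2) img by auto
    qed
  qed
qed (rule \<psi>)

lemma brick_map_continuous:
  assumes \<psi>: "brick_partition S n \<psi>" and h: "\<And>\<kappa>. \<kappa> \<in> X \<Longrightarrow> h \<kappa> \<in> X"
    and g: "\<And>i. i < n \<Longrightarrow> g i \<in> carrier G"
    and hc: "\<And>i \<kappa>. i < n \<Longrightarrow> \<kappa> \<in> X \<Longrightarrow> h (can (\<psi> i) \<kappa>) = can (\<phi> i) (cact (g i) \<kappa>)"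
  shows "continuous_map (cantor_cube S) (cantor_cube S) h"
proof -
  have "continuous_map (cantor_cube S) (discrete_topology UNIV) (\<lambda>\<kappa>. h \<kappa> s k)" if s: "s \<in> S" for s k
    unfolding continuous_map
  proof (intro conjI allI impI)
    fix U :: "bool set"
    define t where "t i = \<alpha> (inv (g i)) s" for i
    \<comment> \<open>On the brick of \<open>\<psi> i\<close>, letter \<open>k\<close> of
      \<open>h \<kappa>\<close> at \<open>s\<close> is either a letter of the prefix
      \<open>\<phi> i s\<close>, or a letter of \<kappa> at \<open>t i\<close>, whose position is
      found by removing that prefix and restoring the one of \<open>\<psi> i\<close>.\<close>
    define V where "V i = (if k < length (\<phi> i s) then (if \<phi> i s ! k \<in> U then X else {})
      else {\<kappa> \<in> X. \<kappa> (t i) (k - length (\<phi> i s) + length (\<psi> i (t i))) \<in> U})" for i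
    have t: "t i \<in> S" if "i < n" for i using g[OF that] s by (simp add: t_def)
    have "openin (cantor_cube S) (V i)" if "i < n" for i
      using openin_coordinate[OF t[OF that], of _ U] openin_topspace[of "cantor_cube S"] by (simp add: V_def del: openin_topspace)
    moreover have "openin (cantor_cube S) (brick S (\<psi> i))" if "i < n" for i
      using \<psi> that by (intro openin_brick) (simp add: brick_partition_def)
    ultimately have "openin (cantor_cube S) (\<Union>i<n. brick S (\<psi> i) \<inter> V i)"
      by (intro openin_Union) (auto intro!: openin_Int)
    moreover have "{\<kappa> \<in> X. h \<kappa> s k \<in> U} = (\<Union>i<n. brick S (\<psi> i) \<inter> V i)"
    proof -
      have iff: "h \<kappa> s k \<in> U \<longleftrightarrow> \<kappa> \<in> V i" if i: "i < n" and k: "\<kappa> \<in> brick S (\<psi> i)" for i \<kappa>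
      proof -
        obtain \<kappa>' where k': "\<kappa>' \<in> X" "\<kappa> = can (\<psi> i) \<kappa>'" using k brick_iff by blast
        have "h \<kappa> s k = prepend (\<phi> i s) (\<kappa>' (t i)) k" using s by (simp add: k'(2) hc[OF i k'(1)] t_def)
        then show ?thesis using t[OF i] k' by (auto simp: V_def prepend_def)
      qed
      have "X = (\<Union>i<n. brick S (\<psi> i))" using \<psi> by (simp add: brick_partition_def)
      then show ?thesis using iff by blast
    qed
    ultimately show "openin (cantor_cube S) {\<kappa> \<in> X. h \<kappa> s k \<in> U}" by simp
  qed auto
  then have "continuous_map (cantor_cube S) cantor_space (\<lambda>\<kappa>. h \<kappa> s)" if "s \<in> S" for s
    unfolding cantor_space_def continuous_map_componentwise_UNIV using that by blast
  moreover have "h ` X \<subseteq> extensional S" using h by (auto simp: cube_points_eq)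
  ultimately show ?thesis
    by (subst (2) cantor_cube_def) (simp add: continuous_map_componentwise)
qed

lemma fromA_in_SVG:
  assumes f: "f \<in> B.A"
  shows "fromA f \<in> carrier \<Gamma>"
proof -
  define h where "h = fst (fromA f)"
  define \<gamma> where "\<gamma> = snd (fromA f)"
  have sh: "h \<in> X \<rightarrow>\<^sub>E X" "\<gamma> \<in> X \<rightarrow>\<^sub>E carrier G" using fromA_shape[OF f] by (auto simp: shape_def h_def \<gamma>_def)
  have f1: "f (\<kappa>, \<one>) = (h \<kappa>, \<gamma> \<kappa>)" if "\<kappa> \<in> X" for \<kappa> using that by (simp add: h_def \<gamma>_def fromA_def)
  have fa: "f (\<kappa>, a) = (h \<kappa>, \<gamma> \<kappa> \<otimes> a)" if "\<kappa> \<in> X" "a \<in> carrier G" for \<kappa> a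
    using A_equivariant_one[OF f that] f1[OF that(1)] by simp
  have gc: "\<gamma> \<kappa> \<in> carrier G" and hX: "h \<kappa> \<in> X" if "\<kappa> \<in> X" for \<kappa> using sh that by auto
  have inj: "inj_on h X"
  proof (rule inj_onI)
    fix \<kappa> \<kappa>' assume k: "\<kappa> \<in> X" "\<kappa>' \<in> X" "h \<kappa> = h \<kappa>'"
    \<comment> \<open>The second coordinate compensates for the difference between the two values of
      \<gamma>, so injectivity of \<open>f\<close> yields that of \<open>h\<close>.\<close>
    have "f (\<kappa>', inv (\<gamma> \<kappa>') \<otimes> \<gamma> \<kappa>) = f (\<kappa>, \<one>)"
      using k gc by (simp add: fa m_assoc[symmetric])
    then show "\<kappa> = \<kappa>'" using bij_is_inj[OF B.A_bij[OF f]] by (auto dest: injD)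
  qed
  have surj: "h ` X = X"
  proof
    show "h ` X \<subseteq> X" using hX by blast
    show "X \<subseteq> h ` X"
    proof
      fix \<kappa> assume k: "\<kappa> \<in> X"
      have "finv f (\<kappa>, \<one>) \<in> Yp" using B.A_in[OF B.A_inv[OF f], of "(\<kappa>, \<one>)"] k by simp
      then obtain \<kappa>' a where a: "finv f (\<kappa>, \<one>) = (\<kappa>', a)" "\<kappa>' \<in> X" "a \<in> carrier G" by (auto simp: Yp_def)
      have "(\<kappa>, \<one>) = f (\<kappa>', a)" using B.A_inv_apply(2)[OF f, of "(\<kappa>, \<one>)"] a(1) by simp
      then have "\<kappa> = h \<kappa>'" using fa[OF a(2,3)] by simp
      then show "\<kappa> \<in> h ` X" using a(2) by blast
    qed
  qed
  obtain P where P: "B.part P" "\<And>m. m \<in> P \<Longrightarrow> m \<in> B.E" "\<And>m. m \<in> P \<Longrightarrow> f \<circ> m \<in> Mp" using B.domain_partition[OF f] by blast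
  define n where "n = card P"
  obtain e where e: "bij_betw e {..<n} P"
    using ex_bij_betw_nat_finite[OF B.part_finite[OF P(1)]] by (auto simp: n_def atLeast0LessThan)
  have eP: "e i \<in> P" if "i < n" for i using e that by (auto simp: bij_betw_def)
  have "\<forall>i. \<exists>\<psi>. i < n \<longrightarrow> \<psi> \<in> L \<and> e i = eps \<psi>" using eP P(2) E_eps by blast
  then obtain \<psi> where \<psi>: "\<And>i. i < n \<Longrightarrow> \<psi> i \<in> L" "\<And>i. i < n \<Longrightarrow> e i = eps (\<psi> i)" by metis
  have "\<forall>i. \<exists>\<phi> g. i < n \<longrightarrow> \<phi> \<in> L \<and> g \<in> carrier G \<and> f \<circ> e i = eps \<phi> \<circ> theta g"
    using eP P(3) by (metis Mp_E)
  then obtain \<phi> g where \<phi>: "\<And>i. i < n \<Longrightarrow> \<phi> i \<in> L" "\<And>i. i < n \<Longrightarrow> g i \<in> carrier G"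
    "\<And>i. i < n \<Longrightarrow> f \<circ> e i = eps (\<phi> i) \<circ> theta (g i)" by metis
  have part\<psi>: "brick_partition S n \<psi>"
    by (rule part_eps_brick_partition[OF P(1) e \<psi>(1)]) (simp_all add: \<psi>(2) eps_image)
  have part\<phi>: "brick_partition S n \<phi>"
  proof (rule part_eps_brick_partition[OF B.A_image_part[OF f P(1,3)]])
    show "bij_betw (\<lambda>i. f \<circ> e i) {..<n} ((\<circ>) f ` P)"
      using bij_betw_trans[OF e inj_on_imp_bij_betw[OF inj_on_subset[OF B.A_comp_inj[OF f] subset_UNIV]]] by (simp add: comp_def)
    show "\<phi> i \<in> L" if "i < n" for i using \<phi>(1) that .
    show "(f \<circ> e i) ` Yp = brick S (\<phi> i) \<times> carrier G" if "i < n" for i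
      unfolding \<phi>(3)[OF that] by (rule Mp_image[OF \<phi>(2)[OF that]])
  qed
  have val: "h (can (\<psi> i) \<kappa>) = can (\<phi> i) (cact (g i) \<kappa>)" "\<gamma> (can (\<psi> i) \<kappa>) = g i" if i: "i < n" and k: "\<kappa> \<in> X" for i \<kappa>
  proof -
    have "f (can (\<psi> i) \<kappa>, \<one>) = (f \<circ> e i) (\<kappa>, \<one>)" using k by (simp add: \<psi>(2)[OF i] eps_def)
    also have "\<dots> = (can (\<phi> i) (cact (g i) \<kappa>), g i)" unfolding \<phi>(3)[OF i] using k \<phi>(2)[OF i] by (simp add: eps_def theta_def)
    finally show "h (can (\<psi> i) \<kappa>) = can (\<phi> i) (cact (g i) \<kappa>)" "\<gamma> (can (\<psi> i) \<kappa>) = g i" using f1[of "can (\<psi> i) \<kappa>"] by simp_all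
  qed
  have "continuous_map (cantor_cube S) (cantor_cube S) h"
    by (rule brick_map_continuous[OF part\<psi> hX \<phi>(2) val(1)])
  then have homeo: "homeomorphic_map (cantor_cube S) (cantor_cube S) h"
    by (rule continuous_imp_homeomorphic_map[OF _ compact_cantor_cube Hausdorff_cantor_cube surj inj])
  have gam: "\<gamma> \<kappa> = g i" if "i < n" "\<kappa> \<in> brick S (\<psi> i)" for i \<kappa>
  proof -
    obtain \<kappa>' where "\<kappa>' \<in> X" "\<kappa> = can (\<psi> i) \<kappa>'" using \<open>\<kappa> \<in> brick S (\<psi> i)\<close> brick_iff by blast
    then show ?thesis using val(2)[OF \<open>i < n\<close>] by simp
  qed
  have "(h, \<gamma>) \<in> SVG_elements G S \<alpha>"
    unfolding SVG_elements_def
    apply (clarify, intro conjI)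
       apply (use sh in \<open>simp add: PiE_def\<close>)
      apply (rule homeo)
     apply (rule sh(2))
    apply (intro exI conjI allI impI ballI)
         apply (rule part\<psi>, rule part\<phi>, erule \<phi>(2), erule (1) val(1), erule (1) gam)
    done
  then show ?thesis by (simp add: SVG_def h_def \<gamma>_def)
qed

lemma toA_mult:
  assumes "x \<in> shape" "y \<in> shape"
  shows "toA (x \<otimes>\<^bsub>\<Gamma>\<^esub> y) = toA x \<circ> toA y"
proof
  fix z
  show "toA (x \<otimes>\<^bsub>\<Gamma>\<^esub> y) z = (toA x \<circ> toA y) z"
  proof (cases "z \<in> Yp")
    case True
    then obtain \<kappa> a where "z = (\<kappa>, a)" "\<kappa> \<in> X" "a \<in> carrier G" by (auto simp: Yp_def)
    then show ?thesis using shape_apply[OF assms(1)] shape_apply[OF assms(2)]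
      by (simp add: toA_def SVG_def case_prod_beta compose_def m_assoc)
  next
    case False
    then show ?thesis by (simp add: toA_def)
  qed
qed

lemma mult_shape: "x \<in> shape \<Longrightarrow> y \<in> shape \<Longrightarrow> x \<otimes>\<^bsub>\<Gamma>\<^esub> y \<in> shape"
  using shape_apply by (auto simp: SVG_def case_prod_beta compose_def shape_def PiE_def Pi_def)

lemma fromA_comp:
  assumes "f \<in> B.A" "g \<in> B.A"
  shows "fromA (f \<circ> g) = fromA f \<otimes>\<^bsub>\<Gamma>\<^esub> fromA g"
proof -
  have "toA (fromA f \<otimes>\<^bsub>\<Gamma>\<^esub> fromA g) = f \<circ> g"
    using toA_mult[OF fromA_shape[OF assms(1)] fromA_shape[OF assms(2)]] by (simp only: toA_fromA assms)
  then show ?thesis using fromA_toA[OF mult_shape[OF fromA_shape[OF assms(1)] fromA_shape[OF assms(2)]]] by simp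
qed

lemma fromA_toA_SVG: "x \<in> carrier \<Gamma> \<Longrightarrow> fromA (toA x) = x"
  using SVG_shape fromA_toA by blast

lemma fromA_iso: "fromA \<in> iso B.PG \<Gamma>"
proof (rule isoI)
  show "fromA \<in> hom B.PG \<Gamma>" by (rule homI) (simp_all only: B.PG_simps fromA_in_SVG fromA_comp)
  show "bij_betw fromA (carrier B.PG) (carrier \<Gamma>)"
    by (rule bij_betwI[of _ _ _ toA]) (auto simp: fromA_in_SVG toA_in_A toA_fromA fromA_toA_SVG)
qed

lemma one_SVG: "fromA id = \<one>\<^bsub>\<Gamma>\<^esub>"
  by (simp add: fromA_def SVG_def cong: restrict_cong)

text \<open>Transported from \<open>PG\<close> along the isomorphism. The transport puts the image
  of the identity in place of \<open>one\<close>, and \<open>one_SVG\<close> shows that nothing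
  changes.\<close>

lemma group_SVG: "group \<Gamma>"
proof -
  have "group (\<Gamma>\<lparr>one := fromA \<one>\<^bsub>B.PG\<^esub>\<rparr>)" by (rule group.iso_imp_img_group[OF B.group_PG fromA_iso])
  moreover have "\<Gamma>\<lparr>one := fromA \<one>\<^bsub>B.PG\<^esub>\<rparr> = \<Gamma>" by (simp only: B.PG_simps one_SVG) simp
  ultimately show ?thesis by simp
qed

end

theorem theorem6p4:
  fixes G :: "('g, 'm) monoid_scheme" and S :: "'s set" and \<alpha> :: "'g \<Rightarrow> 's \<Rightarrow> 's"
  assumes "group_action G S \<alpha>" and "S \<noteq> {}"
  shows "property_NL TYPE('x) (SVG G S \<alpha>)"
proof -
  interpret twisted G S \<alpha> by (intro twisted.intro twisted_axioms.intro assms)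
  have hom: "fromA \<in> hom B.PG \<Gamma>" using fromA_iso by (simp add: iso_def)
  have no_lox: "\<not> hyperbolic_metric_group.lox \<Gamma> D \<delta> g"
    if D: "hyperbolic_metric_group \<Gamma> D \<delta>" and g: "g \<in> carrier \<Gamma>" for D \<delta> g
  proof -
    have "hyperbolic_brick_group Yp Mp (ee s0 False) (ee s0 True) (\<lambda>a b. D (fromA a) (fromA b)) \<delta>"
      by (intro hyperbolic_brick_group.intro hyperbolic_brick_group_axioms.intro B.brick_monoid_axioms
          hyperbolic_metric_group_pullback(1)[OF D B.group_PG hom] B.homomorphism_vanishes)
    then have "\<not> hyperbolic_metric_group.lox B.PG (\<lambda>a b. D (fromA a) (fromA b)) \<delta> (toA g)"
      using toA_in_A[OF g] by (rule hyperbolic_brick_group.not_lox)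
    then show ?thesis
      using hyperbolic_metric_group_pullback(2)[OF D B.group_PG hom, of "toA g"] toA_in_A[OF g]
      by (simp add: fromA_toA_SVG[OF g])
  qed
  show ?thesis
    unfolding property_NL_def
    by (intro conjI allI impI group_SVG no_loxodromics_imp_elliptic_or_parabolic no_lox)
qed

end
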